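(* Let $\Bbbk$ be a field of arbitrary characteristic and let $v,w\in S_n$. With respect to the term order $\prec$, the essential minors of $I_{v,w}$ form a Gr\"obner basis of the Kazhdan--Lusztig ideal $I_{v,w}\subseteq \Bbbk[\mathbf{z}^{(v)}]$.
   Context: Positions in an $n\times n$ matrix are written $(i,j)$, meaning the $i$-th row counted from the BOTTOM and the $j$-th column counted from the left. For $v\in S_n$, let $Z^{(v)}$ be the $n\times n$ matrix such that for each $j$: the entry at $(n-v(j)+1,j)$ is $1$; the entries at positions $(n-v(j)+1,a)$ with $a>j$ and at positions $(b,j)$ with $b>n-v(j)+1$ are $0$; every remaining entry, at position $(i,j)$, is a distinct indeterminate $z_{ij}$. Let $\mathbf{z}^{(v)}$ be the set of these indeterminates. (Their positions form the Rothe diagram $D(u)=\{(i,j): i<n-u(j)+1,\ j<u^{-1}(n-i+1)\}$ for $u=v$.) For $w\in S_n$ let $r^w_{ij}=\#\{k\le j : w(k)\ge n-i+1\}$. Let $Z^{(v)}_{ij}$ be the submatrix of $Z^{(v)}$ consisting of the bottom $i$ rows and leftmost $j$ columns. The Kazhdan--Lusztig ideal $I_{v,w}\subseteq\Bbbk[\mathbf{z}^{(v)}]$ is generated by all minors of size $1+r^w_{ij}$ of $Z^{(v)}_{ij}$, for all $1\le i,j\le n$. The essential set of $w$ is $\mathcal{E}(w)=\{(i,j)\in D(w): (i+1,j)\notin D(w),\ (i,j+1)\notin D(w)\}$, and the essential minors of $I_{v,w}$ are the minors of size $1+r^w_{ij}$ of $Z^{(v)}_{ij}$ for $(i,j)\in\mathcal{E}(w)$.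 The term order $\prec$ is the pure lexicographic order on monomials in $\mathbf{z}^{(v)}$ induced by favoring variables further to the right, breaking ties in a column by favoring variables further down: $z_{ij}\prec z_{kl}$ if $j<l$, or if $j=l$ and $i>k$. The leading term is the $\prec$-largest term. *)

theory Defs
  imports
    "HOL-Library.Poly_Mapping"
    "HOL-Combinatorics.Permutations"
    "HOL-Algebra.Ideal"
    "Jordan_Normal_Form.Determinant"
    "Jordan_Normal_Form.DL_Submatrix"
begin

section \<open>Polynomials in indeterminates indexed by matrix positions\<close>

text \<open>The position \<open>(i, j)\<close> is row \<open>i\<close>, counted from the bottom and starting at 1, and
  column \<open>j\<close>, counted from the left and starting at 1.\<close>

type_synonym pos = "nat \<times> nat"
type_synonym monom = "pos \<Rightarrow>\<^sub>0 nat"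
type_synonym 'a pol = "monom \<Rightarrow>\<^sub>0 'a"

definition indet :: "pos \<Rightarrow> 'a::field pol" where
  "indet x = Poly_Mapping.single (Poly_Mapping.single x 1) 1"

text \<open>The type \<^typ>\<open>'a pol\<close> has an indeterminate for every pair of naturals; the polynomial ring
  in the indeterminates at the positions in \<open>V\<close> is the subring of polynomials that only
  involve these.\<close>

definition pol_ring :: "pos set \<Rightarrow> 'a::field pol ring" where
  "pol_ring V = \<lparr>carrier = {p. \<forall>m\<in>Poly_Mapping.keys p. Poly_Mapping.keys m \<subseteq> V},
     monoid.mult = (*), one = 1, zero = 0, add = (+)\<rparr>"

lemma pol_ring_simps [simp]:
  "carrier (pol_ring V) = {p. \<forall>m\<in>Poly_Mapping.keys p. Poly_Mapping.keys m \<subseteq> V}"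
  "x \<otimes>\<^bsub>pol_ring V\<^esub> y = x * y" "\<one>\<^bsub>pol_ring V\<^esub> = 1" "\<zero>\<^bsub>pol_ring V\<^esub> = 0" "x \<oplus>\<^bsub>pol_ring V\<^esub> y = x + y"
  by (simp_all add: pol_ring_def)

lemma cring_pol_ring: "cring (pol_ring V :: 'a::field pol ring)"
proof (rule cringI)
  have plus: "x + y \<in> carrier (pol_ring V)"
    if "x \<in> carrier (pol_ring V)" "y \<in> carrier (pol_ring V)" for x y :: "'a pol"
    using that Poly_Mapping.keys_add[of x y] by auto
  have times: "x * y \<in> carrier (pol_ring V)"
    if "x \<in> carrier (pol_ring V)" "y \<in> carrier (pol_ring V)" for x y :: "'a pol"
  proof -
    have "Poly_Mapping.keys m \<subseteq> V" if m: "m \<in> Poly_Mapping.keys (x * y)" for m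
    proof -
      obtain a b where "m = a + b" "a \<in> Poly_Mapping.keys x" "b \<in> Poly_Mapping.keys y"
        using m keys_mult[of x y] by auto
      then show ?thesis
        using that Poly_Mapping.keys_add[of a b]
          \<open>x \<in> carrier (pol_ring V)\<close> \<open>y \<in> carrier (pol_ring V)\<close> by fastforce
    qed
    then show ?thesis by simp
  qed
  show "abelian_group (pol_ring V :: 'a pol ring)"
  proof (rule abelian_groupI)
    fix x y :: "'a pol" assume "x \<in> carrier (pol_ring V)" "y \<in> carrier (pol_ring V)"
    then show "x \<oplus>\<^bsub>pol_ring V\<^esub> y \<in> carrier (pol_ring V)"
      using plus by (simp only: pol_ring_simps(5))
  next
    fix x :: "'a pol" assume "x \<in> carrier (pol_ring V)"
    then show "\<exists>y\<in>carrier (pol_ring V). y \<oplus>\<^bsub>pol_ring V\<^esub> x = \<zero>\<^bsub>pol_ring V\<^esub>"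
      by (intro bexI[of _ "- x"]) auto
  qed (simp_all add: add.assoc add.commute)
  show "comm_monoid (pol_ring V :: 'a pol ring)"
  proof (rule comm_monoidI)
    fix x y :: "'a pol" assume "x \<in> carrier (pol_ring V)" "y \<in> carrier (pol_ring V)"
    then show "x \<otimes>\<^bsub>pol_ring V\<^esub> y \<in> carrier (pol_ring V)"
      using times by (simp only: pol_ring_simps(2))
  qed (simp_all add: mult.assoc mult.commute)
qed (simp add: distrib_right)


section \<open>Term orders, leading terms and Groebner bases\<close>

definition indet_less :: "pos \<Rightarrow> pos \<Rightarrow> bool" where
  "indet_less x y \<longleftrightarrow> (case (x, y) of ((i, j), (k, l)) \<Rightarrow> j < l \<or> (j = l \<and> i > k))"

definition lex_less :: "monom \<Rightarrow> monom \<Rightarrow> bool" where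
  "lex_less m m' \<longleftrightarrow> (\<exists>x. Poly_Mapping.lookup m x < Poly_Mapping.lookup m' x \<and>
     (\<forall>y. indet_less x y \<longrightarrow> Poly_Mapping.lookup m y = Poly_Mapping.lookup m' y))"

definition lead_monom :: "(monom \<Rightarrow> monom \<Rightarrow> bool) \<Rightarrow> 'a::field pol \<Rightarrow> monom" where
  "lead_monom prec p = (THE m. m \<in> Poly_Mapping.keys p \<and>
     (\<forall>m'\<in>Poly_Mapping.keys p. m' \<noteq> m \<longrightarrow> prec m' m))"

text \<open>Only meaningful for nonzero polynomials.\<close>

definition lead_term :: "(monom \<Rightarrow> monom \<Rightarrow> bool) \<Rightarrow> 'a::field pol \<Rightarrow> 'a pol" where
  "lead_term prec p =
     Poly_Mapping.single (lead_monom prec p) (Poly_Mapping.lookup p (lead_monom prec p))"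

definition groebner_basis ::
    "pos set \<Rightarrow> (monom \<Rightarrow> monom \<Rightarrow> bool) \<Rightarrow> 'a::field pol set \<Rightarrow> 'a pol set \<Rightarrow> bool" where
  "groebner_basis V prec I G \<longleftrightarrow> finite G \<and> G \<subseteq> I \<and>
     Idl\<^bsub>pol_ring V\<^esub> (lead_term prec ` (G - {0})) = Idl\<^bsub>pol_ring V\<^esub> (lead_term prec ` (I - {0}))"

lemma indet_less_linear: "indet_less x y \<or> x = y \<or> indet_less y x"
  by (auto simp: indet_less_def split: prod.splits)

lemma indet_less_trans: "indet_less x y \<Longrightarrow> indet_less y z \<Longrightarrow> indet_less x z"
  by (auto simp: indet_less_def split: prod.splits)

lemma indet_less_irrefl: "\<not> indet_less x x"
  by (auto simp: indet_less_def split: prod.splits)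

lemma indet_less_finite_max:
  assumes "finite A" "A \<noteq> {}"
  shows "\<exists>x\<in>A. \<forall>y\<in>A. y \<noteq> x \<longrightarrow> indet_less y x"
  using assms
proof (induction A rule: finite_ne_induct)
  case (insert a A)
  then obtain x where "x \<in> A" "\<forall>y\<in>A. y \<noteq> x \<longrightarrow> indet_less y x" by blast
  then show ?case
    using indet_less_linear[of a x] by (metis indet_less_trans insert_iff)
qed simp

lemma lex_less_linear: "lex_less m m' \<or> m = m' \<or> lex_less m' m"
proof (cases "m = m'")
  case False
  define A where "A = {x. Poly_Mapping.lookup m x \<noteq> Poly_Mapping.lookup m' x}"
  have "A \<subseteq> Poly_Mapping.keys m \<union> Poly_Mapping.keys m'"
    by (auto simp: A_def in_keys_iff)
  then have "finite A" by (rule finite_subset) simp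
  moreover have "A \<noteq> {}" using False by (auto simp: A_def intro: poly_mapping_eqI)
  ultimately obtain x where x: "x \<in> A" "\<forall>y\<in>A. y \<noteq> x \<longrightarrow> indet_less y x"
    using indet_less_finite_max by blast
  have "Poly_Mapping.lookup m y = Poly_Mapping.lookup m' y" if "indet_less x y" for y
    using x that indet_less_trans indet_less_irrefl by (metis (mono_tags, lifting) A_def mem_Collect_eq)
  then show ?thesis
    using x(1) unfolding lex_less_def A_def by (metis (mono_tags, lifting) linorder_neq_iff mem_Collect_eq)
qed simp

lemma lex_less_irrefl: "\<not> lex_less m m"
  by (simp add: lex_less_def)

lemma lex_less_trans:
  assumes "lex_less a b" "lex_less b c"
  shows "lex_less a c"
proof -
  obtain x where x: "Poly_Mapping.lookup a x < Poly_Mapping.lookup b x"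
    "\<forall>y. indet_less x y \<longrightarrow> Poly_Mapping.lookup a y = Poly_Mapping.lookup b y"
    using assms(1) unfolding lex_less_def by blast
  obtain z where z: "Poly_Mapping.lookup b z < Poly_Mapping.lookup c z"
    "\<forall>y. indet_less z y \<longrightarrow> Poly_Mapping.lookup b y = Poly_Mapping.lookup c y"
    using assms(2) unfolding lex_less_def by blast
  consider "indet_less x z" | "x = z" | "indet_less z x"
    using indet_less_linear by blast
  then show ?thesis
  proof cases
    case 1
    have "Poly_Mapping.lookup a z < Poly_Mapping.lookup c z"
      using x(2)[rule_format, OF 1] z(1) by simp
    moreover have "Poly_Mapping.lookup a y = Poly_Mapping.lookup c y" if "indet_less z y" for y
      using x(2)[rule_format, OF indet_less_trans[OF 1 that]] z(2)[rule_format, OF that] by simp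
    ultimately show ?thesis unfolding lex_less_def by blast
  next
    case 2
    have "Poly_Mapping.lookup a x < Poly_Mapping.lookup c x"
      using x(1) z(1) 2 by simp
    moreover have "Poly_Mapping.lookup a y = Poly_Mapping.lookup c y" if "indet_less x y" for y
      using x(2)[rule_format, OF that] z(2)[rule_format, of y] that 2 by simp
    ultimately show ?thesis unfolding lex_less_def by blast
  next
    case 3
    have "Poly_Mapping.lookup a x < Poly_Mapping.lookup c x"
      using x(1) z(2)[rule_format, OF 3] by simp
    moreover have "Poly_Mapping.lookup a y = Poly_Mapping.lookup c y" if "indet_less x y" for y
      using x(2)[rule_format, OF that] z(2)[rule_format, OF indet_less_trans[OF 3 that]] by simp
    ultimately show ?thesis unfolding lex_less_def by blast
  qed
qed

lemma lead_monom_lex: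
  fixes p :: "'a::field pol"
  assumes "p \<noteq> 0"
  shows "lead_monom lex_less p \<in> Poly_Mapping.keys p"
    and "\<forall>m\<in>Poly_Mapping.keys p. m \<noteq> lead_monom lex_less p \<longrightarrow> lex_less m (lead_monom lex_less p)"
proof -
  have max: "\<exists>x\<in>A. \<forall>y\<in>A. y \<noteq> x \<longrightarrow> lex_less y x" if "finite A" "A \<noteq> {}" for A
    using that
  proof (induction A rule: finite_ne_induct)
    case (insert a A)
    then obtain x where "x \<in> A" "\<forall>y\<in>A. y \<noteq> x \<longrightarrow> lex_less y x" by blast
    then show ?case
      using lex_less_linear[of a x] by (metis lex_less_trans insert_iff)
  qed simp
  obtain m where m: "m \<in> Poly_Mapping.keys p"
    "\<forall>m'\<in>Poly_Mapping.keys p. m' \<noteq> m \<longrightarrow> lex_less m' m"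
    using max[of "Poly_Mapping.keys p"] assms by auto
  have "\<exists>!m. m \<in> Poly_Mapping.keys p \<and> (\<forall>m'\<in>Poly_Mapping.keys p. m' \<noteq> m \<longrightarrow> lex_less m' m)"
  proof (rule ex1I[of _ m])
    fix m' assume "m' \<in> Poly_Mapping.keys p \<and>
      (\<forall>m''\<in>Poly_Mapping.keys p. m'' \<noteq> m' \<longrightarrow> lex_less m'' m')"
    then have "lex_less m m'" "lex_less m' m" if "m' \<noteq> m"
      using m that by auto
    then show "m' = m"
      using lex_less_trans[of m m' m] lex_less_irrefl[of m] by blast
  qed (use m in blast)
  from theI'[OF this] show "lead_monom lex_less p \<in> Poly_Mapping.keys p"
    and "\<forall>m\<in>Poly_Mapping.keys p. m \<noteq> lead_monom lex_less p \<longrightarrow> lex_less m (lead_monom lex_less p)"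
    unfolding lead_monom_def by blast+
qed


section \<open>Kazhdan--Lusztig ideals\<close>

definition KL_one_pos :: "nat \<Rightarrow> (nat \<Rightarrow> nat) \<Rightarrow> pos set" where
  "KL_one_pos n v = {(n - v j + 1, j) | j. j \<in> {1..n}}"

definition KL_zero_pos :: "nat \<Rightarrow> (nat \<Rightarrow> nat) \<Rightarrow> pos set" where
  "KL_zero_pos n v = {(n - v j + 1, a) | a j. j \<in> {1..n} \<and> a \<in> {1..n} \<and> a > j} \<union>
                     {(b, j) | b j. j \<in> {1..n} \<and> b \<in> {1..n} \<and> b > n - v j + 1}"

definition KL_indet_pos :: "nat \<Rightarrow> (nat \<Rightarrow> nat) \<Rightarrow> pos set" where
  "KL_indet_pos n v = {1..n} \<times> {1..n} - KL_one_pos n v - KL_zero_pos n v"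

definition KL_entry :: "nat \<Rightarrow> (nat \<Rightarrow> nat) \<Rightarrow> pos \<Rightarrow> 'a::field pol" where
  "KL_entry n v x =
     (if x \<in> KL_one_pos n v then 1 else if x \<in> KL_zero_pos n v then 0 else indet x)"

text \<open>Rows of the library's matrices are counted from the top and both indices start at 0.\<close>

definition KL_matrix :: "nat \<Rightarrow> (nat \<Rightarrow> nat) \<Rightarrow> 'a::field pol mat" where
  "KL_matrix n v = mat n n (\<lambda>(r, c). KL_entry n v (n - r, c + 1))"

definition KL_southwest :: "nat \<Rightarrow> (nat \<Rightarrow> nat) \<Rightarrow> nat \<Rightarrow> nat \<Rightarrow> 'a::field pol mat" where
  "KL_southwest n v i j = submatrix (KL_matrix n v) {n - i..<n} {..<j}"

definition minors :: "nat \<Rightarrow> 'a::comm_ring_1 mat \<Rightarrow> 'a set" where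
  "minors k A = {det (submatrix A I J) | I J.
     I \<subseteq> {..<dim_row A} \<and> J \<subseteq> {..<dim_col A} \<and> card I = k \<and> card J = k}"

definition perm_rank :: "nat \<Rightarrow> (nat \<Rightarrow> nat) \<Rightarrow> nat \<Rightarrow> nat \<Rightarrow> nat" where
  "perm_rank n w i j = card {k \<in> {1..n}. k \<le> j \<and> w k \<ge> n - i + 1}"

definition rothe_diagram :: "nat \<Rightarrow> (nat \<Rightarrow> nat) \<Rightarrow> pos set" where
  "rothe_diagram n u =
     {(i, j). i \<in> {1..n} \<and> j \<in> {1..n} \<and> i < n - u j + 1 \<and> j < inv_into UNIV u (n - i + 1)}"

definition essential_set :: "nat \<Rightarrow> (nat \<Rightarrow> nat) \<Rightarrow> pos set" where
  "essential_set n w = {(i, j). (i, j) \<in> rothe_diagram n w \<and>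
     (i + 1, j) \<notin> rothe_diagram n w \<and> (i, j + 1) \<notin> rothe_diagram n w}"

definition KL_ring :: "nat \<Rightarrow> (nat \<Rightarrow> nat) \<Rightarrow> 'a::field pol ring" where
  "KL_ring n v = pol_ring (KL_indet_pos n v)"

definition KL_ideal :: "nat \<Rightarrow> (nat \<Rightarrow> nat) \<Rightarrow> (nat \<Rightarrow> nat) \<Rightarrow> 'a::field pol set" where
  "KL_ideal n v w = Idl\<^bsub>KL_ring n v\<^esub>
     (\<Union>i\<in>{1..n}. \<Union>j\<in>{1..n}. minors (1 + perm_rank n w i j) (KL_southwest n v i j))"

definition essential_minors :: "nat \<Rightarrow> (nat \<Rightarrow> nat) \<Rightarrow> (nat \<Rightarrow> nat) \<Rightarrow> 'a::field pol set" where
  "essential_minors n v w =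
     (\<Union>(i, j)\<in>essential_set n w. minors (1 + perm_rank n w i j) (KL_southwest n v i j))"

lemma KL_indet_pos_eq_rothe_diagram:
  assumes "v permutes {1..n}"
  shows "KL_indet_pos n v = rothe_diagram n v"
proof -
  have range: "1 \<le> v j \<and> v j \<le> n" if "1 \<le> j" "j \<le> n" for j
    using permutes_in_image[OF assms, of j] that by auto
  have "(i, j) \<in> KL_indet_pos n v \<longleftrightarrow> (i, j) \<in> rothe_diagram n v" for i j
  proof (cases "i \<in> {1..n} \<and> j \<in> {1..n}")
    case True
    define a where "a = inv_into UNIV v (n - i + 1)"
    have "n - i + 1 \<in> {1..n}" using True by auto
    then have a: "a \<in> {1..n}" "v a = n - i + 1"
      using permutes_in_image[OF permutes_inv[OF assms], of "n - i + 1"]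
        permutes_inverses(1)[OF assms] by (auto simp: a_def)
    have "i = n - v k + 1 \<longleftrightarrow> k = a" if "k \<in> {1..n}" for k
    proof -
      have "i = n - v k + 1 \<longleftrightarrow> v k = v a" using range[of k] that True a by auto
      also have "\<dots> \<longleftrightarrow> k = a" using permutes_inj[OF assms] by (auto dest: injD)
      finally show ?thesis .
    qed
    then have row: "(\<exists>k. k \<in> {1..n} \<and> i = n - v k + 1 \<and> P k) \<longleftrightarrow> P a" for P
      using a(1) by blast
    have one: "(i, j) \<in> KL_one_pos n v \<longleftrightarrow> j = a"
      using row[of "\<lambda>k. k = j"] True by (auto simp: KL_one_pos_def)
    have zero: "(i, j) \<in> KL_zero_pos n v \<longleftrightarrow> j > a \<or> i > n - v j + 1"
      using row[of "\<lambda>k. k < j"] True by (auto simp: KL_zero_pos_def)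
    have "j = a \<longleftrightarrow> i = n - v j + 1"
      using \<open>\<And>k. k \<in> {1..n} \<Longrightarrow> i = n - v k + 1 \<longleftrightarrow> k = a\<close> True by auto
    moreover have "inv_into UNIV v (Suc (n - i)) = a" by (simp add: a_def)
    ultimately show ?thesis
      using True by (auto simp: KL_indet_pos_def rothe_diagram_def one zero)
  qed (auto simp: KL_indet_pos_def rothe_diagram_def)
  then show ?thesis by auto
qed

lemma KL_entry_in_KL_ring:
  assumes "x \<in> {1..n} \<times> {1..n}"
  shows "KL_entry n v x \<in> carrier (KL_ring n v :: 'a::field pol ring)"
  using assms by (auto simp: KL_entry_def KL_ring_def KL_indet_pos_def indet_def split: if_splits)

end

theory Submission
  imports Defs "HOL-Computational_Algebra.Fraction_Field"
begin

text \<open>Induction on the number of indeterminates, along the recursion of Kostant and Kumar. Let \<open>p\<close> and \<open>q\<close> be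
  the sequences of the rows of the ones for \<open>v\<close> and \<open>w\<close>, let \<open>j\<close> be the last descent of \<open>p\<close>, and let \<open>y\<close>
  be the lowest indeterminate in column \<open>j\<close>; it is the largest one. If \<open>s\<close> exchanges \<open>j\<close> and \<open>j + 1\<close>,
  the matrix of \<open>p s\<close> involves all indeterminates but \<open>y\<close>, and that of \<open>p\<close> arises from it by a column
  exchange and the addition of \<open>y\<close> times a unit column. Let \<open>q'\<close> be the one of \<open>q\<close> and \<open>q s\<close> without
  a descent at \<open>j\<close>. For an element of the ideal of \<open>(p, q)\<close>, the leading coefficient with respect to
  \<open>y\<close> lies in the ideal of \<open>(p s, q)\<close>, and even in that of \<open>(p s, q')\<close> if \<open>y\<close> does not occur; the minors for
  these two pairs lift to minors for \<open>(p, q)\<close> with known leading terms.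

  In place of primality and dimension of the ideals, the induction carries a point over a large field
  at which precisely the elements of the ideal vanish. In the step, the missing coordinate \<open>y\<close> is either
  a new transcendental element or forced to be a quotient of two minors. If \<open>p\<close> violates the rank
  conditions of \<open>q\<close>, one of the minors is 1. Finally, Laplace expansion shows that the leading term of
  every defining minor is divisible by that of an essential minor.\<close>

section \<open>Polynomials over arbitrary index sets\<close>

text \<open>Membership in an ideal says little about the coefficients with respect to
  \<open>y\<close>, because cofactors may cancel; vanishing at a point says more. If the value
  \<open>t\<close> of \<open>y\<close> is transcendental over the other coordinates, every
  coefficient vanishes. If \<open>t = - c / e\<close>, multiplying by a power of \<open>e\<close>
  and specializing to a point where \<open>e\<close> vanishes and \<open>c\<close> does not leaves
  the leading coefficient alone. The claim of the induction is therefore that each nonzero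
  polynomial vanishing at the point has a leading monomial divisible by that of a defining minor.
  This settles the Groebner basis at once: the minors vanish at the point, hence so do all elements
  of the ideal. Division by the minors yields the converse, on which the specialization between
  points rests. The points have coordinates in rational functions over the ground field, so its
  characteristic and cardinality never enter. A descent of \<open>q\<close> involves two points, and
  the one for \<open>p s\<close> and \<open>q\<close> can only be demanded if the rank conditions
  hold for this pair.\<close>

abbreviation "lookup \<equiv> Poly_Mapping.lookup"
abbreviation "keys \<equiv> Poly_Mapping.keys"
abbreviation "single \<equiv> Poly_Mapping.single"
abbreviation "lm f \<equiv> lead_monom lex_less f"

text \<open>The index type is arbitrary because both the matrix positions and the generators of the
  rational function field below serve as indeterminates.\<close>

definition pvars :: "(('x \<Rightarrow>\<^sub>0 nat) \<Rightarrow>\<^sub>0 'a::zero) \<Rightarrow> 'x set" where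
  "pvars f = (\<Union>m\<in>keys f. keys m)"

lemma pvars_zero [simp]: "pvars (0 :: (_ \<Rightarrow>\<^sub>0 nat) \<Rightarrow>\<^sub>0 _) = {}"
  by (simp add: pvars_def)

lemma pvars_one [simp]: "pvars (1 :: ('x \<Rightarrow>\<^sub>0 nat) \<Rightarrow>\<^sub>0 'a::zero_neq_one) = {}"
  by (simp add: pvars_def)

lemma pvars_uminus [simp]: "pvars (- g) = pvars (g :: ('x \<Rightarrow>\<^sub>0 nat) \<Rightarrow>\<^sub>0 'a::ab_group_add)"
  by (auto simp: pvars_def in_keys_iff)

lemma pvars_single: "pvars (single m c) \<subseteq> keys m"
  by (auto simp: pvars_def)

lemma pvars_indet: "pvars (indet x :: 'a::field pol) \<subseteq> {x}"
  by (auto simp: pvars_def indet_def split: if_splits)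

lemma pvars_add: "pvars (f + g) \<subseteq> pvars f \<union> pvars g"
  using Poly_Mapping.keys_add[of f g] by (fastforce simp: pvars_def)

lemma pvars_mult:
  fixes f g :: "('x \<Rightarrow>\<^sub>0 nat) \<Rightarrow>\<^sub>0 'a::semiring_0"
  shows "pvars (f * g) \<subseteq> pvars f \<union> pvars g"
proof
  fix x assume "x \<in> pvars (f * g)"
  then obtain m where m: "m \<in> keys (f * g)" "x \<in> keys m" by (auto simp: pvars_def)
  obtain a b where "m = a + b" "a \<in> keys f" "b \<in> keys g"
    using m(1) keys_mult[of f g] by auto
  then show "x \<in> pvars f \<union> pvars g"
    using m(2) Poly_Mapping.keys_add[of a b] by (fastforce simp: pvars_def)
qed

lemma pvars_add_subset: "pvars f \<subseteq> V \<Longrightarrow> pvars g \<subseteq> V \<Longrightarrow> pvars (f + g) \<subseteq> V"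
  using pvars_add[of f g] by blast

lemma pvars_mult_subset:
  fixes f g :: "('x \<Rightarrow>\<^sub>0 nat) \<Rightarrow>\<^sub>0 'a::semiring_0"
  shows "pvars f \<subseteq> V \<Longrightarrow> pvars g \<subseteq> V \<Longrightarrow> pvars (f * g) \<subseteq> V"
  using pvars_mult[of f g] by blast

lemma pvars_sum_subset: "(\<And>i. i \<in> I \<Longrightarrow> pvars (f i) \<subseteq> V) \<Longrightarrow> pvars (sum f I) \<subseteq> V"
  by (induction I rule: infinite_finite_induct) (simp_all add: pvars_add_subset)

lemma pvars_prod_subset:
  fixes f :: "'i \<Rightarrow> ('x \<Rightarrow>\<^sub>0 nat) \<Rightarrow>\<^sub>0 'a::comm_semiring_1"
  shows "(\<And>i. i \<in> I \<Longrightarrow> pvars (f i) \<subseteq> V) \<Longrightarrow> pvars (prod f I) \<subseteq> V"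
  by (induction I rule: infinite_finite_induct) (simp_all add: pvars_mult_subset)

lemma pvars_power_subset:
  fixes f :: "('x \<Rightarrow>\<^sub>0 nat) \<Rightarrow>\<^sub>0 'a::comm_semiring_1"
  shows "pvars f \<subseteq> V \<Longrightarrow> pvars (f ^ k) \<subseteq> V"
  by (induction k) (simp_all add: pvars_mult_subset)

lemma lookup_single_mult:
  fixes f :: "('x \<Rightarrow>\<^sub>0 nat) \<Rightarrow>\<^sub>0 'a::semiring_0"
  shows "lookup (single a c * f) (a + m) = c * lookup f m"
proof -
  have "lookup (single a c * f) (a + m) =
      Sum_any (\<lambda>l. (c * Sum_any (\<lambda>q. lookup f q when a + m = l + q)) when l = a)"
    unfolding lookup_mult by (rule Sum_any.cong) (auto simp: lookup_single when_def)
  also have "\<dots> = c * Sum_any (\<lambda>q. lookup f q when a + m = a + q)"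
    by (simp only: Sum_any_when_equal)
  also have "(\<lambda>q. lookup f q when a + m = a + q) = (\<lambda>q. lookup f q when q = m)"
    by (auto simp: when_def fun_eq_iff)
  finally show ?thesis by simp
qed

lemma keys_single_mult:
  fixes f :: "('x \<Rightarrow>\<^sub>0 nat) \<Rightarrow>\<^sub>0 'a::field"
  assumes "c \<noteq> 0"
  shows "keys (single a c * f) = (+) a ` keys f"
proof
  show "keys (single a c * f) \<subseteq> (+) a ` keys f"
    using keys_mult[of "single a c" f] assms by auto
  show "(+) a ` keys f \<subseteq> keys (single a c * f)"
    using assms by (auto simp: in_keys_iff lookup_single_mult)
qed

lemma poly_mapping_sum_single: "f = (\<Sum>m\<in>keys f. single m (lookup f m))"
proof (rule poly_mapping_eqI)
  fix m
  have "(\<Sum>i\<in>keys f. lookup (single i (lookup f i)) m) = (\<Sum>i\<in>keys f. if i = m then lookup f m else 0)"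
    by (rule sum.cong) (auto simp: lookup_single)
  then show "lookup f m = lookup (\<Sum>m\<in>keys f. single m (lookup f m)) m"
    by (simp add: lookup_sum in_keys_iff)
qed


section \<open>Evaluation\<close>

definition monom_ev :: "('x \<Rightarrow> 'l::comm_semiring_1) \<Rightarrow> ('x \<Rightarrow>\<^sub>0 nat) \<Rightarrow> 'l" where
  "monom_ev \<xi> m = (\<Prod>x\<in>keys m. \<xi> x ^ lookup m x)"

lemma monom_ev_superset:
  assumes "finite A" "keys m \<subseteq> A"
  shows "monom_ev \<xi> m = (\<Prod>x\<in>A. \<xi> x ^ lookup m x)"
  unfolding monom_ev_def
  by (rule prod.mono_neutral_left) (use assms in \<open>auto simp: in_keys_iff\<close>)

lemma monom_ev_add: "monom_ev \<xi> (a + b) = monom_ev \<xi> a * monom_ev \<xi> b"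
proof -
  let ?A = "keys a \<union> keys b"
  show ?thesis
    using Poly_Mapping.keys_add[of a b]
    by (simp add: monom_ev_superset[of ?A] lookup_add power_add prod.distrib)
qed

lemma monom_ev_single [simp]: "monom_ev \<xi> (single x k) = \<xi> x ^ k"
  by (simp add: monom_ev_def)

lemma monom_ev_zero [simp]: "monom_ev \<xi> 0 = 1"
  by (simp add: monom_ev_def)

lemma monom_ev_cong: "(\<And>x. x \<in> keys m \<Longrightarrow> \<xi> x = \<zeta> x) \<Longrightarrow> monom_ev \<xi> m = monom_ev \<zeta> m"
  by (simp add: monom_ev_def)

text \<open>Coefficients are mapped along \<open>\<iota>\<close> because the points of the induction
  have coordinates in an extension of the ground field.\<close>

locale coeff_hom = comm_ring_hom \<iota> for \<iota> :: "'k::field \<Rightarrow> 'l::field"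
begin

definition ev :: "('x \<Rightarrow> 'l) \<Rightarrow> (('x \<Rightarrow>\<^sub>0 nat) \<Rightarrow>\<^sub>0 'k) \<Rightarrow> 'l" where
  "ev \<xi> f = (\<Sum>m\<in>keys f. \<iota> (lookup f m) * monom_ev \<xi> m)"

lemma ev_superset:
  assumes "finite A" "keys f \<subseteq> A"
  shows "ev \<xi> f = (\<Sum>m\<in>A. \<iota> (lookup f m) * monom_ev \<xi> m)"
  unfolding ev_def
  by (rule sum.mono_neutral_left) (use assms in \<open>auto simp: in_keys_iff\<close>)

lemma ev_add: "ev \<xi> (f + g) = ev \<xi> f + ev \<xi> g"
  using Poly_Mapping.keys_add[of f g]
  by (simp add: ev_superset[of "keys f \<union> keys g"] lookup_add hom_add distrib_right sum.distrib)

lemma ev_zero [simp]: "ev \<xi> 0 = 0"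
  by (simp add: ev_def)

lemma ev_single [simp]: "ev \<xi> (single m c) = \<iota> c * monom_ev \<xi> m"
  by (simp add: ev_def)

lemma ev_sum: "ev \<xi> (sum f I) = (\<Sum>i\<in>I. ev \<xi> (f i))"
  by (induction I rule: infinite_finite_induct) (simp_all add: ev_add)

lemma ev_mult: "ev \<xi> (f * g) = ev \<xi> f * ev \<xi> g"
proof -
  let ?s = "\<lambda>f. (\<Sum>m\<in>keys f. single m (lookup f m))"
  have "f * g = ?s f * ?s g"
    using poly_mapping_sum_single[of f] poly_mapping_sum_single[of g] by metis
  also have "\<dots> = (\<Sum>a\<in>keys f. \<Sum>b\<in>keys g. single (a + b) (lookup f a * lookup g b))"
    by (simp add: sum_product mult_single)
  finally have "ev \<xi> (f * g) =
      (\<Sum>a\<in>keys f. \<Sum>b\<in>keys g. \<iota> (lookup f a * lookup g b) * monom_ev \<xi> (a + b))"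
    by (simp only: ev_sum ev_single)
  then show ?thesis
    by (simp add: ev_def hom_mult monom_ev_add sum_product ac_simps)
qed

lemma ev_one [simp]: "ev \<xi> 1 = 1"
  using ev_single[of \<xi> 0 1] by simp

sublocale ev: comm_ring_hom "ev \<xi>"
  by unfold_locales (simp_all add: ev_add ev_mult)

lemma ev_indet [simp]: "ev \<xi> (indet x) = \<xi> x"
  by (simp add: indet_def)

lemma ev_cong:
  assumes "\<And>x. x \<in> pvars f \<Longrightarrow> \<xi> x = \<zeta> x"
  shows "ev \<xi> f = ev \<zeta> f"
  unfolding ev_def
  by (intro sum.cong arg_cong2[where f = "(*)"] monom_ev_cong refl assms) (auto simp: pvars_def)

end


section \<open>Leading monomials for the lexicographic order\<close>

lemma lex_less_add_iff [simp]: "lex_less (a + c) (b + c) \<longleftrightarrow> lex_less a b"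
  "lex_less (c + a) (c + b) \<longleftrightarrow> lex_less a b"
  by (simp_all add: lex_less_def lookup_add)

lemma lex_less_asym: "lex_less a b \<Longrightarrow> \<not> lex_less b a"
  using lex_less_trans lex_less_irrefl by blast

lemma lm_in_keys: "f \<noteq> 0 \<Longrightarrow> lm f \<in> keys f"
  by (rule lead_monom_lex)

lemma lm_max: "m \<in> keys f \<Longrightarrow> m \<noteq> lm f \<Longrightarrow> lex_less m (lm f)"
  by (cases "f = 0") (auto dest: lead_monom_lex(2))

lemma lm_eqI:
  assumes "m \<in> keys f" "\<And>m'. m' \<in> keys f \<Longrightarrow> m' \<noteq> m \<Longrightarrow> lex_less m' m"
  shows "lm f = m"
proof (rule ccontr)
  assume "lm f \<noteq> m"
  moreover have "f \<noteq> 0" using assms(1) by auto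
  ultimately show False
    using assms(2)[OF lm_in_keys] lm_max[OF assms(1)] lex_less_asym by blast
qed

lemma lm_uminus [simp]: "lm (- f) = lm (f :: 'a::field pol)"
proof -
  have "keys (- f) = keys f" by (auto simp: in_keys_iff)
  then show ?thesis by (simp add: lead_monom_def)
qed

text \<open>The third hypothesis confines all variation within \<open>Q\<close> to \<open>V\<close>.
  The exponent of the largest indeterminate \<open>y\<close> of \<open>V\<close> is minimized first;
  the monomials attaining this minimum vary only in \<open>V - {y}\<close>, where the induction
  hypothesis applies.\<close>

lemma lex_less_minimal:
  assumes "finite V" "Q \<noteq> {}"
    and "\<And>m m' x. m \<in> Q \<Longrightarrow> m' \<in> Q \<Longrightarrow> x \<notin> V \<Longrightarrow> lookup m x = lookup m' x"
  shows "\<exists>m\<in>Q. \<forall>m'\<in>Q. \<not> lex_less m' m"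
  using assms
proof (induction "card V" arbitrary: V Q)
  case 0
  then have "m = m'" if "m \<in> Q" "m' \<in> Q" for m m'
    using that by (auto intro!: poly_mapping_eqI)
  then show ?case using 0 lex_less_irrefl by blast
next
  case (Suc k)
  then have "V \<noteq> {}" by auto
  then obtain y where y: "y \<in> V" "\<And>x. x \<in> V \<Longrightarrow> x \<noteq> y \<Longrightarrow> indet_less x y"
    using indet_less_finite_max[OF Suc.prems(1)] by blast
  obtain m0 where m0: "m0 \<in> Q" "\<And>m. m \<in> Q \<Longrightarrow> lookup m0 y \<le> lookup m y"
    using exists_least_iff[of "\<lambda>k. \<exists>m\<in>Q. lookup m y = k"] Suc.prems(2)
    by (metis ex_in_conv linorder_not_less)
  define R where "R = {m \<in> Q. lookup m y = lookup m0 y}"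
  have "\<exists>m\<in>R. \<forall>m'\<in>R. \<not> lex_less m' m"
  proof (rule Suc.hyps(1))
    show "k = card (V - {y})" using Suc.hyps(2) y(1) by simp
    show "lookup m x = lookup m' x" if "m \<in> R" "m' \<in> R" "x \<notin> V - {y}" for m m' x
      using that Suc.prems(3)[of m m' x] by (cases "x = y") (auto simp: R_def)
  qed (use Suc.prems m0 in \<open>auto simp: R_def\<close>)
  then obtain m where m: "m \<in> R" "\<And>m'. m' \<in> R \<Longrightarrow> \<not> lex_less m' m" by blast
  have "\<not> lex_less m' m" if m': "m' \<in> Q" for m'
  proof
    assume less: "lex_less m' m"
    then obtain x where x: "lookup m' x < lookup m x"
      "\<And>z. indet_less x z \<Longrightarrow> lookup m' z = lookup m z" unfolding lex_less_def by blast
    have "m' \<notin> R" using less m(2) by blast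
    then have "lookup m' y > lookup m y" using m0(2)[OF m'] m' m(1) by (auto simp: R_def)
    then have "x \<noteq> y" "\<not> indet_less x y" using x(1) x(2)[of y] by auto
    then have "x \<notin> V" using y(2) by blast
    then show False using Suc.prems(3)[of m' m x] m' m(1) x(1) by (auto simp: R_def)
  qed
  then show ?case using m(1) by (auto simp: R_def)
qed

text \<open>The bound by a finite \<open>V\<close> matters: the indeterminates of one column, read
  upwards, form an infinite descending chain.\<close>

lemma wf_lex_less:
  assumes "finite V"
  shows "wf {(a, b). keys a \<subseteq> V \<and> keys b \<subseteq> V \<and> lex_less a b}"
proof (rule wfI_min)
  fix m :: monom and Q assume m: "m \<in> Q"
  show "\<exists>z\<in>Q. \<forall>y. (y, z) \<in> {(a, b). keys a \<subseteq> V \<and> keys b \<subseteq> V \<and> lex_less a b} \<longrightarrow> y \<notin> Q"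
  proof (cases "keys m \<subseteq> V")
    case True
    have "\<exists>m\<in>{m \<in> Q. keys m \<subseteq> V}. \<forall>m'\<in>{m \<in> Q. keys m \<subseteq> V}. \<not> lex_less m' m"
      using assms
    proof (rule lex_less_minimal)
      show "lookup a x = lookup b x"
        if "a \<in> {m \<in> Q. keys m \<subseteq> V}" "b \<in> {m \<in> Q. keys m \<subseteq> V}" "x \<notin> V" for a b x
      proof -
        have "x \<notin> keys a" "x \<notin> keys b" using that by auto
        then show ?thesis by (simp add: in_keys_iff)
      qed
    qed (use True m in auto)
    then show ?thesis by auto
  qed (use m in auto)
qed


section \<open>Polynomials as polynomials in one distinguished indeterminate\<close>

definition coeff_in :: "'x \<Rightarrow> nat \<Rightarrow> (('x \<Rightarrow>\<^sub>0 nat) \<Rightarrow>\<^sub>0 'a::comm_monoid_add) \<Rightarrow> ('x \<Rightarrow>\<^sub>0 nat) \<Rightarrow>\<^sub>0 'a" where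
  "coeff_in y d f = (\<Sum>m\<in>{m \<in> keys f. lookup m y = d}. single (m - single y d) (lookup f m))"

lemma minus_single_add: "lookup m y = d \<Longrightarrow> m - single y d + single y d = m" for m :: "'x \<Rightarrow>\<^sub>0 nat"
  by (rule poly_mapping_eqI) (auto simp: lookup_add lookup_minus lookup_single when_def)

lemma lookup_coeff_in:
  "lookup (coeff_in y d f) m = (if lookup m y = 0 then lookup f (m + single y d) else 0)"
proof -
  have *: "a - single y d = m \<longleftrightarrow> lookup m y = 0 \<and> a = m + single y d" if "lookup a y = d" for a
  proof
    assume "a - single y d = m"
    then show "lookup m y = 0 \<and> a = m + single y d"
      using that minus_single_add[of a y d] by (auto simp: lookup_minus)
  qed (simp add: add_diff_cancel_right')
  have "lookup (coeff_in y d f) m =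
      (\<Sum>a\<in>{a \<in> keys f. lookup a y = d}. if lookup m y = 0 \<and> a = m + single y d then lookup f a else 0)"
    unfolding coeff_in_def lookup_sum
    by (rule sum.cong) (auto simp: lookup_single when_def *)
  also have "\<dots> = (if lookup m y = 0 then lookup f (m + single y d) else 0)"
    by (auto simp: sum.delta lookup_add in_keys_iff)
  finally show ?thesis .
qed

lemma keys_coeff_in: "m \<in> keys (coeff_in y d f) \<longleftrightarrow> lookup m y = 0 \<and> m + single y d \<in> keys f"
  by (auto simp: in_keys_iff lookup_coeff_in)

lemma pvars_coeff_in: "pvars (coeff_in y d f) \<subseteq> pvars f - {y}"
proof
  fix x assume "x \<in> pvars (coeff_in y d f)"
  then obtain m where m: "x \<in> keys m" "lookup m y = 0" "m + single y d \<in> keys f"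
    by (auto simp: pvars_def keys_coeff_in)
  then show "x \<in> pvars f - {y}"
    by (auto simp: pvars_def in_keys_iff lookup_add intro!: bexI[of _ "m + single y d"])
qed

lemma (in coeff_hom) ev_coeff_in:
  assumes "\<And>m. m \<in> keys f \<Longrightarrow> lookup m y \<le> D"
  shows "ev (\<xi>(y := t)) f = (\<Sum>d\<le>D. ev \<xi> (coeff_in y d f) * t ^ d)"
proof -
  have m: "monom_ev (\<xi>(y := t)) m = monom_ev \<xi> (m - single y d) * t ^ d" if "lookup m y = d" for m d
  proof -
    have "monom_ev (\<xi>(y := t)) m = monom_ev (\<xi>(y := t)) (m - single y d) * t ^ d"
      using monom_ev_add[of "\<xi>(y := t)" "m - single y d" "single y d"] minus_single_add[OF that]
      by simp
    also have "monom_ev (\<xi>(y := t)) (m - single y d) = monom_ev \<xi> (m - single y d)"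
      by (rule monom_ev_cong) (auto simp: in_keys_iff lookup_minus that)
    finally show ?thesis .
  qed
  have "ev (\<xi>(y := t)) f = (\<Sum>d\<le>D. \<Sum>m\<in>{m \<in> keys f. lookup m y = d}. \<iota> (lookup f m) * monom_ev (\<xi>(y := t)) m)"
    unfolding ev_def by (rule sum.group[symmetric]) (use assms in auto)
  also have "\<dots> = (\<Sum>d\<le>D. ev \<xi> (coeff_in y d f) * t ^ d)"
    by (simp add: coeff_in_def ev_sum sum_distrib_right m mult.assoc)
  finally show ?thesis .
qed

definition top_var :: "pos \<Rightarrow> pos set \<Rightarrow> bool" where
  "top_var y V \<longleftrightarrow> (\<forall>x\<in>V. x \<noteq> y \<longrightarrow> indet_less x y)"

lemma lex_less_top_var:
  assumes "top_var y V" "keys a \<subseteq> V" "keys b \<subseteq> V" "lookup a y < lookup b y"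
  shows "lex_less a b"
proof -
  have "lookup a x = lookup b x" if "indet_less y x" for x
  proof -
    have "x \<notin> V"
      using that assms(1) indet_less_irrefl indet_less_trans unfolding top_var_def by metis
    then have "x \<notin> keys a" "x \<notin> keys b" using assms by auto
    then show ?thesis by (simp add: in_keys_iff)
  qed
  then show ?thesis using assms(4) unfolding lex_less_def by blast
qed

text \<open>As \<open>y\<close> exceeds all other indeterminates of \<open>f\<close>, monomials are
  compared by their degree in \<open>y\<close> first. The leading monomial thus comes from the top
  coefficient, and multiplication by a fixed power of \<open>y\<close> preserves the order.\<close>

lemma lm_coeff_in:
  fixes f :: "'a::field pol"
  assumes top: "top_var y V" and "pvars f \<subseteq> V" "f \<noteq> 0"
  defines "d \<equiv> lookup (lm f) y"
  shows "\<And>m. m \<in> keys f \<Longrightarrow> lookup m y \<le> d"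
    and "coeff_in y d f \<noteq> 0"
    and "lm f = lm (coeff_in y d f) + single y d"
proof -
  have sub: "keys m \<subseteq> V" if "m \<in> keys f" for m using that assms(2) by (auto simp: pvars_def)
  show "lookup m y \<le> d" if "m \<in> keys f" for m
    using lex_less_top_var[OF top sub sub, of "lm f" m] that lm_in_keys[OF assms(3)]
      lm_max[OF that] lex_less_asym lex_less_irrefl unfolding d_def by (metis linorder_not_less)
  have e: "lm f - single y d + single y d = lm f" by (simp add: minus_single_add d_def)
  have key: "lm f - single y d \<in> keys (coeff_in y d f)"
    using lm_in_keys[OF assms(3)] e by (simp add: keys_coeff_in lookup_minus d_def)
  then show "coeff_in y d f \<noteq> 0" by auto
  have "lm (coeff_in y d f) = lm f - single y d"
  proof (rule lm_eqI[OF key])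
    fix m assume m: "m \<in> keys (coeff_in y d f)" "m \<noteq> lm f - single y d"
    then have "m + single y d \<in> keys f" "m + single y d \<noteq> lm f"
      by (simp add: keys_coeff_in) (use m(2) add_diff_cancel_right' in metis)
    then show "lex_less m (lm f - single y d)"
      using lm_max[of "m + single y d" f] lex_less_add_iff(1)[of m "single y d" "lm f - single y d"] e
      by simp
  qed
  then show "lm f = lm (coeff_in y d f) + single y d" using e by simp
qed

text \<open>A monomial containing \<open>y\<close> exceeds each monomial of \<open>c\<close>, so
  \<open>c\<close> cannot influence the leading monomial. Linearity in a column later brings lifted
  minors into this form.\<close>

lemma lm_linear:
  fixes c e :: "'a::field pol"
  assumes top: "top_var y V" "y \<in> V" and c: "pvars c \<subseteq> V - {y}" and e: "pvars e \<subseteq> V - {y}"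
    and "e \<noteq> 0"
  shows "c + indet y * e \<noteq> 0" "lm (c + indet y * e) = single y 1 + lm e"
proof -
  let ?f = "c + indet y * e"
  have ye: "keys (indet y * e) = (+) (single y 1) ` keys e"
    unfolding indet_def by (rule keys_single_mult) simp
  have kc: "lookup m y = 0" "keys m \<subseteq> V" if "m \<in> keys c" for m
  proof -
    have "keys m \<subseteq> V - {y}" using that c by (auto simp: pvars_def)
    then have "y \<notin> keys m" "keys m \<subseteq> V" by auto
    then show "lookup m y = 0" "keys m \<subseteq> V" by (simp_all add: in_keys_iff)
  qed
  have ke: "lookup m y = 0" "keys m \<subseteq> V" if "m \<in> keys e" for m
  proof -
    have "keys m \<subseteq> V - {y}" using that e by (auto simp: pvars_def)
    then have "y \<notin> keys m" "keys m \<subseteq> V" by auto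
    then show "lookup m y = 0" "keys m \<subseteq> V" by (simp_all add: in_keys_iff)
  qed
  have 1: "lm e \<in> keys e" by (rule lm_in_keys[OF \<open>e \<noteq> 0\<close>])
  have "lookup c (single y 1 + lm e) = 0"
    using kc(1)[of "single y 1 + lm e"] by (auto simp: in_keys_iff lookup_add)
  then have key: "single y 1 + lm e \<in> keys ?f"
    using 1 by (simp add: in_keys_iff lookup_add indet_def lookup_single_mult)
  then show "?f \<noteq> 0" by (metis keys_zero empty_iff)
  show "lm ?f = single y 1 + lm e"
  proof (rule lm_eqI[OF key])
    fix m assume m: "m \<in> keys ?f" "m \<noteq> single y 1 + lm e"
    then consider "m \<in> keys c" | m' where "m' \<in> keys e" "m = single y 1 + m'"
      using Poly_Mapping.keys_add[of c "indet y * e"] ye by auto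
    then show "lex_less m (single y 1 + lm e)"
    proof cases
      case 1
      have "keys (single y 1 + lm e) \<subseteq> V"
        using Poly_Mapping.keys_add[of "single y 1" "lm e"] ke(2)[OF \<open>lm e \<in> keys e\<close>] top(2) by auto
      then show ?thesis
        by (intro lex_less_top_var[OF top(1)]) (simp_all add: kc[OF 1] lookup_add)
    next
      case 2
      then show ?thesis using m(2) lm_max[of m' e] by auto
    qed
  qed
qed

section \<open>Divisibility of monomials\<close>

definition mdvd :: "('x \<Rightarrow>\<^sub>0 nat) \<Rightarrow> ('x \<Rightarrow>\<^sub>0 nat) \<Rightarrow> bool" where
  "mdvd a b \<longleftrightarrow> (\<exists>c. b = a + c)"

lemma mdvd_refl [simp]: "mdvd a a"
  by (auto simp: mdvd_def intro: exI[of _ 0])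

lemma mdvd_trans: "mdvd a b \<Longrightarrow> mdvd b c \<Longrightarrow> mdvd a c"
  by (auto simp: mdvd_def add.assoc)

lemma mdvd_add [simp]: "mdvd a (a + b)" "mdvd b (a + b)"
  by (auto simp: mdvd_def add.commute)

lemma mdvd_zero [simp]: "mdvd 0 a"
  by (simp add: mdvd_def)

lemma mdvd_add_right: "mdvd a b \<Longrightarrow> mdvd (c + a) (c + b)"
  by (auto simp: mdvd_def add.assoc)

section \<open>Minors along lists of rows and columns\<close>

text \<open>Lists instead of sets of indices allow any chosen row or column to be put in front for a
  Laplace expansion. Reordering costs only a sign, and a repeated index gives 0.\<close>

definition lminor :: "(nat \<Rightarrow> nat \<Rightarrow> 'a::comm_ring_1) \<Rightarrow> nat list \<Rightarrow> nat list \<Rightarrow> 'a" where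
  "lminor E rs cs = det (mat (length cs) (length cs) (\<lambda>(i, j). E (rs ! i) (cs ! j)))"

definition remove_nth :: "nat \<Rightarrow> 'b list \<Rightarrow> 'b list" where
  "remove_nth i xs = take i xs @ drop (Suc i) xs"

lemma length_remove_nth: "i < length xs \<Longrightarrow> length (remove_nth i xs) = length xs - 1"
  by (simp add: remove_nth_def)

lemma nth_remove_nth:
  assumes "i < length xs" "j < length xs - 1"
  shows "remove_nth i xs ! j = xs ! (if j < i then j else Suc j)"
  using assms by (auto simp: remove_nth_def nth_append min_def)

lemma mset_remove_nth: "i < length xs \<Longrightarrow> mset (remove_nth i xs) = mset xs - {#xs ! i#}"
  by (metis Suc_leI add_mset_remove_trivial id_take_nth_drop less_or_eq_imp_le mset_append mset.simps(2)
      remove_nth_def union_mset_add_mset_right)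

lemma set_remove_nth_subset: "set (remove_nth i xs) \<subseteq> set xs"
  by (auto simp: remove_nth_def dest: in_set_takeD in_set_dropD)

lemma lminor_cong:
  assumes "length rs = length cs" "\<And>b k. b \<in> set rs \<Longrightarrow> k \<in> set cs \<Longrightarrow> E b k = E' b k"
  shows "lminor E rs cs = lminor E' rs cs"
  unfolding lminor_def by (intro arg_cong[where f = det] cong_mat) (use assms in auto)

lemma lminor_map_cols:
  "lminor E rs (map g cs) = lminor (\<lambda>b k. E b (g k)) rs cs"
  unfolding lminor_def by (intro arg_cong[where f = det] cong_mat) auto

lemma lminor_transpose:
  assumes "length rs = length cs"
  shows "lminor (\<lambda>b k. E k b) cs rs = lminor E rs cs"
proof -
  let ?A = "mat (length cs) (length cs) (\<lambda>(i, j). E (rs ! i) (cs ! j))"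
  have "mat (length rs) (length rs) (\<lambda>(i, j). E (rs ! j) (cs ! i)) = ?A\<^sup>T"
    using assms by (intro eq_matI) auto
  moreover have "det (?A\<^sup>T) = det ?A" by (rule det_transpose) auto
  ultimately show ?thesis unfolding lminor_def by simp
qed

lemma lminor_expand_row:
  assumes "length cs = Suc (length rs)"
  shows "lminor E (r # rs) cs =
    (\<Sum>j<length cs. E r (cs ! j) * ((-1) ^ j * lminor E rs (remove_nth j cs)))"
proof -
  let ?n = "length cs"
  let ?A = "mat ?n ?n (\<lambda>(i, j). E ((r # rs) ! i) (cs ! j))"
  have "mat_delete ?A 0 j =
      mat (length (remove_nth j cs)) (length (remove_nth j cs)) (\<lambda>(i, l). E (rs ! i) (remove_nth j cs ! l))"
    if "j < ?n" for j
    using that assms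
    by (intro eq_matI) (auto simp: mat_delete_def length_remove_nth nth_remove_nth)
  then have "cofactor ?A 0 j = (-1) ^ j * lminor E rs (remove_nth j cs)" if "j < ?n" for j
    using that by (simp add: cofactor_def lminor_def)
  then have "?A $$ (0, j) * cofactor ?A 0 j =
      E r (cs ! j) * ((-1) ^ j * lminor E rs (remove_nth j cs))" if "j < ?n" for j
    using that assms by simp
  moreover have "det ?A = (\<Sum>j<?n. ?A $$ (0, j) * cofactor ?A 0 j)"
    by (rule laplace_expansion_row) (use assms in auto)
  ultimately show ?thesis unfolding lminor_def by simp
qed

lemma lminor_expand_col:
  assumes "length rs = Suc (length cs)"
  shows "lminor E rs (c # cs) =
    (\<Sum>i<length rs. E (rs ! i) c * ((-1) ^ i * lminor E (remove_nth i rs) cs))"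
proof -
  have "lminor E rs (c # cs) = lminor (\<lambda>b k. E k b) (c # cs) rs"
    by (subst lminor_transpose) (use assms in auto)
  also have "\<dots> = (\<Sum>i<length rs. E (rs ! i) c * ((-1) ^ i * lminor (\<lambda>b k. E k b) cs (remove_nth i rs)))"
    by (rule lminor_expand_row) (rule assms)
  also have "\<dots> = (\<Sum>i<length rs. E (rs ! i) c * ((-1) ^ i * lminor E (remove_nth i rs) cs))"
    by (intro sum.cong refl arg_cong2[where f = "(*)"] lminor_transpose)
      (use assms in \<open>simp add: length_remove_nth\<close>)
  finally show ?thesis .
qed

lemma lminor_Nil [simp]: "lminor E rs [] = 1"
  by (simp add: lminor_def)

text \<open>Signs are not tracked, since neither vanishing nor the leading monomial depends on
  them.\<close>

definition pm_eq :: "'a::group_add \<Rightarrow> 'a \<Rightarrow> bool" where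
  "pm_eq f g \<longleftrightarrow> f = g \<or> f = - g"

lemma pm_eq_refl [simp]: "pm_eq f f"
  by (simp add: pm_eq_def)

lemma pm_eq_sym: "pm_eq f g \<Longrightarrow> pm_eq g f"
  by (auto simp: pm_eq_def)

lemma pm_eq_trans: "pm_eq f g \<Longrightarrow> pm_eq g h \<Longrightarrow> pm_eq f h"
  by (auto simp: pm_eq_def)

lemma pm_eq_zero: "pm_eq f g \<Longrightarrow> f = 0 \<longleftrightarrow> g = 0"
  by (auto simp: pm_eq_def)

lemma pm_eq_lm: "pm_eq f g \<Longrightarrow> lm f = lm (g :: 'a::field pol)"
  by (auto simp: pm_eq_def)

lemma lminor_permute_rows:
  assumes "mset rs = mset rs'" "length rs = length cs"
  shows "pm_eq (lminor E rs cs) (lminor E rs' cs)"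
proof -
  obtain p where p: "p permutes {..<length rs'}" "permute_list p rs' = rs"
    using mset_eq_permutation[OF assms(1)] .
  have len: "length rs' = length cs" using assms mset_eq_length by metis
  let ?n = "length cs"
  let ?A = "mat ?n ?n (\<lambda>(i, j). E (rs' ! i) (cs ! j))"
  have pn: "p permutes {0..<?n}" using p(1) len by (simp add: atLeast0LessThan)
  have less: "p i < ?n" if "i < ?n" for i using permutes_in_image[OF pn, of i] that by auto
  have nth: "rs ! i = rs' ! p i" if "i < ?n" for i
    using permute_list_nth[OF p(1), of i] p(2) len that by simp
  have "mat ?n ?n (\<lambda>(i, j). E (rs ! i) (cs ! j)) = mat ?n ?n (\<lambda>(i, j). ?A $$ (p i, j))"
    by (rule eq_matI) (simp_all add: less nth)
  also have "det \<dots> = signof p * det ?A"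
    by (rule det_permute_rows) (use pn in auto)
  finally have "lminor E rs cs = signof p * lminor E rs' cs" by (simp add: lminor_def)
  moreover have "sign p = 1 \<or> sign p = - 1" by (simp add: sign_def)
  ultimately show ?thesis unfolding pm_eq_def by auto
qed

lemma lminor_permute_cols:
  assumes "mset cs = mset cs'" "length rs = length cs"
  shows "pm_eq (lminor E rs cs) (lminor E rs cs')"
proof -
  define F where "F = (\<lambda>b k. E k b)"
  have len: "length rs = length cs'" using assms mset_eq_length by metis
  have "lminor F cs rs = lminor E rs cs" "lminor F cs' rs = lminor E rs cs'"
    unfolding F_def by (rule lminor_transpose, use assms len in simp)+
  moreover have "pm_eq (lminor F cs rs) (lminor F cs' rs)"
    by (rule lminor_permute_rows) (use assms in simp_all)
  ultimately show ?thesis by simp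
qed

lemma lminor_nonzero_distinct:
  assumes "lminor E rs cs \<noteq> 0" "length rs = length cs"
  shows "distinct rs" "distinct cs"
proof -
  have rows: "distinct rs" if "lminor E rs cs \<noteq> 0" "length rs = length cs" for E :: "nat \<Rightarrow> nat \<Rightarrow> 'a" and rs cs
  proof (rule ccontr)
    assume "\<not> distinct rs"
    then obtain i j where ij: "i < length rs" "j < length rs" "i \<noteq> j" "rs ! i = rs ! j"
      by (auto simp: distinct_conv_nth)
    let ?A = "mat (length cs) (length cs) (\<lambda>(i, j). E (rs ! i) (cs ! j))"
    have "det ?A = 0"
      by (rule det_identical_rows[of _ "length cs" i j]) (use ij that in \<open>auto simp: row_def\<close>)
    then show False using that by (simp add: lminor_def)
  qed
  show "distinct rs" using rows assms .
  define F where "F = (\<lambda>b k. E k b)"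
  have "lminor F cs rs = lminor E rs cs"
    unfolding F_def by (rule lminor_transpose) (rule assms)
  then show "distinct cs" using rows[of F cs rs] assms by simp
qed

lemma lminor_hom:
  assumes "comm_ring_hom h"
  shows "h (lminor E rs cs) = lminor (\<lambda>b k. h (E b k)) rs cs"
proof -
  interpret comm_ring_hom h by fact
  have "mat (length cs) (length cs) (\<lambda>(i, j). h (E (rs ! i) (cs ! j))) =
     map_mat h (mat (length cs) (length cs) (\<lambda>(i, j). E (rs ! i) (cs ! j)))"
    by (intro eq_matI) auto
  then show ?thesis unfolding lminor_def by simp
qed

lemma pvars_lminor:
  fixes E :: "nat \<Rightarrow> nat \<Rightarrow> ('x \<Rightarrow>\<^sub>0 nat) \<Rightarrow>\<^sub>0 'a::comm_ring_1"
  assumes "length rs = length cs" "\<And>b k. b \<in> set rs \<Longrightarrow> k \<in> set cs \<Longrightarrow> pvars (E b k) \<subseteq> V"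
  shows "pvars (lminor E rs cs) \<subseteq> V"
  using assms
proof (induction rs arbitrary: cs)
  case (Cons r rs)
  have len: "length cs = Suc (length rs)" using Cons.prems(1) by simp
  have "pvars (lminor E rs (remove_nth j cs)) \<subseteq> V" if "j < length cs" for j
    by (rule Cons.IH) (use that len Cons.prems(2) set_remove_nth_subset[of j cs] in
      \<open>auto simp: length_remove_nth\<close>)
  moreover have "pvars ((-1 :: ('x \<Rightarrow>\<^sub>0 nat) \<Rightarrow>\<^sub>0 'a) ^ j) \<subseteq> V" for j
    by (rule pvars_power_subset) simp
  ultimately show ?case
    unfolding lminor_expand_row[OF len]
    by (intro pvars_sum_subset pvars_mult_subset) (use Cons.prems(2) in auto)
qed simp

lemma lminor_lower_triangular:
  assumes "length rs = length cs" "\<And>i. i < length cs \<Longrightarrow> E (rs ! i) (cs ! i) = 1"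
    and "\<And>i j. i < j \<Longrightarrow> j < length cs \<Longrightarrow> E (rs ! i) (cs ! j) = 0"
  shows "lminor E rs cs = 1"
proof -
  let ?A = "mat (length cs) (length cs) (\<lambda>(i, j). E (rs ! i) (cs ! j))"
  have "det ?A = prod_list (diag_mat ?A)"
    by (rule det_lower_triangular[of "length cs"]) (use assms in auto)
  also have "diag_mat ?A = map (\<lambda>i. 1) [0..<length cs]"
    unfolding diag_mat_def by (rule map_cong) (use assms(2) in auto)
  finally show ?thesis by (simp add: lminor_def map_replicate_const)
qed


section \<open>Spans of columns over a field\<close>

definition in_span :: "(nat \<Rightarrow> nat \<Rightarrow> 'l::field) \<Rightarrow> nat \<Rightarrow> nat set \<Rightarrow> (nat \<Rightarrow> 'l) \<Rightarrow> bool" where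
  "in_span M a C v \<longleftrightarrow> (\<exists>\<mu>. \<forall>b\<in>{1..a}. v b = (\<Sum>l\<in>C. \<mu> l * M b l))"

lemma in_span_cong:
  assumes "\<And>b l. b \<in> {1..a} \<Longrightarrow> l \<in> C \<Longrightarrow> M b l = M' b l" "\<And>b. b \<in> {1..a} \<Longrightarrow> v b = v' b"
  shows "in_span M a C v \<longleftrightarrow> in_span M' a C v'"
  unfolding in_span_def using assms by (metis (no_types, lifting) sum.cong)

lemma in_span_zero: "in_span M a C (\<lambda>b. 0)"
  unfolding in_span_def by (rule exI[of _ "\<lambda>_. 0"]) simp

lemma in_span_add:
  assumes "in_span M a C v" "in_span M a C v'"
  shows "in_span M a C (\<lambda>b. v b + v' b)"
proof -
  obtain \<mu> \<nu> where "\<forall>b\<in>{1..a}. v b = (\<Sum>l\<in>C. \<mu> l * M b l)" "\<forall>b\<in>{1..a}. v' b = (\<Sum>l\<in>C. \<nu> l * M b l)"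
    using assms unfolding in_span_def by blast
  then show ?thesis
    unfolding in_span_def by (intro exI[of _ "\<lambda>l. \<mu> l + \<nu> l"]) (simp add: distrib_right sum.distrib)
qed

lemma in_span_smult:
  assumes "in_span M a C v"
  shows "in_span M a C (\<lambda>b. t * v b)"
proof -
  obtain \<mu> where "\<forall>b\<in>{1..a}. v b = (\<Sum>l\<in>C. \<mu> l * M b l)"
    using assms unfolding in_span_def by blast
  then show ?thesis
    unfolding in_span_def by (intro exI[of _ "\<lambda>l. t * \<mu> l"]) (simp add: sum_distrib_left mult.assoc)
qed

lemma in_span_smult_iff: "t \<noteq> 0 \<Longrightarrow> in_span M a C (\<lambda>b. t * v b) \<longleftrightarrow> in_span M a C v"
  using in_span_smult[of M a C v t] in_span_smult[of M a C "\<lambda>b. t * v b" "inverse t"]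
  by (auto simp: mult.assoc[symmetric])

lemma in_span_diff:
  assumes "in_span M a C v" "in_span M a C v'"
  shows "in_span M a C (\<lambda>b. v b - v' b)"
  using in_span_add[OF assms(1) in_span_smult[OF assms(2), of "-1"]] by simp

lemma in_span_sum: "(\<And>i. i \<in> I \<Longrightarrow> in_span M a C (v i)) \<Longrightarrow> in_span M a C (\<lambda>b. \<Sum>i\<in>I. v i b)"
  by (induction I rule: infinite_finite_induct) (simp_all add: in_span_zero in_span_add)

lemma in_span_column:
  assumes "finite C" "l \<in> C"
  shows "in_span M a C (\<lambda>b. M b l)"
  unfolding in_span_def
  by (rule exI[of _ "\<lambda>i. if i = l then 1 else 0"]) (use assms in \<open>simp add: if_distrib[of "\<lambda>x. x * _"] cong: if_cong\<close>)

lemma in_span_trans: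
  assumes "in_span M a C v" "\<And>l. l \<in> C \<Longrightarrow> in_span M' a D (\<lambda>b. M b l)"
  shows "in_span M' a D v"
proof -
  obtain \<mu> where \<mu>: "\<forall>b\<in>{1..a}. v b = (\<Sum>l\<in>C. \<mu> l * M b l)"
    using assms(1) unfolding in_span_def by blast
  have "in_span M' a D (\<lambda>b. \<Sum>l\<in>C. \<mu> l * M b l)"
    by (intro in_span_sum in_span_smult assms(2))
  then show ?thesis using \<mu> by (subst in_span_cong[of a D M' M']) auto
qed

lemma in_span_mono:
  assumes "in_span M a C v" "C \<subseteq> D" "finite D"
  shows "in_span M a D v"
  using assms(1) by (rule in_span_trans) (use assms in \<open>auto intro: in_span_column\<close>)

lemma in_span_mono_rows: "in_span M a C v \<Longrightarrow> a' \<le> a \<Longrightarrow> in_span M a' C v"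
  unfolding in_span_def by (meson atLeastAtMost_iff le_trans)

lemma in_span_insert_iff:
  assumes "finite C" "l \<notin> C"
  shows "in_span M a (insert l C) v \<longleftrightarrow> (\<exists>t. in_span M a C (\<lambda>b. v b - t * M b l))"
proof
  assume "in_span M a (insert l C) v"
  then obtain \<mu> where "\<forall>b\<in>{1..a}. v b = (\<Sum>l\<in>insert l C. \<mu> l * M b l)"
    unfolding in_span_def by blast
  then show "\<exists>t. in_span M a C (\<lambda>b. v b - t * M b l)"
    unfolding in_span_def by (intro exI[of _ "\<mu> l"] exI[of _ \<mu>]) (use assms in simp)
next
  assume "\<exists>t. in_span M a C (\<lambda>b. v b - t * M b l)"
  then obtain t where "in_span M a C (\<lambda>b. v b - t * M b l)" ..
  then have "in_span M a (insert l C) (\<lambda>b. (v b - t * M b l) + t * M b l)"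
    using assms by (intro in_span_add in_span_smult in_span_column) (auto elim: in_span_mono)
  then show "in_span M a (insert l C) v" by simp
qed

text \<open>The matrix factors through fewer than \<open>length cs\<close> columns. Padding both
  factors with zeros to square matrices makes the second one singular.\<close>

lemma lminor_eq_zero_of_span:
  fixes M :: "nat \<Rightarrow> nat \<Rightarrow> 'l::field"
  assumes "finite B" "card B < length cs" "length rs = length cs" "set rs \<subseteq> {1..a}"
    and "\<And>l. l \<in> set cs \<Longrightarrow> in_span M a B (\<lambda>b. M b l)"
  shows "lminor M rs cs = 0"
proof -
  let ?n = "length cs"
  obtain bs where bs: "set bs = B" "distinct bs" using finite_distinct_list[OF assms(1)] by blast
  then have lbs: "length bs < ?n" using assms(2) distinct_card by metis
  obtain \<mu> where \<mu>: "\<And>l b. l \<in> set cs \<Longrightarrow> b \<in> {1..a} \<Longrightarrow> M b l = (\<Sum>i\<in>B. \<mu> l i * M b i)"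
    using assms(5) unfolding in_span_def by metis
  define P where "P = mat ?n ?n (\<lambda>(i, j). if j < length bs then M (rs ! i) (bs ! j) else 0)"
  define Q where "Q = mat ?n ?n (\<lambda>(j, i). if j < length bs then \<mu> (cs ! i) (bs ! j) else 0)"
  have "mat ?n ?n (\<lambda>(i, j). M (rs ! i) (cs ! j)) = P * Q"
  proof (rule eq_matI)
    fix i j assume ij: "i < dim_row (P * Q)" "j < dim_col (P * Q)"
    then have "i < length rs" "j < length cs" using assms(3) by (simp_all add: P_def Q_def)
    then have "rs ! i \<in> {1..a}" "cs ! j \<in> set cs" using assms(4) by (blast intro: nth_mem)+
    then have "M (rs ! i) (cs ! j) = (\<Sum>k\<in>set bs. \<mu> (cs ! j) k * M (rs ! i) k)"
      using \<mu> bs by simp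
    also have "\<dots> = (\<Sum>k<length bs. \<mu> (cs ! j) (bs ! k) * M (rs ! i) (bs ! k))"
      using bs by (intro sum.reindex_bij_betw[symmetric] bij_betw_nth) auto
    also have "\<dots> = (\<Sum>k<?n. if k < length bs then \<mu> (cs ! j) (bs ! k) * M (rs ! i) (bs ! k) else 0)"
      using lbs by (intro sum.mono_neutral_cong_left) auto
    also have "\<dots> = (P * Q) $$ (i, j)"
      using ij by (auto simp: P_def Q_def scalar_prod_def atLeast0LessThan intro!: sum.cong)
    finally show "mat ?n ?n (\<lambda>(i, j). M (rs ! i) (cs ! j)) $$ (i, j) = (P * Q) $$ (i, j)"
      using ij by (simp add: P_def Q_def)
  qed (auto simp: P_def Q_def)
  moreover have "det (P * Q) = det P * det Q" by (rule det_mult) (auto simp: P_def Q_def)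
  \<comment> \<open>Row \<open>length bs\<close> of \<open>Q\<close> consists of padding only; it
    exists because \<open>length bs < ?n\<close>.\<close>
  moreover have "det Q = (\<Sum>j<?n. Q $$ (length bs, j) * cofactor Q (length bs) j)"
    by (rule laplace_expansion_row) (use lbs in \<open>auto simp: Q_def\<close>)
  then have "det Q = 0" using lbs by (simp add: Q_def)
  ultimately show ?thesis by (simp add: lminor_def)
qed

text \<open>Induction on the columns. Given a nonzero minor of the tail, suppose that no additional
  row \<open>b\<close> yields a nonzero minor. Laplace expansion along \<open>b\<close> is then a
  linear relation whose coefficients do not depend on \<open>b\<close>, and the nonzero coefficient
  of the first column places that column in the span of the others.\<close>

lemma exists_nonzero_lminor:
  fixes M :: "nat \<Rightarrow> nat \<Rightarrow> 'l::field"
  assumes "\<And>i. i < length cs \<Longrightarrow> \<not> in_span M a (set (drop (Suc i) cs)) (\<lambda>b. M b (cs ! i))"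
  shows "\<exists>rs. set rs \<subseteq> {1..a} \<and> length rs = length cs \<and> lminor M rs cs \<noteq> 0"
  using assms
proof (induction cs)
  case (Cons c cs)
  have "\<exists>rs. set rs \<subseteq> {1..a} \<and> length rs = length cs \<and> lminor M rs cs \<noteq> 0"
    by (rule Cons.IH) (use Cons.prems[of "Suc _"] in auto)
  then obtain rs where rs: "set rs \<subseteq> {1..a}" "length rs = length cs" "lminor M rs cs \<noteq> 0" by blast
  define \<nu> where "\<nu> j = (-1) ^ Suc j * lminor M rs (remove_nth (Suc j) (c # cs))" for j
  have exp: "lminor M (b # rs) (c # cs) = M b c * lminor M rs cs + (\<Sum>j<length cs. \<nu> j * M b (cs ! j))" for b
    using rs(2)
    by (subst lminor_expand_row)
      (simp_all add: sum.lessThan_Suc_shift remove_nth_def[of 0] \<nu>_def ac_simps del: sum.lessThan_Suc)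
  have "\<exists>b\<in>{1..a}. lminor M (b # rs) (c # cs) \<noteq> 0"
  proof (rule ccontr)
    assume "\<not> ?thesis"
    then have z: "M b c = (\<Sum>j<length cs. (- \<nu> j / lminor M rs cs) * M b (cs ! j))" if "b \<in> {1..a}" for b
      using that rs(3) exp[of b]
      by (simp add: field_simps sum_negf sum_divide_distrib[symmetric] add_eq_0_iff)
    have "in_span M a (set cs) (\<lambda>b. \<Sum>j<length cs. (- \<nu> j / lminor M rs cs) * M b (cs ! j))"
      by (intro in_span_sum in_span_smult in_span_column) auto
    then have "in_span M a (set cs) (\<lambda>b. M b c)"
      using z by (subst in_span_cong[of a _ M M]) auto
    then show False using Cons.prems[of 0] by simp
  qed
  then obtain b where "b \<in> {1..a}" "lminor M (b # rs) (c # cs) \<noteq> 0" ..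
  then show ?case using rs by (intro exI[of _ "b # rs"]) auto
qed auto


section \<open>Leading monomials of minors\<close>

text \<open>Disjoint supports exclude cancellation: the leading monomial of the sum comes from a
  single summand, all of whose monomials also occur in the sum.\<close>

lemma lm_sum_disjoint:
  fixes h :: "'i \<Rightarrow> 'a::field pol"
  assumes "finite I" and "\<And>i j. i \<in> I \<Longrightarrow> j \<in> I \<Longrightarrow> i \<noteq> j \<Longrightarrow> keys (h i) \<inter> keys (h j) = {}"
    and "(\<Sum>i\<in>I. h i) \<noteq> 0"
  shows "\<exists>i\<in>I. h i \<noteq> 0 \<and> lm (\<Sum>i\<in>I. h i) = lm (h i)"
proof -
  let ?f = "\<Sum>i\<in>I. h i"
  have look: "lookup ?f m = lookup (h i) m" if "i \<in> I" "m \<in> keys (h i)" for i m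
  proof -
    have "lookup (h j) m = 0" if "j \<in> I" "j \<noteq> i" for j
      using assms(2)[OF that(1) \<open>i \<in> I\<close> that(2)] \<open>m \<in> keys (h i)\<close> by (auto simp: in_keys_iff)
    then show ?thesis
      using that assms(1) by (simp add: lookup_sum lookup_add sum.remove[of I i])
  qed
  have "lookup ?f (lm ?f) \<noteq> 0" using lm_in_keys[OF assms(3)] by (simp add: in_keys_iff)
  then obtain i where i: "i \<in> I" "lm ?f \<in> keys (h i)"
    by (auto simp: lookup_sum in_keys_iff dest: sum.not_neutral_contains_not_neutral)
  have "lm (h i) = lm ?f"
  proof (rule lm_eqI[OF i(2)])
    fix m assume m: "m \<in> keys (h i)" "m \<noteq> lm ?f"
    then have "m \<in> keys ?f" using look[OF i(1) m(1)] by (simp add: in_keys_iff)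
    then show "lex_less m (lm ?f)" using m(2) by (rule lm_max)
  qed
  then show ?thesis using i by (intro bexI[of _ i]) auto
qed

lemma lm_single_mult:
  fixes g :: "'a::field pol"
  assumes "g \<noteq> 0" "c \<noteq> 0"
  shows "lm (single a c * g) = a + lm g"
proof (rule lm_eqI)
  show "a + lm g \<in> keys (single a c * g)"
    using lm_in_keys[OF assms(1)] by (simp add: keys_single_mult[OF assms(2)])
  show "lex_less m (a + lm g)" if "m \<in> keys (single a c * g)" "m \<noteq> a + lm g" for m
    using that lm_max[of _ g] by (auto simp: keys_single_mult[OF assms(2)])
qed

lemma keys_indet_mult: "keys (indet x * f) = (+) (single x 1) ` keys (f :: 'a::field pol)"
  by (simp add: indet_def keys_single_mult)

lemma lm_indet_mult: "f \<noteq> 0 \<Longrightarrow> lm (indet x * f) = single x 1 + lm (f :: 'a::field pol)"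
  by (simp add: indet_def lm_single_mult)

lemma indet_neq [simp]: "indet x \<noteq> (0 :: 'a::field pol)" "indet x \<noteq> (1 :: 'a::field pol)"
proof -
  have x: "single x (1::nat) \<noteq> 0" by (metis keys_single keys_zero insert_not_empty one_neq_zero)
  have k: "keys (indet x :: 'a pol) = {single x 1}" by (simp add: indet_def)
  show "indet x \<noteq> (0 :: 'a pol)" using k by (metis keys_zero insert_not_empty)
  show "indet x \<noteq> (1 :: 'a pol)" using k x by (metis keys_one singleton_inject)
qed

lemma indet_inj [simp]: "indet x = (indet y :: 'a::field pol) \<longleftrightarrow> x = y"
proof
  assume "indet x = (indet y :: 'a pol)"
  then have "keys (indet x :: 'a pol) = keys (indet y :: 'a pol)" by simp
  then have "single x (1::nat) = single y 1" by (simp add: indet_def)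
  then have "keys (single x (1::nat)) = keys (single y (1::nat))" by simp
  then show "x = y" by simp
qed simp

lemma lookup_notin_pvars: "x \<notin> pvars f \<Longrightarrow> m \<in> keys f \<Longrightarrow> lookup m x = 0"
  by (auto simp: pvars_def in_keys_iff)

text \<open>The nonzero entries of the column \<open>c\<close> are distinct monomials in indeterminates that occur
  nowhere else, so the terms of a Laplace expansion along that column cannot cancel.\<close>

lemma lm_lminor_expand_first:
  fixes E :: "nat \<Rightarrow> nat \<Rightarrow> 'a::field pol"
  assumes len: "length rs = Suc (length cs)" and nz: "lminor E rs (c # cs) \<noteq> 0"
    and entry: "\<And>b. b \<in> set rs \<Longrightarrow> E b c = 0 \<or> E b c = 1 \<or> (\<exists>x. E b c = indet x)"
    and inj: "\<And>b b'. b \<in> set rs \<Longrightarrow> b' \<in> set rs \<Longrightarrow> E b c = E b' c \<Longrightarrow> E b c \<noteq> 0 \<Longrightarrow> b = b'"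
    and free: "\<And>b b' k x. b \<in> set rs \<Longrightarrow> b' \<in> set rs \<Longrightarrow> k \<in> set cs \<Longrightarrow> E b c = indet x \<Longrightarrow> x \<notin> pvars (E b' k)"
  shows "\<exists>i<length rs. E (rs ! i) c \<noteq> 0 \<and> lminor E (remove_nth i rs) cs \<noteq> 0 \<and>
    mdvd (lm (lminor E (remove_nth i rs) cs)) (lm (lminor E rs (c # cs)))"
proof -
  define g where "g i = (-1) ^ i * lminor E (remove_nth i rs) cs" for i
  define h where "h i = E (rs ! i) c * g i" for i
  have exp: "lminor E rs (c # cs) = (\<Sum>i<length rs. h i)"
    using lminor_expand_col[OF len, of E c] by (simp add: h_def g_def)
  have g_pm: "pm_eq (g i) (lminor E (remove_nth i rs) cs)" for i
    by (cases "even i") (auto simp: g_def pm_eq_def)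
  have dist: "distinct rs" using lminor_nonzero_distinct(1)[OF nz] len by simp
  have g_free: "lookup m x = 0" if "i < length rs" "j < length rs" "E (rs ! i) c = indet x" "m \<in> keys (g j)" for i j x m
  proof (rule lookup_notin_pvars)
    have "pvars (lminor E (remove_nth j rs) cs) \<subseteq> UNIV - {x}"
    proof (rule pvars_lminor)
      show "length (remove_nth j rs) = length cs" using that len by (simp add: length_remove_nth)
      fix b' k assume "b' \<in> set (remove_nth j rs)" "k \<in> set cs"
      then show "pvars (E b' k) \<subseteq> UNIV - {x}"
        using free[of "rs ! i" b' k x] that set_remove_nth_subset[of j rs] by auto
    qed
    then show "x \<notin> pvars (g j)" using g_pm[of j] by (auto simp: pm_eq_def)
  qed (fact that)
  have h_keys: "(E (rs ! i) c = 1 \<and> m \<in> keys (g i)) \<or>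
      (\<exists>x m'. E (rs ! i) c = indet x \<and> m' \<in> keys (g i) \<and> m = single x 1 + m')"
    if i: "i < length rs" "m \<in> keys (h i)" for i m
  proof -
    consider "E (rs ! i) c = 0" | "E (rs ! i) c = 1" | x where "E (rs ! i) c = indet x"
      using entry[OF nth_mem[OF i(1)]] by blast
    then show ?thesis
    proof cases
      case 3
      then obtain m' where "m' \<in> keys (g i)" "m = single x 1 + m'"
        using i(2) by (auto simp only: h_def keys_indet_mult)
      then show ?thesis using 3 by blast
    qed (use i in \<open>simp_all add: h_def\<close>)
  qed
  have "\<exists>i\<in>{..<length rs}. h i \<noteq> 0 \<and> lm (\<Sum>i<length rs. h i) = lm (h i)"
  proof (rule lm_sum_disjoint)
    fix i j assume ij: "i \<in> {..<length rs}" "j \<in> {..<length rs}" "i \<noteq> j"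
    show "keys (h i) \<inter> keys (h j) = {}"
    proof (rule ccontr)
      assume "keys (h i) \<inter> keys (h j) \<noteq> {}"
      then obtain m where m: "m \<in> keys (h i)" "m \<in> keys (h j)" by auto
      have "rs ! i \<noteq> rs ! j" using ij dist by (simp add: nth_eq_iff_index_eq)
      then have ne: "E (rs ! i) c \<noteq> E (rs ! j) c" if "E (rs ! i) c \<noteq> 0"
        using inj[of "rs ! i" "rs ! j"] ij that by auto
      \<comment> \<open>Read in \<open>h i\<close>, the monomial \<open>m\<close> contains
        \<open>x\<close>. In \<open>h j\<close> the factor \<open>g j\<close> is free of
        \<open>x\<close>, and the entry of row \<open>j\<close> is 1 or an indeterminate other than
        \<open>x\<close>.\<close>
      have no: False if ij: "i < length rs" "j < length rs" and m: "m \<in> keys (h i)" "m \<in> keys (h j)"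
        and x: "E (rs ! i) c = indet x" and ne: "E (rs ! i) c \<noteq> E (rs ! j) c" for i j x
      proof -
        have "E (rs ! i) c \<noteq> 1" using x by simp
        then obtain x' m' where "E (rs ! i) c = indet x'" "m = single x' 1 + m'"
          using h_keys[OF ij(1) m(1)] by blast
        then have "lookup m x \<noteq> 0" using x by (simp add: lookup_add)
        moreover have "lookup m x = 0"
          using h_keys[OF ij(2) m(2)]
        proof
          assume "\<exists>x m'. E (rs ! j) c = indet x \<and> m' \<in> keys (g j) \<and> m = single x 1 + m'"
          then obtain z m' where z: "E (rs ! j) c = indet z" "m' \<in> keys (g j)" "m = single z 1 + m'"
            by blast
          then have "z \<noteq> x" using x ne by auto
          then show ?thesis using z g_free[OF ij x z(2)] by (simp add: lookup_add lookup_single)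
        qed (use g_free[OF ij x] in blast)
        ultimately show False by simp
      qed
      consider "E (rs ! i) c = 1" "E (rs ! j) c = 1" | x where "E (rs ! i) c = indet x"
        | x where "E (rs ! j) c = indet x"
        using h_keys[of i m] h_keys[of j m] ij m by blast
      then show False
      proof cases
        case 1
        then show False using ne by simp
      next
        case 2
        then show False using no[of i j] ij m ne by auto
      next
        case 3
        then show False using no[of j i] ij m ne h_keys[of i m] by auto
      qed
    qed
  qed (use nz exp in auto)
  then obtain i where i: "i < length rs" "h i \<noteq> 0" "lm (lminor E rs (c # cs)) = lm (h i)"
    unfolding exp by auto
  then have nz: "E (rs ! i) c \<noteq> 0" "g i \<noteq> 0" by (auto simp: h_def)
  then have "mdvd (lm (g i)) (lm (h i))"
    using entry[of "rs ! i"] i(1) by (auto simp: h_def lm_indet_mult)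
  then show ?thesis
    using i nz pm_eq_lm[OF g_pm[of i]] pm_eq_zero[OF g_pm[of i]] by auto
qed

lemma Suc_length_remove1: "c \<in> set cs \<Longrightarrow> Suc (length (remove1 c cs)) = length cs"
  using length_pos_if_in_set[of c cs] by (simp add: length_remove1)

text \<open>Moving \<open>c\<close> to the front changes a minor at most by a sign, so the expansion
  along the first column applies to every column.\<close>

lemma lm_lminor_expand:
  fixes E :: "nat \<Rightarrow> nat \<Rightarrow> 'a::field pol"
  assumes len: "length rs = length cs" and nz: "lminor E rs cs \<noteq> 0" and c: "c \<in> set cs"
    and entry: "\<And>b. b \<in> set rs \<Longrightarrow> E b c = 0 \<or> E b c = 1 \<or> (\<exists>x. E b c = indet x)"
    and inj: "\<And>b b'. b \<in> set rs \<Longrightarrow> b' \<in> set rs \<Longrightarrow> E b c = E b' c \<Longrightarrow> E b c \<noteq> 0 \<Longrightarrow> b = b'"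
    and free: "\<And>b b' k x. b \<in> set rs \<Longrightarrow> b' \<in> set rs \<Longrightarrow> k \<in> set cs \<Longrightarrow> k \<noteq> c \<Longrightarrow> E b c = indet x \<Longrightarrow>
      x \<notin> pvars (E b' k)"
  shows "\<exists>r\<in>set rs. E r c \<noteq> 0 \<and> lminor E (remove1 r rs) (remove1 c cs) \<noteq> 0 \<and>
    mdvd (lm (lminor E (remove1 r rs) (remove1 c cs))) (lm (lminor E rs cs))"
proof -
  let ?cs = "remove1 c cs"
  have len': "length rs = Suc (length ?cs)" using len c by (simp only: Suc_length_remove1)
  have pm: "pm_eq (lminor E rs (c # ?cs)) (lminor E rs cs)"
  proof (rule lminor_permute_cols)
    show "length rs = length (c # ?cs)" using len' by (simp only: list.size add_Suc_right add_0_right)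
  qed (use c in simp)
  have dist: "distinct cs" using lminor_nonzero_distinct(2)[OF nz len] .
  have "\<exists>i<length rs. E (rs ! i) c \<noteq> 0 \<and> lminor E (remove_nth i rs) ?cs \<noteq> 0 \<and>
    mdvd (lm (lminor E (remove_nth i rs) ?cs)) (lm (lminor E rs (c # ?cs)))"
  proof (rule lm_lminor_expand_first[OF len'])
    show "lminor E rs (c # ?cs) \<noteq> 0" using pm_eq_zero[OF pm] nz by simp
  next
    fix b b' k x assume "b \<in> set rs" "b' \<in> set rs" "k \<in> set ?cs" "E b c = indet x"
    then show "x \<notin> pvars (E b' k)" using dist by (intro free) auto
  qed (fact entry inj)+
  then obtain i where i: "i < length rs" "E (rs ! i) c \<noteq> 0" "lminor E (remove_nth i rs) ?cs \<noteq> 0"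
    "mdvd (lm (lminor E (remove_nth i rs) ?cs)) (lm (lminor E rs (c # ?cs)))" by blast
  have "pm_eq (lminor E (remove1 (rs ! i) rs) ?cs) (lminor E (remove_nth i rs) ?cs)"
  proof (rule lminor_permute_rows)
    show "mset (remove1 (rs ! i) rs) = mset (remove_nth i rs)"
      by (simp add: mset_remove_nth[OF i(1)])
    show "length (remove1 (rs ! i) rs) = length ?cs"
      using len' Suc_length_remove1[OF nth_mem[OF i(1)]] by (simp only: nat.inject)
  qed
  then show ?thesis
    using i pm_eq_zero pm_eq_lm[of _ "lminor E (remove_nth i rs) ?cs"] pm_eq_lm[OF pm] nth_mem[OF i(1)]
    by metis
qed


section \<open>A field with enough transcendental elements\<close>

text \<open>Each element involves finitely many of the countably many generators, so every finite
  set of elements leaves generators that are transcendental over it.\<close>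

type_synonym 'k rat_fun = "((nat \<Rightarrow>\<^sub>0 nat) \<Rightarrow>\<^sub>0 'k) fract"

definition emb :: "((nat \<Rightarrow>\<^sub>0 nat) \<Rightarrow>\<^sub>0 'k::field) \<Rightarrow> 'k rat_fun" where
  "emb p = Fract p 1"

definition cst :: "'k::field \<Rightarrow> 'k rat_fun" where
  "cst c = emb (single 0 c)"

definition gen :: "nat \<Rightarrow> 'k::field rat_fun" where
  "gen i = emb (single (single i 1) 1)"

lemma emb_eq_iff [simp]: "emb p = emb q \<longleftrightarrow> p = q"
  by (simp add: emb_def eq_fract)

lemma emb_zero [simp]: "emb 0 = 0"
  and emb_one [simp]: "emb 1 = 1"
  and emb_add: "emb (p + q) = emb p + emb q"
  and emb_mult: "emb (p * q) = emb p * emb q"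
  by (simp_all add: emb_def Zero_fract_def One_fract_def)

lemma emb_eq_zero_iff [simp]: "emb p = 0 \<longleftrightarrow> p = 0"
  using emb_eq_iff[of p 0] by simp

lemma emb_sum: "emb (sum f I) = (\<Sum>i\<in>I. emb (f i))"
  by (induction I rule: infinite_finite_induct) (simp_all add: emb_add)

interpretation cst: coeff_hom "cst :: 'k::field \<Rightarrow> 'k rat_fun"
proof unfold_locales
  show "cst (a + b) = cst a + cst b" "cst (a * b) = cst a * cst b" for a b :: 'k
    by (simp_all add: cst_def single_add emb_add mult_single flip: emb_mult)
qed (simp_all add: cst_def)

text \<open>The fractions in the first \<open>m\<close> generators. Expressing membership by
  clearing a denominator avoids the choice of representatives.\<close>

definition sub_rat_fun :: "nat \<Rightarrow> 'k::field rat_fun set" where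
  "sub_rat_fun m = {x. \<exists>p q. pvars p \<subseteq> {..<m} \<and> pvars q \<subseteq> {..<m} \<and> q \<noteq> 0 \<and> x * emb q = emb p}"

lemma sub_rat_fun_emb: "pvars p \<subseteq> {..<m} \<Longrightarrow> emb p \<in> sub_rat_fun m"
  unfolding sub_rat_fun_def by (intro CollectI exI[of _ p] exI[of _ 1], simp)

lemma sub_rat_fun_cst: "cst c \<in> sub_rat_fun m"
  unfolding cst_def by (rule sub_rat_fun_emb) (use pvars_single[of 0 c] in auto)

lemma sub_rat_fun_mono: "m \<le> m' \<Longrightarrow> sub_rat_fun m \<subseteq> sub_rat_fun m'"
  unfolding sub_rat_fun_def by (auto; metis lessThan_subset_iff order_trans)

lemma sub_rat_fun_add:
  assumes "x \<in> sub_rat_fun m" "y \<in> sub_rat_fun m"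
  shows "x + y \<in> sub_rat_fun m"
proof -
  obtain p q p' q' where pq: "pvars p \<subseteq> {..<m}" "pvars q \<subseteq> {..<m}" "q \<noteq> 0" "x * emb q = emb p"
    "pvars p' \<subseteq> {..<m}" "pvars q' \<subseteq> {..<m}" "q' \<noteq> 0" "y * emb q' = emb p'"
    using assms unfolding sub_rat_fun_def by blast
  have "(x + y) * emb (q * q') = (x * emb q) * emb q' + (y * emb q') * emb q"
    by (simp add: emb_mult algebra_simps)
  also have "\<dots> = emb (p * q' + p' * q)" using pq by (simp add: emb_mult emb_add)
  finally show ?thesis
    unfolding sub_rat_fun_def using pq
    by (intro CollectI exI[of _ "p * q' + p' * q"] exI[of _ "q * q'"])
      (simp add: pvars_add_subset pvars_mult_subset)
qed

lemma sub_rat_fun_mult: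
  assumes "x \<in> sub_rat_fun m" "y \<in> sub_rat_fun m"
  shows "x * y \<in> sub_rat_fun m"
proof -
  obtain p q p' q' where pq: "pvars p \<subseteq> {..<m}" "pvars q \<subseteq> {..<m}" "q \<noteq> 0" "x * emb q = emb p"
    "pvars p' \<subseteq> {..<m}" "pvars q' \<subseteq> {..<m}" "q' \<noteq> 0" "y * emb q' = emb p'"
    using assms unfolding sub_rat_fun_def by blast
  have "(x * y) * emb (q * q') = (x * emb q) * (y * emb q')"
    by (simp add: emb_mult algebra_simps)
  also have "\<dots> = emb (p * p')" using pq by (simp add: emb_mult)
  finally show ?thesis
    unfolding sub_rat_fun_def using pq
    by (intro CollectI exI[of _ "p * p'"] exI[of _ "q * q'"]) (simp add: pvars_mult_subset)
qed

lemma sub_rat_fun_one: "1 \<in> sub_rat_fun m"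
  using sub_rat_fun_emb[of 1 m] by simp

lemma sub_rat_fun_zero: "0 \<in> sub_rat_fun m"
  using sub_rat_fun_emb[of 0 m] by simp

lemma sub_rat_fun_power: "x \<in> sub_rat_fun m \<Longrightarrow> x ^ k \<in> sub_rat_fun m"
  by (induction k) (simp_all add: sub_rat_fun_one sub_rat_fun_mult)

lemma sub_rat_fun_prod: "(\<And>i. i \<in> I \<Longrightarrow> f i \<in> sub_rat_fun m) \<Longrightarrow> prod f I \<in> sub_rat_fun m"
  by (induction I rule: infinite_finite_induct) (simp_all add: sub_rat_fun_one sub_rat_fun_mult)

lemma sub_rat_fun_sum: "(\<And>i. i \<in> I \<Longrightarrow> f i \<in> sub_rat_fun m) \<Longrightarrow> sum f I \<in> sub_rat_fun m"
  by (induction I rule: infinite_finite_induct) (simp_all add: sub_rat_fun_zero sub_rat_fun_add)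

lemma finite_pvars: "finite (pvars f)"
  by (simp add: pvars_def)

lemma sub_rat_fun_exhaust: "\<exists>m. x \<in> sub_rat_fun m"
proof -
  obtain p q where pq: "x = Fract p q" "q \<noteq> 0" by (cases x) auto
  obtain m where m: "pvars p \<union> pvars q \<subseteq> {..<m}"
    using finite_nat_iff_bounded[of "pvars p \<union> pvars q"] by (auto simp: finite_pvars)
  have "x * emb q = emb p"
    using pq by (simp add: emb_def eq_fract)
  then show ?thesis using pq(2) m unfolding sub_rat_fun_def by blast
qed

text \<open>Multiplication by a common denominator turns the relation into one between polynomials
  \<open>P d\<close> free of generator \<open>i\<close>. Different powers of this generator keep
  their monomials apart, so each \<open>P d\<close> is 0.\<close>

lemma gen_transcendental:
  assumes a: "\<And>d. d \<le> D \<Longrightarrow> a d \<in> sub_rat_fun m" and "m \<le> i" and "(\<Sum>d\<le>D. a d * gen i ^ d) = 0"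
    and "d \<le> D"
  shows "a d = 0"
proof -
  obtain p q where pq: "\<And>d. d \<le> D \<Longrightarrow>
      pvars (p d) \<subseteq> {..<m} \<and> pvars (q d) \<subseteq> {..<m} \<and> q d \<noteq> 0 \<and> a d * emb (q d) = emb (p d)"
    using a unfolding sub_rat_fun_def by simp metis
  define P where "P d = p d * (\<Prod>j\<in>{..D} - {d}. q j)" for d
  define Q where "Q = (\<Prod>j\<le>D. q j)"
  have aQ: "a d * emb Q = emb (P d)" if "d \<le> D" for d
    using pq[OF that] that
    by (simp add: Q_def P_def prod.remove[of "{..D}" d] emb_mult flip: mult.assoc)
  have varsP: "pvars (P d) \<subseteq> {..<m}" if "d \<le> D" for d
    unfolding P_def by (intro pvars_mult_subset pvars_prod_subset) (use pq that in auto)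
  have X: "emb (single (single i d) (1::'a)) = gen i ^ d" for d
  proof (induction d)
    case (Suc d)
    have "single (single i (Suc d)) (1::'a) = single (single i 1) 1 * single (single i d) 1"
      by (simp add: mult_single flip: single_add)
    then show ?case using Suc by (simp add: emb_mult gen_def)
  qed simp
  have "emb (\<Sum>d\<le>D. single (single i d) 1 * P d) = (\<Sum>d\<le>D. gen i ^ d * (a d * emb Q))"
    unfolding emb_sum
  proof (rule sum.cong[OF refl])
    fix d assume "d \<in> {..D}"
    then show "emb (single (single i d) 1 * P d) = gen i ^ d * (a d * emb Q)"
      by (simp only: emb_mult X aQ atMost_iff)
  qed
  also have "\<dots> = (\<Sum>d\<le>D. a d * gen i ^ d) * emb Q"
    by (simp add: sum_distrib_right sum_distrib_left ac_simps)
  finally have "emb (\<Sum>d\<le>D. single (single i d) 1 * P d) = (\<Sum>d\<le>D. a d * gen i ^ d) * emb Q" .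
  then have zero: "(\<Sum>d\<le>D. single (single i d) 1 * P d) = 0"
    unfolding assms(3) by (simp only: mult_zero_left emb_eq_zero_iff)
  have "P d = 0"
  proof (rule poly_mapping_eqI)
    fix n
    show "lookup (P d) n = lookup 0 n"
    proof (cases "n \<in> keys (P d)")
      case True
      have n: "lookup n i = 0" if "n \<in> keys (P d)" "d \<le> D" for n d
      proof (rule lookup_notin_pvars)
        show "i \<notin> pvars (P d)" using varsP[OF that(2)] \<open>m \<le> i\<close> by fastforce
      qed (fact that)
      have "lookup (single (single i j) 1 * P j) (single i d + n) = 0" if "j \<le> D" "j \<noteq> d" for j
      proof (rule ccontr)
        assume "\<not> ?thesis"
        then have "single i d + n \<in> keys (single (single i j) 1 * P j)"
          by (simp only: in_keys_iff not_False_eq_True)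
        then obtain n' where n': "n' \<in> keys (P j)" "single i d + n = single i j + n'"
          using keys_single_mult[of "1::'a" "single i j" "P j"] by auto
        have "lookup (single i d + n) i = lookup (single i j + n') i" using n'(2) by (rule arg_cong)
        then show False
          using n[OF n'(1)] n[OF True \<open>d \<le> D\<close>] that by (simp add: lookup_add)
      qed
      then have "lookup (\<Sum>d\<le>D. single (single i d) 1 * P d) (single i d + n) = lookup (P d) n"
        using \<open>d \<le> D\<close> by (simp add: lookup_sum lookup_add sum.remove[of "{..D}" d] lookup_single_mult)
      then show ?thesis using zero by simp
    qed (simp add: in_keys_iff)
  qed
  then show "a d = 0"
    using aQ[OF \<open>d \<le> D\<close>] pq by (auto simp: Q_def)
qed

text \<open>Infinitely many generators are new with respect to the coordinates in \<open>V\<close>,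
  so one of them also avoids \<open>Y\<close>. In the application \<open>Y\<close> collects the
  values of \<open>t\<close> at which a rank would drop.\<close>

lemma exists_transcendental:
  fixes \<xi> :: "'x \<Rightarrow> 'k::field rat_fun"
  assumes "finite V" "finite Y"
  shows "\<exists>t. t \<notin> Y \<and> (\<forall>a D. (\<forall>d. pvars (a d) \<subseteq> V) \<longrightarrow> (\<Sum>d\<le>D. cst.ev \<xi> (a d) * t ^ d) = 0 \<longrightarrow>
    (\<forall>d\<le>D. cst.ev \<xi> (a d) = 0))"
proof -
  have "\<exists>m. \<forall>x\<in>V. \<xi> x \<in> sub_rat_fun m"
    using assms(1)
  proof (induction V)
    case (insert x V)
    then obtain m where "\<forall>x\<in>V. \<xi> x \<in> sub_rat_fun m" by blast
    moreover obtain m' where "\<xi> x \<in> sub_rat_fun m'" using sub_rat_fun_exhaust by blast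
    ultimately show ?case
      using sub_rat_fun_mono[of m "max m m'"] sub_rat_fun_mono[of m' "max m m'"]
      by (intro exI[of _ "max m m'"]) auto
  qed auto
  then obtain m where m: "\<And>x. x \<in> V \<Longrightarrow> \<xi> x \<in> sub_rat_fun m" by blast
  have "inj (gen :: nat \<Rightarrow> 'k rat_fun)"
  proof (rule injI)
    fix i j assume "gen i = (gen j :: 'k rat_fun)"
    then have "keys (single (single i (1::nat)) (1::'k)) = keys (single (single j (1::nat)) (1::'k))"
      by (simp add: gen_def)
    then have "keys (single i (1::nat)) = keys (single j (1::nat))" by simp
    then show "i = j" by simp
  qed
  then have "infinite (gen ` {m..} :: 'k rat_fun set)"
    using finite_imageD[of gen "{m..}"] inj_on_subset infinite_Ici by blast
  then have "\<not> gen ` {m..} \<subseteq> Y" using assms(2) finite_subset by metis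
  then obtain i where i: "m \<le> i" "gen i \<notin> Y" by auto
  have sub: "cst.ev \<xi> f \<in> sub_rat_fun m" if "pvars f \<subseteq> V" for f
    unfolding cst.ev_def monom_ev_def
    by (intro sub_rat_fun_sum sub_rat_fun_mult sub_rat_fun_cst sub_rat_fun_prod sub_rat_fun_power m)
      (use that in \<open>auto simp: pvars_def\<close>)
  show ?thesis
  proof (intro exI[of _ "gen i"] conjI allI impI)
    fix a D d
    assume "\<forall>d. pvars (a d) \<subseteq> V" "(\<Sum>d\<le>D. cst.ev \<xi> (a d) * gen i ^ d) = 0" "d \<le> D"
    then show "cst.ev \<xi> (a d) = 0"
      using gen_transcendental[of D "\<lambda>d. cst.ev \<xi> (a d)" m i d] sub i(1) by blast
  qed (rule i(2))
qed

section \<open>Rank functions and adjacent transpositions\<close>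

definition row_perm :: "nat \<Rightarrow> (nat \<Rightarrow> nat) \<Rightarrow> bool" where
  "row_perm n p \<longleftrightarrow> bij_betw p {1..n} {1..n}"

text \<open>The rank of the lowest \<open>a\<close> rows and first \<open>k\<close> columns of the
  permutation matrix with its 1 of column \<open>l\<close> in row \<open>q l\<close>.\<close>

definition rk :: "(nat \<Rightarrow> nat) \<Rightarrow> nat \<Rightarrow> nat \<Rightarrow> nat" where
  "rk q a k = card {l \<in> {1..k}. q l \<le> a}"

lemma rk_Suc: "rk q a (Suc k) = rk q a k + (if q (Suc k) \<le> a then 1 else 0)"
proof -
  have "{l \<in> {1..Suc k}. q l \<le> a} = {l \<in> {1..k}. q l \<le> a} \<union> (if q (Suc k) \<le> a then {Suc k} else {})"
    by (auto simp: le_Suc_eq)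
  then show ?thesis by (simp add: rk_def)
qed

lemma row_perm_in: "row_perm n p \<Longrightarrow> k \<in> {1..n} \<Longrightarrow> p k \<in> {1..n}"
  unfolding row_perm_def using bij_betwE by blast

lemma row_perm_inj: "row_perm n p \<Longrightarrow> k \<in> {1..n} \<Longrightarrow> l \<in> {1..n} \<Longrightarrow> p k = p l \<longleftrightarrow> k = l"
  unfolding row_perm_def using bij_betw_imp_inj_on inj_on_eq_iff by metis

lemma row_perm_surj: "row_perm n p \<Longrightarrow> b \<in> {1..n} \<Longrightarrow> \<exists>l\<in>{1..n}. b = p l"
  unfolding row_perm_def bij_betw_def by blast

definition swap_at :: "nat \<Rightarrow> (nat \<Rightarrow> nat) \<Rightarrow> nat \<Rightarrow> nat" where
  "swap_at j p = p(j := p (Suc j), Suc j := p j)"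

lemma swap_at_simps [simp]:
  "swap_at j p j = p (Suc j)" "swap_at j p (Suc j) = p j"
  "k \<noteq> j \<Longrightarrow> k \<noteq> Suc j \<Longrightarrow> swap_at j p k = p k"
  by (simp_all add: swap_at_def)

lemma swap_at_comp: "swap_at j p = p \<circ> swap_at j id"
  by (auto simp: swap_at_def fun_eq_iff)

lemma swap_at_swap_at [simp]: "swap_at j (swap_at j p) = p"
  by (auto simp: swap_at_def fun_eq_iff)

lemma row_perm_swap_at:
  assumes "row_perm n p" "1 \<le> j" "j < n"
  shows "row_perm n (swap_at j p)"
proof -
  have "bij_betw (swap_at j id) {1..n} {1..n}"
    by (rule bij_betw_byWitness[where f' = "swap_at j id"])
      (use assms in \<open>auto simp: swap_at_def\<close>)
  then show ?thesis
    using assms(1) bij_betw_trans unfolding row_perm_def swap_at_comp[of j p] by blast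
qed

lemma image_swap_at_less: "k \<le> j \<Longrightarrow> swap_at j p ` {1..<k} = p ` {1..<k}"
  by (intro image_cong) auto

lemma image_swap_at_greater:
  assumes "1 \<le> j" "Suc j < k"
  shows "swap_at j p ` {1..<k} = p ` {1..<k}"
proof -
  have "swap_at j id ` {1..<k} = {1..<k}"
  proof
    show "swap_at j id ` {1..<k} \<subseteq> {1..<k}" using assms by (auto simp: swap_at_def)
    show "{1..<k} \<subseteq> swap_at j id ` {1..<k}"
    proof
      fix x assume "x \<in> {1..<k}"
      then show "x \<in> swap_at j id ` {1..<k}"
        using assms by (intro image_eqI[of _ _ "swap_at j id x"]) (auto simp: swap_at_def)
    qed
  qed
  then show ?thesis unfolding swap_at_comp[of j p] image_comp[symmetric] by simp
qed

text \<open>Exchanging the values at \<open>j\<close> and \<open>j + 1\<close> alters the set of the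
  first \<open>k\<close> values only for \<open>k = j\<close>.\<close>

lemma rk_swap_at:
  assumes "1 \<le> j" "k \<noteq> j"
  shows "rk (swap_at j q) a k = rk q a k"
proof -
  have less: "rk (swap_at j q) a k = rk q a k" if "k < j" for k
    unfolding rk_def by (rule arg_cong[where f = card]) (use that in auto)
  obtain j' where j': "j = Suc j'" using assms(1) by (cases j) auto
  have "rk (swap_at j q) a (Suc j) = rk q a (Suc j)"
    using less[of j'] by (simp add: j' rk_Suc del: swap_at_simps) (simp add: swap_at_def)
  then have "rk (swap_at j q) a (Suc j + m) = rk q a (Suc j + m)" for m
    by (induction m) (simp_all add: rk_Suc)
  then show ?thesis
    using less[of k] assms(2) by (metis Suc_leI le_add_diff_inverse linorder_neqE_nat)
qed

section \<open>Generic matrices attached to a permutation\<close>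

text \<open>The indeterminate in row \<open>b\<close> and column \<open>k\<close> is labelled by \<open>b\<close> and by the row \<open>p k\<close> of the 1 in
  column \<open>k\<close>; in this way the labels do not change when \<open>p\<close> is multiplied by an adjacent
  transposition. Rows are counted from the bottom.\<close>

locale labelling =
  fixes n :: nat and lab :: "nat \<Rightarrow> nat \<Rightarrow> pos"
  assumes lab_inj [simp]: "lab b c = lab b' c' \<longleftrightarrow> b = b' \<and> c = c'"
begin

text \<open>The Rothe diagram: strictly below the 1 of column \<open>k\<close>, and not to the right
  of the 1 of row \<open>b\<close>.\<close>

definition is_var :: "(nat \<Rightarrow> nat) \<Rightarrow> nat \<Rightarrow> nat \<Rightarrow> bool" where
  "is_var p b k \<longleftrightarrow> b \<in> {1..n} \<and> k \<in> {1..n} \<and> b < p k \<and> b \<notin> p ` {1..<k}"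

definition ent :: "(nat \<Rightarrow> nat) \<Rightarrow> nat \<Rightarrow> nat \<Rightarrow> 'k::field pol" where
  "ent p b k = (if b = p k then 1 else if is_var p b k then indet (lab b (p k)) else 0)"

definition vars :: "(nat \<Rightarrow> nat) \<Rightarrow> pos set" where
  "vars p = {lab b (p k) | b k. is_var p b k}"

text \<open>Admitting lists in any order and with repetitions adds only signs and 0. The bounds
  \<open>a = 0\<close> and \<open>k = 0\<close> contribute nothing, as the lists have positive
  length.\<close>

definition gens :: "(nat \<Rightarrow> nat) \<Rightarrow> (nat \<Rightarrow> nat) \<Rightarrow> 'k::field pol set" where
  "gens p q = {lminor (ent p) rs cs | a k rs cs. a \<le> n \<and> k \<le> n \<and> set rs \<subseteq> {1..a} \<and> set cs \<subseteq> {1..k} \<and>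
     length rs = length cs \<and> length cs = Suc (rk q a k)}"

lemma finite_vars: "finite (vars p)"
proof -
  have "vars p \<subseteq> (\<lambda>(b, k). lab b (p k)) ` ({1..n} \<times> {1..n})"
    unfolding vars_def is_var_def by fastforce
  then show ?thesis by (rule finite_subset) simp
qed

lemma pvars_ent: "pvars (ent p b k) \<subseteq> vars p"
proof (cases "b \<noteq> p k \<and> is_var p b k")
  case True
  then have "lab b (p k) \<in> vars p" unfolding vars_def by blast
  then show ?thesis using True pvars_indet[of "lab b (p k)"] by (simp add: ent_def) blast
qed (auto simp: ent_def)

lemma pvars_lminor_ent: "length rs = length cs \<Longrightarrow> pvars (lminor (ent p) rs cs) \<subseteq> vars p"
  by (intro pvars_lminor pvars_ent)

lemma pvars_gens: "g \<in> gens p q \<Longrightarrow> pvars g \<subseteq> vars p"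
  by (auto simp: gens_def intro: subsetD[OF pvars_lminor_ent])

lemma ent_cases: "ent p b k = 0 \<or> ent p b k = 1 \<or> (\<exists>x. ent p b k = indet x)"
  by (auto simp: ent_def)

lemma ent_eq_indetD: "ent p b k = (indet x :: 'k::field pol) \<Longrightarrow> x = lab b (p k)"
  by (auto simp: ent_def split: if_splits)

lemma pvars_ent_lab: "lab b c \<in> pvars (ent p b' k :: 'k::field pol) \<Longrightarrow> b = b' \<and> c = p k"
proof -
  assume x: "lab b c \<in> pvars (ent p b' k :: 'k pol)"
  then have "ent p b' k = (indet (lab b' (p k)) :: 'k pol)" by (auto simp: ent_def split: if_splits)
  then have "lab b c \<in> {lab b' (p k)}" using x pvars_indet[of "lab b' (p k)", where 'a = 'k] by (metis subsetD)
  then show "b = b' \<and> c = p k" by simp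
qed

lemma lm_expand_col:
  assumes p: "row_perm n p" and "length rs = length cs" "lminor (ent p) rs cs \<noteq> (0 :: 'k::field pol)"
    and cs: "set cs \<subseteq> {1..n}" and "c \<in> set cs"
  shows "\<exists>r\<in>set rs. ent p r c \<noteq> (0 :: 'k pol) \<and>
    lminor (ent p) (remove1 r rs) (remove1 c cs) \<noteq> (0 :: 'k pol) \<and>
    mdvd (lm (lminor (ent p) (remove1 r rs) (remove1 c cs) :: 'k pol)) (lm (lminor (ent p) rs cs :: 'k pol))"
proof (rule lm_lminor_expand)
  fix b b' assume "ent p b c = (ent p b' c :: 'k pol)" "ent p b c \<noteq> (0 :: 'k pol)"
  then show "b = b'" by (auto simp: ent_def indet_neq[symmetric] split: if_splits)
next
  fix b b' k x assume "k \<in> set cs" "k \<noteq> c" "ent p b c = (indet x :: 'k pol)"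
  then have "x = lab b (p c)" "p c \<noteq> p k"
    using row_perm_inj[OF p, of c k] subsetD[OF cs] \<open>c \<in> set cs\<close> by (blast dest: ent_eq_indetD)+
  then show "x \<notin> pvars (ent p b' k :: 'k pol)" using pvars_ent_lab by blast
qed (use assms ent_cases in auto)

text \<open>After transposition the two components of the labels exchange their roles:
  \<open>p k\<close> distinguishes the entries of a row, and the row component separates different
  rows.\<close>

lemma lm_expand_row:
  assumes p: "row_perm n p" and len: "length rs = length cs" and nz: "lminor (ent p) rs cs \<noteq> (0 :: 'k::field pol)"
    and cs: "set cs \<subseteq> {1..n}" and r: "r \<in> set rs"
  shows "\<exists>c\<in>set cs. ent p r c \<noteq> (0 :: 'k pol) \<and>
    lminor (ent p) (remove1 r rs) (remove1 c cs) \<noteq> (0 :: 'k pol) \<and>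
    mdvd (lm (lminor (ent p) (remove1 r rs) (remove1 c cs) :: 'k pol)) (lm (lminor (ent p) rs cs :: 'k pol))"
proof -
  define F :: "nat \<Rightarrow> nat \<Rightarrow> 'k pol" where "F = (\<lambda>k b. ent p b k)"
  have F: "lminor F cs' rs' = lminor (ent p) rs' cs'" if "length rs' = length cs'" for rs' cs'
    unfolding F_def by (rule lminor_transpose[OF that])
  have "\<exists>c\<in>set cs. F c r \<noteq> 0 \<and> lminor F (remove1 c cs) (remove1 r rs) \<noteq> 0 \<and>
    mdvd (lm (lminor F (remove1 c cs) (remove1 r rs))) (lm (lminor F cs rs))"
  proof (rule lm_lminor_expand)
    show "lminor F cs rs \<noteq> 0" using F[OF len] nz by simp
  next
    fix k k' assume "k \<in> set cs" "k' \<in> set cs" "F k r = F k' r" "F k r \<noteq> 0"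
    then have "p k = p k'" by (auto simp: F_def ent_def indet_neq[symmetric] split: if_splits)
    then show "k = k'" using row_perm_inj[OF p, of k k'] cs \<open>k \<in> set cs\<close> \<open>k' \<in> set cs\<close> by blast
  next
    fix k k' b x assume "b \<noteq> r" "F k r = indet x"
    then show "x \<notin> pvars (F k' b)"
      using pvars_ent_lab[of r "p k" p b k', where 'k = 'k] by (auto simp: F_def dest!: ent_eq_indetD)
  qed (use len r ent_cases in \<open>auto simp: F_def\<close>)
  then obtain c where "c \<in> set cs" "F c r \<noteq> 0" "lminor F (remove1 c cs) (remove1 r rs) \<noteq> 0"
    "mdvd (lm (lminor F (remove1 c cs) (remove1 r rs))) (lm (lminor F cs rs))" by blast
  moreover have "length (remove1 r rs) = length (remove1 c cs)"
    using len r \<open>c \<in> set cs\<close> by (simp add: length_remove1)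
  ultimately show ?thesis using F len by (intro bexI[of _ c]) (auto simp: F_def)
qed

text \<open>This gives up the last column for a decrease of the size by one, which is what a rank
  condition asks for when column \<open>Suc k\<close> raises the rank.\<close>

lemma shrink_cols:
  assumes p: "row_perm n p" and len: "length rs = length cs" and nz: "lminor (ent p) rs cs \<noteq> (0 :: 'k::field pol)"
    and cs: "set cs \<subseteq> {1..Suc k}" and k: "Suc k \<le> n" and r: "length cs = Suc (Suc r)"
  shows "\<exists>rs' cs'. set rs' \<subseteq> set rs \<and> set cs' \<subseteq> {1..k} \<and> length rs' = length cs' \<and> length cs' = Suc r \<and>
    lminor (ent p) rs' cs' \<noteq> (0 :: 'k pol) \<and>
    mdvd (lm (lminor (ent p) rs' cs' :: 'k pol)) (lm (lminor (ent p) rs cs :: 'k pol))"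
proof -
  \<comment> \<open>If column \<open>Suc k\<close> is not among the chosen ones, deleting any other
    column gives the right size.\<close>
  define c where "c = (if Suc k \<in> set cs then Suc k else hd cs)"
  have c: "c \<in> set cs" using r by (cases cs) (auto simp: c_def)
  obtain x where x: "x \<in> set rs" "lminor (ent p) (remove1 x rs) (remove1 c cs) \<noteq> (0 :: 'k pol)"
    "mdvd (lm (lminor (ent p) (remove1 x rs) (remove1 c cs) :: 'k pol)) (lm (lminor (ent p) rs cs :: 'k pol))"
    using lm_expand_col[OF p len nz _ c] order_trans[OF cs, of "{1..n}"] k by auto
  have "Suc k \<notin> set (remove1 c cs)"
    using lminor_nonzero_distinct(2)[OF nz len] by (auto simp: c_def)
  then have "set (remove1 c cs) \<subseteq> {1..k}"
    using cs set_remove1_subset[of c cs] by (auto simp: le_Suc_eq subset_iff)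
  then show ?thesis
    using x len r Suc_length_remove1[OF x(1)] Suc_length_remove1[OF c] set_remove1_subset[of x rs]
    by (intro exI[of _ "remove1 x rs"] exI[of _ "remove1 c cs"]) simp
qed

lemma shrink_rows:
  assumes p: "row_perm n p" and len: "length rs = length cs" and nz: "lminor (ent p) rs cs \<noteq> (0 :: 'k::field pol)"
    and cs: "set cs \<subseteq> {1..n}" and rs: "set rs \<subseteq> {1..Suc a}" and r: "length cs = Suc (Suc r)"
  shows "\<exists>rs' cs'. set cs' \<subseteq> set cs \<and> set rs' \<subseteq> {1..a} \<and> length rs' = length cs' \<and> length cs' = Suc r \<and>
    lminor (ent p) rs' cs' \<noteq> (0 :: 'k pol) \<and>
    mdvd (lm (lminor (ent p) rs' cs' :: 'k pol)) (lm (lminor (ent p) rs cs :: 'k pol))"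
proof -
  define x where "x = (if Suc a \<in> set rs then Suc a else hd rs)"
  have x: "x \<in> set rs" using r len by (cases rs) (auto simp: x_def)
  obtain c where c: "c \<in> set cs" "lminor (ent p) (remove1 x rs) (remove1 c cs) \<noteq> (0 :: 'k pol)"
    "mdvd (lm (lminor (ent p) (remove1 x rs) (remove1 c cs) :: 'k pol)) (lm (lminor (ent p) rs cs :: 'k pol))"
    using lm_expand_row[OF p len nz cs x] by auto
  have "Suc a \<notin> set (remove1 x rs)"
    using lminor_nonzero_distinct(1)[OF nz len] by (auto simp: x_def)
  then have "set (remove1 x rs) \<subseteq> {1..a}"
    using rs set_remove1_subset[of x rs] by (auto simp: le_Suc_eq subset_iff)
  then show ?thesis
    using c len r Suc_length_remove1[OF x] Suc_length_remove1[OF c(1)] set_remove1_subset[of c cs]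
    by (intro exI[of _ "remove1 x rs"] exI[of _ "remove1 c cs"]) simp
qed

text \<open>The type argument fixes the coefficient field, which the monomial does not
  determine.\<close>

definition covers :: "'k::field itself \<Rightarrow> (nat \<Rightarrow> nat) \<Rightarrow> (nat \<Rightarrow> nat) \<Rightarrow> monom \<Rightarrow> bool" where
  "covers _ p q m \<longleftrightarrow> (\<exists>g\<in>gens p q :: 'k pol set. g \<noteq> 0 \<and> mdvd (lm g) m)"

lemma coversI:
  assumes "a \<le> n" "k \<le> n" "set rs \<subseteq> {1..a}" "set cs \<subseteq> {1..k}" "length rs = length cs"
    "length cs = Suc (rk q a k)" "lminor (ent p) rs cs \<noteq> (0 :: 'k::field pol)"
    "mdvd (lm (lminor (ent p) rs cs :: 'k pol)) m"
  shows "covers TYPE('k) p q m"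
  unfolding covers_def gens_def using assms by blast

lemma covers_mdvd: "covers TYPE('k::field) p q m \<Longrightarrow> mdvd m m' \<Longrightarrow> covers TYPE('k) p q m'"
  unfolding covers_def using mdvd_trans by blast

end

section \<open>Multiplication by an adjacent transposition at the last descent\<close>

context labelling
begin

text \<open>Only the relative order of the labels is prescribed. For the initial permutation the
  labels are the positions themselves, but later an indeterminate may stand in a column other than
  the one in its label.\<close>

definition compat :: "(nat \<Rightarrow> nat) \<Rightarrow> bool" where
  "compat p \<longleftrightarrow> (\<forall>b k b' k'. is_var p b k \<longrightarrow> is_var p b' k' \<longrightarrow> k < k' \<or> k = k' \<and> b' < b \<longrightarrow>
     indet_less (lab b (p k)) (lab b' (p k')))"

end

text \<open>\<open>j\<close> is the last descent of \<open>p\<close>; the columns to the right of \<open>j\<close> are then unit vectors.\<close>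

locale last_descent = labelling +
  fixes p :: "nat \<Rightarrow> nat" and j :: nat
  assumes p: "row_perm n p" and j: "1 \<le> j" "j < n" and desc: "p (Suc j) < p j"
    and inc: "\<And>k l. j < k \<Longrightarrow> k < l \<Longrightarrow> l \<le> n \<Longrightarrow> p k < p l"
begin

abbreviation "ps \<equiv> swap_at j p"
abbreviation "s \<equiv> swap_at j id"

definition y :: pos where
  "y = lab (p (Suc j)) (p j)"

lemma ps: "row_perm n ps"
  using row_perm_swap_at[OF p j] .

text \<open>A row \<open>b\<close> below the 1 of column \<open>k\<close> and without a 1 further
  left has its 1 to the right of \<open>k\<close>, hence a lower 1 in a later column. Beyond the
  last descent this contradicts \<open>inc\<close>.\<close>

lemma is_var_le:
  assumes "is_var p b k"
  shows "k \<le> j"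
proof (rule ccontr)
  assume k: "\<not> k \<le> j"
  obtain l where l: "l \<in> {1..n}" "b = p l"
    using row_perm_surj[OF p, of b] assms by (auto simp: is_var_def)
  then have "l \<notin> {1..<k}" "p l < p k" using assms by (auto simp: is_var_def)
  then have "k < l" using l by (metis atLeastAtMost_iff atLeastLessThan_iff less_irrefl linorder_neqE_nat)
  then show False using inc[of k l] k l \<open>p l < p k\<close> by auto
qed

text \<open>Column \<open>j\<close> of the diagram moves to column \<open>j + 1\<close> and loses
  the box of \<open>y\<close>. Nothing remains in column \<open>j\<close>, because all rows below
  the 1 of \<open>ps\<close> there have their ones to the left.\<close>

lemma is_var_ps_iff:
  "is_var ps b k \<longleftrightarrow> k < j \<and> is_var p b k \<or> k = Suc j \<and> is_var p b j \<and> b \<noteq> p (Suc j)"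
proof -
  consider "k < j" | "k = j" | "k = Suc j" | "Suc j < k" by linarith
  then show ?thesis
  proof cases
    case 1
    then show ?thesis by (simp add: is_var_def image_swap_at_less)
  next
    case 2
    have "\<not> is_var ps b j"
    proof
      assume v: "is_var ps b j"
      then obtain l where l: "l \<in> {1..n}" "b = p l"
        using row_perm_surj[OF p, of b] by (auto simp: is_var_def)
      then have "l \<notin> {1..<j}" "p l < p (Suc j)"
        using v image_swap_at_less[of j j p] by (auto simp: is_var_def)
      then show False using l desc inc[of "Suc j" l]
        by (metis Suc_lessI atLeastAtMost_iff atLeastLessThan_iff less_asym less_irrefl linorder_neqE_nat lessI)
    qed
    then show ?thesis using 2 by simp
  next
    case 3
    have "{1..<Suc j} = insert j {1..<j}" using j by auto
    then have "ps ` {1..<Suc j} = insert (p (Suc j)) (p ` {1..<j})"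
      using image_swap_at_less[of j j p] by simp
    then show ?thesis using 3 j by (auto simp: is_var_def)
  next
    case 4
    have "is_var ps b k \<longleftrightarrow> is_var p b k"
      using 4 image_swap_at_greater[OF j(1) 4, of p] by (simp add: is_var_def)
    then show ?thesis using 4 is_var_le by fastforce
  qed
qed

lemma is_var_y: "is_var p (p (Suc j)) j"
proof -
  have "p (Suc j) \<notin> p ` {1..<j}"
    using row_perm_inj[OF p, of "Suc j"] j by fastforce
  then show ?thesis
    using row_perm_in[OF p, of "Suc j"] j desc by (auto simp: is_var_def)
qed

lemma y_in_vars: "y \<in> vars p"
  unfolding y_def vars_def using is_var_y by blast

lemma vars_ps: "vars ps = vars p - {y}"
proof
  show "vars ps \<subseteq> vars p - {y}"
  proof
    fix x assume "x \<in> vars ps"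
    then obtain b k where x: "x = lab b (ps k)" and v: "is_var ps b k" unfolding vars_def by blast
    show "x \<in> vars p - {y}"
    proof (cases "k < j")
      case True
      then have "is_var p b k" using v is_var_ps_iff by simp
      moreover have "p k \<noteq> p j"
        using row_perm_inj[OF p, of k j] j True v by (auto simp: is_var_def)
      ultimately show ?thesis using x True by (auto simp: vars_def y_def)
    next
      case False
      then have "k = Suc j" "is_var p b j" "b \<noteq> p (Suc j)" using v is_var_ps_iff by auto
      then show ?thesis using x by (auto simp: vars_def y_def)
    qed
  qed
  show "vars p - {y} \<subseteq> vars ps"
  proof
    fix x assume x: "x \<in> vars p - {y}"
    then obtain b k where b: "x = lab b (p k)" "is_var p b k" unfolding vars_def by blast
    show "x \<in> vars ps"
    proof (cases "k = j")
      case True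
      then have "is_var ps b (Suc j)" using x b is_var_ps_iff by (auto simp: y_def)
      then show ?thesis using b True unfolding vars_def by force
    next
      case False
      then have "k < j" using is_var_le[OF b(2)] by simp
      then have "is_var ps b k" "ps k = p k" using is_var_ps_iff b by auto
      then show ?thesis using b unfolding vars_def by force
    qed
  qed
qed

text \<open>The columns right of \<open>j\<close> carry no indeterminate, and one below
  \<open>y\<close> in column \<open>j\<close> would also belong to column \<open>j\<close> of the
  diagram of \<open>ps\<close>, which is empty.\<close>

lemma top_var_y:
  assumes "compat p"
  shows "top_var y (vars p)"
  unfolding top_var_def
proof (intro ballI impI)
  fix x assume x: "x \<in> vars p" "x \<noteq> y"
  then obtain b k where b: "x = lab b (p k)" "is_var p b k" unfolding vars_def by blast
  have "k < j \<or> k = j \<and> p (Suc j) < b"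
  proof (rule ccontr)
    assume "\<not> ?thesis"
    then have k: "k = j" "b \<le> p (Suc j)" using is_var_le[OF b(2)] by auto
    then have "b < p (Suc j)" using x(2) b(1) by (cases "b = p (Suc j)") (auto simp: y_def)
    then have "is_var ps b j" using b(2) k j image_swap_at_less[of j j p] by (auto simp: is_var_def)
    then show False using is_var_ps_iff by simp
  qed
  then show "indet_less x y"
    using assms b is_var_y unfolding compat_def y_def by blast
qed

text \<open>The map \<open>s\<close> is increasing on the columns that carry indeterminates of
  \<open>ps\<close>: those before \<open>j\<close>, which it fixes, and \<open>Suc j\<close>, which
  it sends to \<open>j\<close>.\<close>

lemma compat_ps:
  assumes "compat p"
  shows "compat ps"
  unfolding compat_def
proof (intro allI impI)
  fix b k b' k'
  assume v: "is_var ps b k" "is_var ps b' k'" and less: "k < k' \<or> k = k' \<and> b' < b"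
  have *: "is_var p c (s l) \<and> ps l = p (s l)" if "is_var ps c l" for c l
    using that is_var_ps_iff[of c l] by auto
  have "s k < s k' \<or> s k = s k' \<and> b' < b"
    using less v is_var_ps_iff[of b k] is_var_ps_iff[of b' k'] by auto
  then show "indet_less (lab b (ps k)) (lab b' (ps k'))"
    using assms *[OF v(1)] *[OF v(2)] unfolding compat_def by metis
qed

lemma ent_other: "k \<noteq> j \<Longrightarrow> k \<noteq> Suc j \<Longrightarrow> ent p b k = ent ps b k"
  using is_var_ps_iff[of b k] is_var_le[of b k] by (auto simp: ent_def)

lemma ent_ps_unit: "ent ps b j = (if b = p (Suc j) then 1 else 0)"
  using is_var_ps_iff[of b j] by (auto simp: ent_def)

lemma ent_unit: "ent p b (Suc j) = ent ps b j"
  unfolding ent_ps_unit using is_var_le[of b "Suc j"] by (auto simp: ent_def)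

lemma ent_j: "ent p b j = (ent ps b (Suc j) + indet y * ent ps b j :: 'k::field pol)"
proof (cases "b = p (Suc j)")
  case True
  then have "ent p b j = (indet y :: 'k pol)" "ent ps b (Suc j) = (0 :: 'k pol)"
    using desc is_var_y is_var_ps_iff[of b "Suc j"] by (auto simp: ent_def y_def)
  then show ?thesis using True by (simp add: ent_ps_unit)
next
  case False
  then have "ent ps b j = (0 :: 'k pol)" by (simp add: ent_ps_unit)
  then show ?thesis
    using is_var_ps_iff[of b "Suc j"] False by (auto simp: ent_def[of p] ent_def[of ps b "Suc j"])
qed

lemma lminor_no_j:
  assumes "length rs = length cs" "j \<notin> set cs"
  shows "lminor (ent p) rs cs = lminor (ent ps) rs (map s cs)"
  unfolding lminor_map_cols
proof (rule lminor_cong[OF assms(1)])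
  fix b k assume "k \<in> set cs"
  then have "k \<noteq> j" using assms(2) by blast
  then show "ent p b k = ent ps b (s k)"
    by (cases "k = Suc j") (simp_all add: ent_unit ent_other)
qed

lemma lminor_j:
  assumes len: "length rs = Suc (length cs)" and "j \<notin> set cs"
  shows "lminor (ent p) rs (j # cs) =
    (lminor (ent ps) rs (Suc j # map s cs) + indet y * lminor (ent ps) rs (j # map s cs) :: 'k::field pol)"
proof -
  have len': "length rs = Suc (length (map s cs))" using len by simp
  have "lminor (ent p) (remove_nth i rs) cs = (lminor (ent ps) (remove_nth i rs) (map s cs) :: 'k pol)"
    if "i < length rs" for i
    by (rule lminor_no_j) (use that assms in \<open>simp_all add: length_remove_nth\<close>)
  then have "(lminor (ent p) rs (j # cs) :: 'k pol) = (\<Sum>i<length rs. (ent ps (rs ! i) (Suc j) + indet y * ent ps (rs ! i) j) *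
      ((-1) ^ i * lminor (ent ps) (remove_nth i rs) (map s cs)))"
    unfolding lminor_expand_col[OF len] by (simp add: ent_j)
  also have "\<dots> = lminor (ent ps) rs (Suc j # map s cs) + indet y * lminor (ent ps) rs (j # map s cs)"
    unfolding lminor_expand_col[OF len'] by (simp add: distrib_right sum.distrib sum_distrib_left mult.assoc)
  finally show ?thesis .
qed

lemma map_s_id: "j \<notin> set cs \<Longrightarrow> Suc j \<notin> set cs \<Longrightarrow> map s cs = cs"
  by (intro map_idI) (metis id_apply swap_at_simps(3))

text \<open>For \<open>k \<noteq> j\<close> the bound \<open>k\<close> admits both of the columns
  \<open>j\<close> and \<open>j + 1\<close> or neither. A minor therefore survives up to sign,
  unless it uses column \<open>Suc j\<close> without \<open>j\<close> together with the row of the 1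
  in the unit column. In that case another minor of the same size takes over, whose leading monomial
  divides the original one.\<close>

lemma covers_of_ps_minor:
  fixes rs cs :: "nat list"
  assumes "a \<le> n" "k \<le> n" "k \<noteq> j" "set rs \<subseteq> {1..a}" "set cs \<subseteq> {1..k}" and len: "length rs = length cs"
    and "length cs = Suc (rk q a k)" and nz: "lminor (ent ps) rs cs \<noteq> (0 :: 'k::field pol)"
  shows "covers TYPE('k) p q (lm (lminor (ent ps) rs cs :: 'k pol))"
proof -
  have cov: "covers TYPE('k) p q (lm (lminor (ent ps) rs cs :: 'k pol))"
    if "set rs' \<subseteq> {1..a}" "set cs' \<subseteq> {1..k}" "length rs' = length cs'" "length cs' = length cs"
      "f \<noteq> 0" "mdvd (lm f) (lm (lminor (ent ps) rs cs :: 'k pol))" "pm_eq (lminor (ent p) rs' cs') f"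
    for rs' cs' and f :: "'k pol"
    using coversI[OF assms(1,2) that(1,2,3), where 'k = 'k] that assms(7) pm_eq_zero[OF that(7)] pm_eq_lm[OF that(7)] by simp
  have Sk: "Suc j \<le> k" if "j \<in> set cs \<or> Suc j \<in> set cs" using that assms(3,5) by fastforce
  have s_k: "s l \<in> {1..k}" if "l \<in> set cs" for l
    using that Sk assms(5) j by (cases "l = j"; cases "l = Suc j") auto
  have dist: "distinct cs" using lminor_nonzero_distinct(2)[OF nz len] .
  have ss: "map s (map s cs') = cs'" for cs'
    by (intro map_idI[of _ "\<lambda>x. x", simplified] nth_equalityI) (auto simp: swap_at_def)
  show ?thesis
  proof (cases "Suc j \<in> set cs")
    case False
    have "j \<notin> set (map s cs)" using False by (auto simp: swap_at_def split: if_splits)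
    then have eq: "lminor (ent p) rs (map s cs) = lminor (ent ps) rs cs"
      using lminor_no_j[of rs "map s cs"] len ss by simp
    show ?thesis
    proof (rule cov)
      show "set (map s cs) \<subseteq> {1..k}" using s_k by auto
      show "pm_eq (lminor (ent p) rs (map s cs)) (lminor (ent ps) rs cs)" by (simp only: eq pm_eq_refl)
    qed (use assms in simp_all)
  next
    case S: True
    have j_k: "j \<in> {1..k}" "Suc j \<in> {1..k}" using Sk S j by auto
    define cs1 where "cs1 = remove1 (Suc j) cs"
    have cs1: "mset cs = mset (Suc j # cs1)" using S by (simp add: cs1_def)
    have S1: "Suc j \<notin> set cs1" "distinct cs1" "set cs1 \<subseteq> set cs" using dist by (auto simp: cs1_def set_remove1_subset)
    have len1: "length rs = Suc (length cs1)" using Suc_length_remove1[OF S] len by (simp add: cs1_def)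
    have pm1: "pm_eq (lminor (ent ps) rs cs) (lminor (ent ps) rs (Suc j # cs1) :: 'k pol)"
      by (rule lminor_permute_cols[OF cs1 len])
    \<comment> \<open>With both columns present, adding a multiple of one to the other has no
      effect: the coefficient of \<open>y\<close> is a minor with a repeated column.\<close>
    have both: "lminor (ent p) rs' (j # Suc j # cs') = (lminor (ent ps) rs' (Suc j # j # cs') :: 'k pol)"
      if "j \<notin> set cs'" "Suc j \<notin> set cs'" "length rs' = Suc (Suc (length cs'))" for rs' cs'
    proof -
      have "lminor (ent ps) rs' (j # j # cs') = (0 :: 'k pol)"
        using lminor_nonzero_distinct(2)[of "ent ps :: nat \<Rightarrow> nat \<Rightarrow> 'k pol" rs' "j # j # cs'"] that(3) by auto
      then show ?thesis using lminor_j[of rs' "Suc j # cs'", where 'k = 'k] that map_s_id[of cs'] by simp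
    qed
    show ?thesis
    proof (cases "j \<in> set cs")
      case True
      define cs2 where "cs2 = remove1 j cs1"
      have j1: "j \<in> set cs1" using True by (simp add: cs1_def)
      have mset2: "mset cs1 = mset (j # cs2)" using j1 by (simp add: cs2_def)
      have notin: "j \<notin> set cs2" "Suc j \<notin> set cs2"
        using S1 set_remove1_subset[of j cs1] by (auto simp: cs2_def)
      have len2: "length rs = Suc (Suc (length cs2))"
        using len1 Suc_length_remove1[OF j1] by (simp add: cs2_def)
      have "mset (Suc j # cs1) = mset (Suc j # j # cs2)" using mset2 by simp
      then have "pm_eq (lminor (ent ps) rs (Suc j # cs1)) (lminor (ent ps) rs (Suc j # j # cs2) :: 'k pol)"
        by (rule lminor_permute_cols) (simp add: len1)
      then have pm: "pm_eq (lminor (ent p) rs (j # Suc j # cs2)) (lminor (ent ps) rs cs :: 'k pol)"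
        unfolding both[OF notin len2] by (rule pm_eq_sym[OF pm_eq_trans[OF pm1]])
      show ?thesis
      proof (rule cov[OF _ _ _ _ nz mdvd_refl pm])
        show "set (j # Suc j # cs2) \<subseteq> {1..k}"
          using j_k S1(3) assms(5) set_remove1_subset[of j cs1] by (auto simp: cs2_def)
      qed (use assms len2 in simp_all)
    next
      case False
      have j1: "j \<notin> set cs1" using False S1(3) by blast
      note lin = lminor_j[OF len1 j1, unfolded map_s_id[OF j1 S1(1)], where 'k = 'k]
      show ?thesis
      proof (cases "p (Suc j) \<in> set rs")
        case False
        have "ent ps (rs ! i) j = (0 :: 'k pol)" if "i < length rs" for i
          using False nth_mem[OF that] by (auto simp: ent_ps_unit)
        then have "lminor (ent ps) rs (j # cs1) = (0 :: 'k pol)"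
          by (simp add: lminor_expand_col[OF len1])
        then have "lminor (ent p) rs (j # cs1) = (lminor (ent ps) rs (Suc j # cs1) :: 'k pol)" using lin by simp
        then have pm: "pm_eq (lminor (ent p) rs (j # cs1)) (lminor (ent ps) rs cs :: 'k pol)"
          using pm_eq_sym[OF pm1] by simp
        show ?thesis
          by (rule cov[OF _ _ _ _ nz mdvd_refl pm]) (use assms j_k S1(3) len1 in auto)
      next
        case True
        \<comment> \<open>Row \<open>?i\<close> is split off together with some column
          \<open>c\<close>, which differs from \<open>Suc j\<close> because the entry there is 0.
          The unit column then replaces \<open>c\<close>: expanding along it returns the minor
          without row \<open>?i\<close> and column \<open>c\<close>.\<close>
        let ?i = "p (Suc j)"
        obtain c where c: "c \<in> set cs" "ent ps ?i c \<noteq> (0 :: 'k pol)"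
          "lminor (ent ps) (remove1 ?i rs) (remove1 c cs) \<noteq> (0 :: 'k pol)"
          "mdvd (lm (lminor (ent ps) (remove1 ?i rs) (remove1 c cs) :: 'k pol)) (lm (lminor (ent ps) rs cs :: 'k pol))"
          using lm_expand_row[OF ps len nz _ True] assms(2,5) by (meson atLeastatMost_subset_iff le_refl order_trans)
        have "ent ps ?i (Suc j) = (0 :: 'k pol)"
          using desc is_var_ps_iff[of ?i "Suc j"] by (simp add: ent_def)
        then have "c \<noteq> Suc j" using c(2) by auto
        then have c1: "c \<in> set cs1" using c(1) by (simp add: cs1_def)
        define cs2 where "cs2 = remove1 c cs1"
        define rs2 where "rs2 = remove1 ?i rs"
        have mset2: "mset (remove1 c cs) = mset (Suc j # cs2)"
          unfolding mset_remove1 cs1 cs2_def mset.simps using \<open>c \<noteq> Suc j\<close> by (intro diff_union_swap[symmetric])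
        have notin: "j \<notin> set cs2" "Suc j \<notin> set cs2"
          using S1 j1 set_remove1_subset[of c cs1] by (auto simp: cs2_def)
        have len2: "length rs = Suc (Suc (length cs2))"
          using len1 Suc_length_remove1[OF c1] by (simp add: cs2_def)
        have lenr: "Suc (length rs2) = length rs"
          unfolding rs2_def by (rule Suc_length_remove1[OF True])
        have dr: "distinct rs" using lminor_nonzero_distinct(1)[OF nz len] .
        have "?i \<notin> set rs2" using dr by (simp add: rs2_def)
        then have unit: "ent ps ((?i # rs2) ! i) j = (if i = 0 then 1 else 0 :: 'k pol)" if "i < length (?i # rs2)" for i
          using that by (cases i) (simp_all add: ent_ps_unit, metis nth_mem)
        have "(lminor (ent ps) (?i # rs2) (j # Suc j # cs2) :: 'k pol) =
            (\<Sum>i<length (?i # rs2). (if i = 0 then 1 else 0) * ((-1) ^ i * lminor (ent ps) (remove_nth i (?i # rs2)) (Suc j # cs2)))"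
        proof (subst lminor_expand_col)
          show "length (?i # rs2) = Suc (length (Suc j # cs2))" using lenr len2 by simp
        qed (intro sum.cong refl arg_cong2[where f = "(*)"] unit, simp)
        also have "\<dots> = lminor (ent ps) rs2 (Suc j # cs2)"
          by (simp add: sum.lessThan_Suc_shift remove_nth_def del: sum.lessThan_Suc)
        finally have 1: "lminor (ent ps) (?i # rs2) (j # Suc j # cs2) = (lminor (ent ps) rs2 (Suc j # cs2) :: 'k pol)" .
        have 2: "pm_eq (lminor (ent ps) rs (Suc j # j # cs2)) (lminor (ent ps) rs (j # Suc j # cs2) :: 'k pol)"
          by (rule lminor_permute_cols) (simp_all add: len2)
        have 3: "pm_eq (lminor (ent ps) rs (j # Suc j # cs2)) (lminor (ent ps) (?i # rs2) (j # Suc j # cs2) :: 'k pol)"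
          by (rule lminor_permute_rows) (use True len2 in \<open>simp_all add: rs2_def\<close>)
        have 4: "pm_eq (lminor (ent ps) (remove1 ?i rs) (remove1 c cs)) (lminor (ent ps) rs2 (Suc j # cs2) :: 'k pol)"
          unfolding rs2_def[symmetric]
          by (rule lminor_permute_cols[OF mset2]) (use lenr len Suc_length_remove1[OF c(1)] in simp)
        have pm: "pm_eq (lminor (ent p) rs (j # Suc j # cs2))
            (lminor (ent ps) (remove1 ?i rs) (remove1 c cs) :: 'k pol)"
          unfolding both[OF notin len2]
          by (rule pm_eq_trans[OF 2 pm_eq_trans[OF 3[unfolded 1] pm_eq_sym[OF 4]]])
        show ?thesis
        proof (rule cov[OF _ _ _ _ c(3,4) pm])
          show "set (j # Suc j # cs2) \<subseteq> {1..k}"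
            using j_k S1(3) assms(5) set_remove1_subset[of c cs1] by (auto simp: cs2_def)
        qed (use assms len2 in simp_all)
      qed
    qed
  qed
qed

text \<open>At an ascent of \<open>q'\<close> the conditions for \<open>k = j\<close> follow from
  the others as far as leading monomials are concerned. If column \<open>j\<close> does not raise
  the rank, neither does \<open>j + 1\<close>, and the minor counts for \<open>k = j + 1\<close>; if
  it does, the minor can be shrunk to the columns before \<open>j\<close>.\<close>

lemma covers_of_ps_gens:
  assumes g: "g \<in> gens ps q'" "g \<noteq> (0 :: 'k::field pol)" and q': "q' j < q' (Suc j)"
    and q: "\<And>a k. k \<noteq> j \<Longrightarrow> rk q a k = rk q' a k"
  shows "covers TYPE('k) p q (lm g)"
proof -
  obtain a k rs cs where rc: "a \<le> n" "k \<le> n" "set rs \<subseteq> {1..a}" "set cs \<subseteq> {1..k}"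
    "length rs = length cs" "length cs = Suc (rk q' a k)" "g = lminor (ent ps) rs cs"
    using g(1) unfolding gens_def by blast
  show ?thesis
  proof (cases "k = j")
    case False
    then show ?thesis using covers_of_ps_minor[of a k rs cs q, where 'k = 'k] rc g(2) q[OF False] by simp
  next
    case True
    show ?thesis
    proof (cases "a < q' j")
      case a: True
      then have "rk q' a (Suc j) = rk q' a j" using q' by (simp add: rk_Suc)
      moreover have "set cs \<subseteq> {1..Suc j}" using rc(4) True by fastforce
      ultimately show ?thesis
        using covers_of_ps_minor[of a "Suc j" rs cs q, where 'k = 'k] rc g(2) q[of "Suc j" a] j True by simp
    next
      case a: False
      obtain i where i: "j = Suc i" using j by (cases j) auto
      have r: "length cs = Suc (Suc (rk q a i))"
        using rc(6) a True q[of i a] by (simp add: i rk_Suc)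
      obtain rs' cs' where "set rs' \<subseteq> set rs" "set cs' \<subseteq> {1..i}" "length rs' = length cs'"
        "length cs' = Suc (rk q a i)" "lminor (ent ps) rs' cs' \<noteq> (0 :: 'k pol)"
        and dvd: "mdvd (lm (lminor (ent ps) rs' cs' :: 'k pol)) (lm (lminor (ent ps) rs cs :: 'k pol))"
        using shrink_cols[OF ps rc(5) _ _ _ r, where 'k = 'k and k = i] rc True i g(2) by auto
      then have "covers TYPE('k) p q (lm (lminor (ent ps) rs' cs' :: 'k pol))"
        using rc j i by (intro covers_of_ps_minor[of a i]) auto
      then show ?thesis using dvd rc(7) covers_mdvd by blast
    qed
  qed
qed

text \<open>The critical minors are those for \<open>k = j\<close> that use column \<open>j\<close>.
  This column of \<open>p\<close> contains \<open>y\<close> times column \<open>j\<close> of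
  \<open>ps\<close>, so the minor of \<open>p\<close> on the same rows and columns has the given
  one, up to sign, as its coefficient of \<open>y\<close>.\<close>

lemma covers_y_of_ps_gens:
  assumes g: "g \<in> gens ps q" "g \<noteq> (0 :: 'k::field pol)" and "compat p"
  shows "covers TYPE('k) p q (single y 1 + lm g)"
proof -
  obtain a k rs cs where rc: "a \<le> n" "k \<le> n" "set rs \<subseteq> {1..a}" "set cs \<subseteq> {1..k}"
    "length rs = length cs" "length cs = Suc (rk q a k)" "g = lminor (ent ps) rs cs"
    using g(1) unfolding gens_def by blast
  have nz: "lminor (ent ps) rs cs \<noteq> (0 :: 'k pol)" using g(2) rc(7) by simp
  show ?thesis
  proof (cases "k = j")
    case False
    then show ?thesis
      using covers_of_ps_minor[of a k rs cs q, where 'k = 'k] rc g(2) covers_mdvd mdvd_add(2) by blast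
  next
    case k: True
    have Sj: "Suc j \<notin> set cs" using rc(4) k by auto
    show ?thesis
    proof (cases "j \<in> set cs")
      case False
      then have "lminor (ent p) rs cs = (lminor (ent ps) rs cs :: 'k pol)"
        using lminor_no_j[OF rc(5) False] map_s_id[OF False Sj] by simp
      then show ?thesis using rc nz by (intro coversI[of a k rs cs]) auto
    next
      case True
      define cs1 where "cs1 = remove1 j cs"
      have dist: "distinct cs" using lminor_nonzero_distinct(2)[OF nz rc(5)] .
      have cs1: "j \<notin> set cs1" "Suc j \<notin> set cs1" "set cs1 \<subseteq> set cs"
        using dist Sj by (auto simp: cs1_def set_remove1_subset)
      have len1: "length rs = Suc (length cs1)"
        using rc(5) Suc_length_remove1[OF True] by (simp add: cs1_def)
      have pm: "pm_eq (lminor (ent ps) rs cs) (lminor (ent ps) rs (j # cs1) :: 'k pol)"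
        by (rule lminor_permute_cols) (use True rc(5) in \<open>simp_all add: cs1_def\<close>)
      have eq: "lminor (ent p) rs (j # cs1) =
          (lminor (ent ps) rs (Suc j # cs1) + indet y * lminor (ent ps) rs (j # cs1) :: 'k pol)"
        using lminor_j[OF len1 cs1(1)] map_s_id[OF cs1(1,2)] by simp
      have "lminor (ent p) rs (j # cs1) \<noteq> (0 :: 'k pol) \<and>
          lm (lminor (ent p) rs (j # cs1) :: 'k pol) = single y 1 + lm (lminor (ent ps) rs (j # cs1) :: 'k pol)"
        unfolding eq
        by (intro conjI lm_linear[OF top_var_y[OF assms(3)] y_in_vars])
          (use pm_eq_zero[OF pm] nz len1 pvars_lminor_ent[of rs "_ # cs1" ps] vars_ps in simp_all)
      then show ?thesis
        using rc k len1 cs1(3) True pm_eq_lm[OF pm] by (intro coversI[of a k rs "j # cs1"]) auto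
    qed
  qed
qed

end

section \<open>Points with prescribed ranks\<close>

lemma sorted_desc_drop:
  assumes "sorted_wrt (>) cs" "i < length cs" "l \<in> set (drop (Suc i) cs)"
  shows "l < (cs ! i :: nat)"
proof -
  have "cs = take i cs @ cs ! i # drop (Suc i) cs" using assms(2) by (simp add: id_take_nth_drop[symmetric])
  then have "sorted_wrt (>) (cs ! i # drop (Suc i) cs)" using assms(1) by (metis sorted_wrt_append)
  then show ?thesis using assms(3) by simp
qed

context labelling
begin

text \<open>The first \<open>k\<close> columns of a matrix that is exact for \<open>q\<close>, cut off after the \<open>a\<close> bottom rows, have rank
  \<open>rk q a k\<close>.\<close>

definition exact :: "(nat \<Rightarrow> nat \<Rightarrow> 'l::field) \<Rightarrow> (nat \<Rightarrow> nat) \<Rightarrow> bool" where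
  "exact M q \<longleftrightarrow> (\<forall>k\<in>{1..n}. \<forall>a\<le>n. in_span M a {1..<k} (\<lambda>b. M b k) \<longleftrightarrow> a < q k)"

text \<open>A column with \<open>q l > a\<close> depends on the columns to its left; by induction
  these lie in the span of the columns with \<open>q i \<le> a\<close>.\<close>

lemma exact_span:
  assumes "exact M q" "a \<le> n" "k \<le> n" "l \<in> {1..k}"
  shows "in_span M a {i \<in> {1..k}. q i \<le> a} (\<lambda>b. M b l)"
  using assms(4)
proof (induction l rule: less_induct)
  case (less l)
  show ?case
  proof (cases "q l \<le> a")
    case True
    then show ?thesis using less.prems by (intro in_span_column) auto
  next
    case False
    then have "in_span M a {1..<l} (\<lambda>b. M b l)"
      using assms less.prems unfolding exact_def by force
    then show ?thesis
      by (rule in_span_trans) (use less in auto)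
  qed
qed

lemma exact_lminor_zero:
  assumes "exact M q" "a \<le> n" "k \<le> n" "set rs \<subseteq> {1..a}" "set cs \<subseteq> {1..k}" "length rs = length cs"
    and "rk q a k < length cs"
  shows "lminor M rs cs = 0"
proof (rule lminor_eq_zero_of_span)
  show "card {i \<in> {1..k}. q i \<le> a} < length cs" using assms(7) by (simp add: rk_def)
  show "in_span M a {i \<in> {1..k}. q i \<le> a} (\<lambda>b. M b l)" if "l \<in> set cs" for l
    using exact_span[OF assms(1,2,3)] that assms(5) by blast
qed (use assms in auto)

text \<open>In descending order the rest of the list consists of columns further left, on which
  exactness forbids the current column to depend.\<close>

lemma exact_lminor_nonzero:
  assumes "exact M q" "a \<le> n" "sorted_wrt (>) cs" "set cs \<subseteq> {1..n}" "\<And>l. l \<in> set cs \<Longrightarrow> q l \<le> a"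
  shows "\<exists>rs. set rs \<subseteq> {1..a} \<and> length rs = length cs \<and> lminor M rs cs \<noteq> 0"
proof (rule exists_nonzero_lminor, rule notI)
  fix i assume i: "i < length cs" and span: "in_span M a (set (drop (Suc i) cs)) (\<lambda>b. M b (cs ! i))"
  have mem: "cs ! i \<in> set cs" using i by simp
  have "set (drop (Suc i) cs) \<subseteq> {1..<cs ! i}"
  proof
    fix l assume l: "l \<in> set (drop (Suc i) cs)"
    then have "l \<in> {1..n}" using assms(4) in_set_dropD by fastforce
    then show "l \<in> {1..<cs ! i}" using sorted_desc_drop[OF assms(3) i l] by simp
  qed
  then have "in_span M a {1..<cs ! i} (\<lambda>b. M b (cs ! i))" using in_span_mono[OF span] by simp
  moreover have "cs ! i \<in> {1..n}" using mem assms(4) by blast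
  ultimately have "a < q (cs ! i)" using assms(1,2) unfolding exact_def by blast
  then show False using assms(5)[OF mem] by simp
qed

text \<open>Let \<open>u\<close> be column \<open>j + 1\<close> plus \<open>t\<close> times column
  \<open>j\<close>. Replacing the two columns by \<open>u\<close> and column \<open>j\<close> leaves
  their common span unchanged, so all other columns behave as before. What remains open is for how
  many rows \<open>u\<close> depends on the columns before \<open>j\<close>: the least possible
  number preserves \<open>q\<close>, the largest one exchanges the two values.\<close>

lemma exact_swap:
  fixes M M' :: "nat \<Rightarrow> nat \<Rightarrow> 'l::field"
  assumes j: "1 \<le> j" "j < n" and ex: "exact M q" and q: "q j < q (Suc j)" "q (Suc j) \<le> n"
    and M'_other: "\<And>b k. k \<noteq> j \<Longrightarrow> k \<noteq> Suc j \<Longrightarrow> M' b k = M b k"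
    and M'_Suc: "\<And>b. M' b (Suc j) = M b j" and M'_j: "\<And>b. M' b j = M b (Suc j) + t * M b j"
  shows "(\<And>a. q j \<le> a \<Longrightarrow> a < q (Suc j) \<Longrightarrow> \<not> in_span M a {1..<j} (\<lambda>b. M b (Suc j) + t * M b j)) \<Longrightarrow> exact M' q"
    and "in_span M (q (Suc j) - 1) {1..<j} (\<lambda>b. M b (Suc j) + t * M b j) \<Longrightarrow> exact M' (swap_at j q)"
proof -
  let ?S = "{1..<j}"
  let ?u = "\<lambda>b. M b (Suc j) + t * M b j"
  have S: "{1..<Suc j} = insert j ?S" "j \<notin> ?S" using j by auto
  have low: "in_span M' a {1..<k} v \<longleftrightarrow> in_span M a {1..<k} v" if "k \<le> j" for a k v
    by (rule in_span_cong) (use that M'_other in auto)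
  have high: "in_span M' a {1..<k} v \<longleftrightarrow> in_span M a {1..<k} v" if k: "Suc j < k" for a k v
  proof
    assume "in_span M' a {1..<k} v"
    then show "in_span M a {1..<k} v"
    proof (rule in_span_trans)
      fix l assume "l \<in> {1..<k}"
      then show "in_span M a {1..<k} (\<lambda>b. M' b l)"
        using k j by (cases "l = j"; cases "l = Suc j")
          (auto simp: M'_j M'_Suc M'_other intro!: in_span_add in_span_smult in_span_column)
    qed
  next
    have 1: "in_span M' a {1..<k} (\<lambda>b. M b j)"
      using in_span_column[of "{1..<k}" "Suc j" M' a] k j by (simp add: M'_Suc)
    have "in_span M' a {1..<k} (\<lambda>b. M' b j - t * M b j)"
      using k j 1 by (intro in_span_diff in_span_smult in_span_column) auto
    then have 2: "in_span M' a {1..<k} (\<lambda>b. M b (Suc j))" by (simp add: M'_j)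
    assume "in_span M a {1..<k} v"
    then show "in_span M' a {1..<k} v"
    proof (rule in_span_trans)
      fix l assume "l \<in> {1..<k}"
      then show "in_span M' a {1..<k} (\<lambda>b. M b l)"
        using 1 2 in_span_column[of "{1..<k}" l M' a] M'_other[of l] by (cases "l = j"; cases "l = Suc j") auto
    qed
  qed
  \<comment> \<open>\<open>H1\<close> and \<open>H2\<close> state what exactness of \<open>M\<close>
    says about the columns \<open>j\<close> and \<open>j + 1\<close>, relative to the columns before
    \<open>j\<close>; \<open>T1\<close> and \<open>T2\<close> reduce the conditions on
    \<open>M'\<close> to the same form.\<close>
  have H1: "in_span M a ?S (\<lambda>b. M b j) \<longleftrightarrow> a < q j" if "a \<le> n" for a
    using ex j that unfolding exact_def by auto
  have H2: "(\<exists>s. in_span M a ?S (\<lambda>b. M b (Suc j) - s * M b j)) \<longleftrightarrow> a < q (Suc j)" if "a \<le> n" for a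
    using ex j that in_span_insert_iff[OF _ S(2), of M a "\<lambda>b. M b (Suc j)"] unfolding exact_def S(1)[symmetric] by auto
  have T1: "in_span M' a {1..<j} (\<lambda>b. M' b j) \<longleftrightarrow> in_span M a ?S ?u" for a
    unfolding M'_j by (rule low) simp
  have T2: "in_span M' a {1..<Suc j} (\<lambda>b. M' b (Suc j)) \<longleftrightarrow> (\<exists>s. in_span M a ?S (\<lambda>b. M b j - s * ?u b))" for a
    unfolding S(1) in_span_insert_iff[OF finite_atLeastLessThan S(2)] M'_j M'_Suc low[OF order_refl]
    by (rule refl)
  have u_lt: "a < q (Suc j)" if "a \<le> n" "in_span M a ?S ?u" for a
    using H2[OF that(1)] that(2) by (auto intro!: exI[of _ "- t"])
  have T2_lt: "in_span M a ?S (\<lambda>b. M b j) \<or> a < q (Suc j)" if a: "a \<le> n" and s: "in_span M a ?S (\<lambda>b. M b j - s * ?u b)" for a s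
  proof (cases "s = 0")
    case False
    \<comment> \<open>Division by \<open>s\<close> turns the dependence of column \<open>j\<close>
      on \<open>?u\<close> into a dependence of column \<open>j + 1\<close> on column
      \<open>j\<close>.\<close>
    have "in_span M a ?S (\<lambda>b. (- inverse s) * (M b j - s * ?u b))" using s by (rule in_span_smult)
    also have "(\<lambda>b. (- inverse s) * (M b j - s * ?u b)) = (\<lambda>b. M b (Suc j) - (inverse s - t) * M b j)"
      using False by (simp add: fun_eq_iff field_simps)
    finally show ?thesis using H2[OF a] by blast
  qed (use s in simp)
  have others: "in_span M' a {1..<k} (\<lambda>b. M' b k) \<longleftrightarrow> a < q k"
    if "k \<in> {1..n}" "k \<noteq> j" "k \<noteq> Suc j" "a \<le> n" for a k
  proof -
    have "in_span M' a {1..<k} (\<lambda>b. M' b k) \<longleftrightarrow> in_span M a {1..<k} (\<lambda>b. M b k)"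
      using that low[of k] high[of k] M'_other[of k] by (cases "k < j") auto
    then show ?thesis using ex that unfolding exact_def by auto
  qed
  have conclude: "exact M' q'"
    if "\<And>a. a \<le> n \<Longrightarrow> in_span M a ?S ?u \<longleftrightarrow> a < q' j"
      and "\<And>a. a \<le> n \<Longrightarrow> (\<exists>s. in_span M a ?S (\<lambda>b. M b j - s * ?u b)) \<longleftrightarrow> a < q' (Suc j)"
      and "\<And>k. k \<noteq> j \<Longrightarrow> k \<noteq> Suc j \<Longrightarrow> q' k = q k" for q'
    unfolding exact_def
  proof (intro ballI allI impI)
    fix k a assume "k \<in> {1..n}" "a \<le> n"
    then show "in_span M' a {1..<k} (\<lambda>b. M' b k) \<longleftrightarrow> a < q' k"
      using that T1 T2 others[of k a] by (cases "k = j"; cases "k = Suc j") auto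
  qed
  show "exact M' q" if no: "\<And>a. q j \<le> a \<Longrightarrow> a < q (Suc j) \<Longrightarrow> \<not> in_span M a ?S ?u"
  proof (rule conclude)
    fix a assume a: "a \<le> n"
    have split: "\<exists>s. in_span M a ?S (\<lambda>b. ?u b - (s + t) * M b j)" if lt: "a < q (Suc j)"
    proof -
      obtain s where s: "in_span M a ?S (\<lambda>b. M b (Suc j) - s * M b j)" using H2[OF a] lt by blast
      also have "(\<lambda>b. M b (Suc j) - s * M b j) = (\<lambda>b. ?u b - (s + t) * M b j)"
        by (simp add: fun_eq_iff algebra_simps)
      finally show ?thesis by blast
    qed
    show u: "in_span M a ?S ?u \<longleftrightarrow> a < q j"
    proof
      assume "in_span M a ?S ?u"
      then show "a < q j" using u_lt[OF a] no[of a] by force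
    next
      assume "a < q j"
      then obtain s where "in_span M a ?S (\<lambda>b. ?u b - (s + t) * M b j)" using split q by auto
      moreover have "in_span M a ?S (\<lambda>b. (s + t) * M b j)" using H1[OF a] \<open>a < q j\<close> by (intro in_span_smult) simp
      ultimately have "in_span M a ?S (\<lambda>b. (?u b - (s + t) * M b j) + (s + t) * M b j)" by (rule in_span_add)
      then show "in_span M a ?S ?u" by simp
    qed
    show "(\<exists>s. in_span M a ?S (\<lambda>b. M b j - s * ?u b)) \<longleftrightarrow> a < q (Suc j)"
    proof
      assume "\<exists>s. in_span M a ?S (\<lambda>b. M b j - s * ?u b)"
      then show "a < q (Suc j)" using T2_lt[OF a] H1[OF a] q by auto
    next
      assume less: "a < q (Suc j)"
      show "\<exists>s. in_span M a ?S (\<lambda>b. M b j - s * ?u b)"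
      proof (cases "a < q j")
        case True
        then show ?thesis using H1[OF a] by (auto intro!: exI[of _ 0])
      next
        case False
        obtain s where s: "in_span M a ?S (\<lambda>b. ?u b - (s + t) * M b j)" using split less by auto
        \<comment> \<open>For \<open>s + t = 0\<close> the vector \<open>?u\<close> itself would lie
          in the span, which is excluded as \<open>a\<close> is at least \<open>q j\<close>.\<close>
        then have ne: "s + t \<noteq> 0" using u False by auto
        have "in_span M a ?S (\<lambda>b. (- inverse (s + t)) * (?u b - (s + t) * M b j))"
          using s by (rule in_span_smult)
        also have "(\<lambda>b. (- inverse (s + t)) * (?u b - (s + t) * M b j)) = (\<lambda>b. M b j - inverse (s + t) * ?u b)"
        proof
          fix b
          have "(- inverse x) * (w - x * z) = z - inverse x * w" if "x \<noteq> 0" for x w z :: 'l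
            using that by (simp add: field_simps)
          from this[OF ne] show "(- inverse (s + t)) * (?u b - (s + t) * M b j) = M b j - inverse (s + t) * ?u b" .
        qed
        finally show ?thesis by blast
      qed
    qed
  qed simp
  show "exact M' (swap_at j q)" if yes: "in_span M (q (Suc j) - 1) ?S ?u"
  proof (rule conclude)
    fix a assume a: "a \<le> n"
    have u: "in_span M a ?S ?u \<longleftrightarrow> a < q (Suc j)"
      using u_lt[OF a] in_span_mono_rows[OF yes, of a] by auto
    then show "in_span M a ?S ?u \<longleftrightarrow> a < swap_at j q j" by simp
    show "(\<exists>s. in_span M a ?S (\<lambda>b. M b j - s * ?u b)) \<longleftrightarrow> a < swap_at j q (Suc j)"
    proof
      assume "\<exists>s. in_span M a ?S (\<lambda>b. M b j - s * ?u b)"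
      then obtain s where s: "in_span M a ?S (\<lambda>b. M b j - s * ?u b)" ..
      have "in_span M a ?S (\<lambda>b. M b j)"
      proof (cases "in_span M a ?S (\<lambda>b. M b j)")
        case False
        then have "in_span M a ?S (\<lambda>b. s * ?u b)" using T2_lt[OF a s] u by (intro in_span_smult) simp
        then have "in_span M a ?S (\<lambda>b. (M b j - s * ?u b) + s * ?u b)" by (rule in_span_add[OF s])
        then show ?thesis by simp
      qed simp
      then show "a < swap_at j q (Suc j)" using H1[OF a] by simp
    next
      assume "a < swap_at j q (Suc j)"
      then show "\<exists>s. in_span M a ?S (\<lambda>b. M b j - s * ?u b)" using H1[OF a] by (auto intro!: exI[of _ 0])
    qed
  qed simp
qed

section \<open>Generic points\<close>

definition mat_at :: "(nat \<Rightarrow> nat) \<Rightarrow> (pos \<Rightarrow> 'k::field rat_fun) \<Rightarrow> nat \<Rightarrow> nat \<Rightarrow> 'k rat_fun" where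
  "mat_at p \<xi> b k = cst.ev \<xi> (ent p b k)"

lemma ev_lminor: "cst.ev \<xi> (lminor (ent p) rs cs) = lminor (mat_at p \<xi>) rs cs"
  unfolding mat_at_def[abs_def] by (rule lminor_hom) (rule cst.ev.comm_ring_hom_axioms)

lemma exact_gens_vanish:
  assumes "exact (mat_at p \<xi>) q" "\<And>a k. rk q a k \<le> rk q' a k" "g \<in> gens p q'"
  shows "cst.ev \<xi> g = 0"
proof -
  obtain a k rs cs where rc: "a \<le> n" "k \<le> n" "set rs \<subseteq> {1..a}" "set cs \<subseteq> {1..k}"
    "length rs = length cs" "length cs = Suc (rk q' a k)" "g = lminor (ent p) rs cs"
    using assms(3) unfolding gens_def by blast
  then show ?thesis
    using exact_lminor_zero[OF assms(1) rc(1-5)] assms(2)[of a k] by (simp add: ev_lminor)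
qed

text \<open>Exactness makes all defining minors vanish at \<open>\<xi>\<close>. The second clause is
  the converse in the shape of a Groebner basis statement, so the desired conclusion itself passes
  through the induction.\<close>

definition generic_point :: "(nat \<Rightarrow> nat) \<Rightarrow> (nat \<Rightarrow> nat) \<Rightarrow> (pos \<Rightarrow> 'k::field rat_fun) \<Rightarrow> bool" where
  "generic_point p q \<xi> \<longleftrightarrow> exact (mat_at p \<xi>) q \<and>
     (\<forall>f. f \<noteq> 0 \<longrightarrow> pvars f \<subseteq> vars p \<longrightarrow> cst.ev \<xi> f = 0 \<longrightarrow> covers TYPE('k) p q (lm f))"

text \<open>By division with remainder, the polynomials vanishing at a generic point lie in the ideal of the minors.\<close>

lemma generic_point_specialize:
  fixes \<xi> :: "pos \<Rightarrow> 'k::field rat_fun"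
  assumes gp: "generic_point p q \<xi>" and \<zeta>: "\<And>g. g \<in> gens p q \<Longrightarrow> cst.ev \<zeta> g = 0"
    and "pvars f \<subseteq> vars p" "cst.ev \<xi> f = 0"
  shows "cst.ev \<zeta> f = 0"
proof -
  have "\<forall>f. lm f = m \<longrightarrow> pvars f \<subseteq> vars p \<longrightarrow> cst.ev \<xi> f = 0 \<longrightarrow> cst.ev \<zeta> f = 0" for m
  proof (induction m rule: wf_induct_rule[OF wf_lex_less[OF finite_vars[of p]]])
    case (1 m)
    show ?case
    proof (intro allI impI)
      fix f :: "'k pol" assume m: "lm f = m" and f: "pvars f \<subseteq> vars p" "cst.ev \<xi> f = 0"
      show "cst.ev \<zeta> f = 0"
      proof (cases "f = 0")
        case False
        then obtain g :: "'k pol" where g: "g \<in> gens p q" "g \<noteq> 0" "mdvd (lm g) (lm f)"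
          using gp f unfolding generic_point_def covers_def by blast
        then obtain c where c: "lm f = lm g + c" unfolding mdvd_def by blast
        define t where "t = lookup f (lm f) / lookup g (lm g)"
        \<comment> \<open>Cancelling the leading term with a multiple of a minor changes neither
          value, since the minor vanishes at both points.\<close>
        define h where "h = f - single c t * g"
        have lf: "lookup f (lm f) \<noteq> 0" "lookup g (lm g) \<noteq> 0"
          using lm_in_keys[OF False] lm_in_keys[OF g(2)] by (simp_all add: in_keys_iff)
        then have t: "t \<noteq> 0" by (simp add: t_def)
        have g0: "cst.ev \<xi> g = 0"
          using gp exact_gens_vanish[of p \<xi> q q g] g(1) unfolding generic_point_def by blast
        have keysV: "keys m' \<subseteq> vars p" if "m' \<in> keys f" for m' using that f(1) by (auto simp: pvars_def)
        have "keys c \<subseteq> keys (lm f)" unfolding c by (auto simp: in_keys_iff lookup_add)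
        then have cV: "keys c \<subseteq> vars p" using keysV[OF lm_in_keys[OF False]] by blast
        have hV: "pvars h \<subseteq> vars p"
          unfolding h_def diff_conv_add_uminus
          using f(1) pvars_gens[OF g(1)] cV pvars_single[of c t]
          by (intro pvars_add_subset) (simp_all add: pvars_mult_subset)
        have h\<xi>: "cst.ev \<xi> h = 0" using f(2) g0 by (simp add: h_def cst.ev.hom_minus cst.ev_mult)
        have h\<zeta>: "cst.ev \<zeta> h = cst.ev \<zeta> f" using \<zeta>[OF g(1)] by (simp add: h_def cst.ev.hom_minus cst.ev_mult)
        show ?thesis
        proof (cases "h = 0")
          case False
          have key: "lm h \<in> keys h" by (rule lm_in_keys[OF False])
          have "lookup h (lm f) = 0"
            using lf by (simp add: h_def lookup_minus c t_def lookup_single_mult add.commute[of "lm g"])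
          then have ne: "lm h \<noteq> lm f" using key by (auto simp: in_keys_iff)
          have "lex_less (lm h) (lm f)"
          proof (cases "lm h \<in> keys f")
            case True
            then show ?thesis using ne by (rule lm_max)
          next
            case False
            then have "lm h \<in> keys (single c t * g)" using key by (auto simp: h_def in_keys_iff lookup_minus)
            then obtain m' where m': "m' \<in> keys g" "lm h = c + m'" by (auto simp: keys_single_mult[OF t])
            then show ?thesis using ne lm_max[of m' g] by (auto simp: c add.commute[of "lm g"])
          qed
          moreover have "keys (lm h) \<subseteq> vars p" using key hV by (auto simp: pvars_def)
          moreover have "keys (lm f) \<subseteq> vars p" by (rule keysV[OF lm_in_keys[OF \<open>f \<noteq> 0\<close>]])
          ultimately have "(lm h, m) \<in> {(a, b). keys a \<subseteq> vars p \<and> keys b \<subseteq> vars p \<and> lex_less a b}"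
            using m by simp
          from 1[OF this] have "cst.ev \<zeta> h = 0" using hV h\<xi> by blast
          then show ?thesis using h\<zeta> by simp
        qed (use h\<zeta> in simp)
      qed simp
    qed
  qed
  then show ?thesis using assms(3,4) by blast
qed

text \<open>The surplus ones of \<open>p\<close> in the region give a minor of the required size.
  Ordered by columns it is unitriangular, because in every row the entries to the right of the 1 are
  0.\<close>

lemma one_in_gens:
  assumes p: "row_perm n p" and a: "a \<le> n" "k \<le> n" and less: "rk q a k < rk p a k"
  shows "1 \<in> gens p q"
proof -
  define B where "B = {l \<in> {1..k}. p l \<le> a}"
  define cs where "cs = take (Suc (rk q a k)) (sorted_list_of_set B)"
  have fin: "finite B" by (simp add: B_def)
  have len: "length cs = Suc (rk q a k)" using less by (simp add: cs_def B_def rk_def)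
  have sorted: "sorted_wrt (<) cs"
    unfolding cs_def by (intro sorted_wrt_take strict_sorted_list_of_set)
  have sub: "set cs \<subseteq> B" using fin set_take_subset unfolding cs_def by fastforce
  have "lminor (ent p) (map p cs) cs = (1 :: 'a pol)"
  proof (rule lminor_lower_triangular)
    fix i j assume ij: "i < j" "j < length cs"
    then have less: "cs ! i < cs ! j" using sorted by (simp add: sorted_wrt_iff_nth_less)
    have "cs ! i \<in> B" "cs ! j \<in> B" using ij sub by auto
    then have "cs ! i \<in> {1..n}" "cs ! j \<in> {1..n}" "cs ! i \<in> {1..<cs ! j}" using a less by (auto simp: B_def)
    then show "ent p (map p cs ! i) (cs ! j) = 0"
      using ij less row_perm_inj[OF p, of "cs ! i" "cs ! j"] by (auto simp: ent_def is_var_def)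
  qed (simp_all add: ent_def)
  moreover have "p l \<in> {1..a}" if "l \<in> B" for l
    using that row_perm_in[OF p, of l] a by (auto simp: B_def)
  then have "set (map p cs) \<subseteq> {1..a}" using sub by auto
  moreover have "set cs \<subseteq> {1..k}" using sub by (auto simp: B_def)
  ultimately show ?thesis
    unfolding gens_def using a len by (intro CollectI exI[of _ a] exI[of _ k] exI[of _ "map p cs"] exI[of _ cs]) simp
qed

lemma lm_one [simp]: "lm (1 :: 'k::field pol) = 0"
  by (rule lm_eqI) auto

end

section \<open>The induction step\<close>

context last_descent
begin

text \<open>The lifting property of the Bruhat order in terms of ranks. Only \<open>k = j\<close> is
  at stake: if \<open>q' j \<le> a\<close>, the bound at \<open>j - 1\<close> suffices; otherwise
  \<open>q'\<close> gains nothing between \<open>j - 1\<close> and \<open>j + 1\<close>, and the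
  bound at \<open>j + 1\<close> applies.\<close>

lemma rk_ps_le:
  assumes "\<And>a k. a \<le> n \<Longrightarrow> k \<le> n \<Longrightarrow> rk p a k \<le> rk q a k" and "q' = q \<or> q' = swap_at j q" and "q' j < q' (Suc j)"
    and "a \<le> n" "k \<le> n"
  shows "rk ps a k \<le> rk q' a k"
proof -
  have q': "rk q' a k = rk q a k" if "k \<noteq> j" for a k
    using assms(2) rk_swap_at[OF j(1) that] by auto
  show ?thesis
  proof (cases "k = j")
    case False
    then show ?thesis using assms(1)[OF assms(4,5)] q' rk_swap_at[OF j(1) False] by simp
  next
    case True
    obtain i where i: "j = Suc i" using j by (cases j) auto
    have "rk ps a i = rk p a i" "rk q' a i = rk q a i" using rk_swap_at[OF j(1), of i] q'[of i] i by auto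
    moreover have "rk p a (Suc j) \<le> rk q' a (Suc j)" "rk p a i \<le> rk q a i"
      using assms(1)[OF assms(4)] q'[of "Suc j" a] j i by auto
    ultimately show ?thesis
      using assms(3) desc True i by (auto simp: rk_Suc swap_at_def split: if_splits)
  qed
qed

lemma ev_update_y: "pvars f \<subseteq> vars ps \<Longrightarrow> cst.ev (\<xi>(y := t)) f = cst.ev \<xi> f"
  by (rule cst.ev_cong) (auto simp: vars_ps)

lemma mat_at_update_y:
  "k \<noteq> j \<Longrightarrow> k \<noteq> Suc j \<Longrightarrow> mat_at p (\<xi>(y := t)) b k = mat_at ps \<xi> b k"
  "mat_at p (\<xi>(y := t)) b (Suc j) = mat_at ps \<xi> b j"
  "mat_at p (\<xi>(y := t)) b j = mat_at ps \<xi> b (Suc j) + t * mat_at ps \<xi> b j"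
  by (simp_all add: mat_at_def ent_other ent_unit ent_j cst.ev_add cst.ev_mult ev_update_y[OF pvars_ent])

lemma covers_lead_coeff:
  fixes f :: "'k::field pol"
  assumes "covers TYPE('k) ps q' (lm (coeff_in y d f))" and "lm f = lm (coeff_in y d f) + single y d"
    and "q' j < q' (Suc j)" and "\<And>a k. k \<noteq> j \<Longrightarrow> rk q a k = rk q' a k"
  shows "covers TYPE('k) p q (lm f)"
proof -
  obtain g :: "'k pol" where g: "g \<in> gens ps q'" "g \<noteq> 0" "mdvd (lm g) (lm (coeff_in y d f))"
    using assms(1) unfolding covers_def by blast
  then have "covers TYPE('k) p q (lm g)" using covers_of_ps_gens assms(3,4) by blast
  moreover have "mdvd (lm g) (lm f)" unfolding assms(2) by (rule mdvd_trans[OF g(3) mdvd_add(1)])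
  ultimately show ?thesis by (rule covers_mdvd)
qed

text \<open>One factor \<open>y\<close> is consumed by the lifted minor, hence the positive
  exponent; the remaining ones are absorbed by divisibility.\<close>

lemma covers_y_lead_coeff:
  fixes f :: "'k::field pol"
  assumes "covers TYPE('k) ps q (lm (coeff_in y (Suc d) f))"
    and "lm f = lm (coeff_in y (Suc d) f) + single y (Suc d)" and "compat p"
  shows "covers TYPE('k) p q (lm f)"
proof -
  obtain g :: "'k pol" where g: "g \<in> gens ps q" "g \<noteq> 0" "mdvd (lm g) (lm (coeff_in y (Suc d) f))"
    using assms(1) unfolding covers_def by blast
  have "lm f = (single y 1 + lm (coeff_in y (Suc d) f)) + single y d"
    unfolding assms(2) using single_add[of y d "1::nat"] by (simp add: ac_simps)
  then have "mdvd (single y 1 + lm g) (lm f)"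
    using mdvd_trans[OF mdvd_add_right[OF g(3)] mdvd_add(1)] by simp
  then show ?thesis using covers_y_of_ps_gens[OF g(1,2) assms(3)] covers_mdvd by blast
qed

lemma generic_point_no_descent:
  fixes \<xi> :: "pos \<Rightarrow> 'k::field rat_fun"
  assumes compat: "compat p" and q: "row_perm n q" "q j < q (Suc j)" and gp: "generic_point ps q \<xi>"
  shows "\<exists>\<xi> :: pos \<Rightarrow> 'k rat_fun. generic_point p q \<xi>"
proof -
  let ?M = "mat_at ps \<xi>"
  let ?u = "\<lambda>t b. ?M b (Suc j) + t * ?M b j"
  let ?Y = "\<lambda>a. {t. in_span ?M a {1..<j} (?u t)}"
  have ex: "exact ?M q" using gp unfolding generic_point_def by blast
  have qn: "q (Suc j) \<le> n" using row_perm_in[OF q(1), of "Suc j"] j by simp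
  \<comment> \<open>For two different values of \<open>t\<close>, the difference of the two vectors
    is a nonzero multiple of column \<open>j\<close>, which is not in the span for
    \<open>a \<ge> q j\<close>. So each \<open>a\<close> excludes at most one value.\<close>
  have fin: "finite (?Y a)" if a: "q j \<le> a" "a < q (Suc j)" for a
  proof -
    have "t = t'" if "t \<in> ?Y a" "t' \<in> ?Y a" for t t'
    proof (rule ccontr)
      assume "t \<noteq> t'"
      have "in_span ?M a {1..<j} (\<lambda>b. ?u t b - ?u t' b)" using that by (intro in_span_diff) auto
      also have "(\<lambda>b. ?u t b - ?u t' b) = (\<lambda>b. (t - t') * ?M b j)" by (simp add: fun_eq_iff algebra_simps)
      finally have "in_span ?M a {1..<j} (\<lambda>b. ?M b j)" using \<open>t \<noteq> t'\<close> in_span_smult_iff[of "t - t'"] by simp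
      moreover have "j \<in> {1..n}" "a \<le> n" using j a qn by auto
      ultimately show False using ex a unfolding exact_def by fastforce
    qed
    then show ?thesis by (metis (no_types, lifting) finite.emptyI finite_insert finite_subset singletonI subsetI)
  qed
  have finY: "finite (\<Union>a\<in>{q j..<q (Suc j)}. ?Y a)" using fin by auto
  obtain t where t: "t \<notin> (\<Union>a\<in>{q j..<q (Suc j)}. ?Y a)"
    "\<forall>a D. (\<forall>d. pvars (a d) \<subseteq> vars ps) \<longrightarrow> (\<Sum>d\<le>D. cst.ev \<xi> (a d) * t ^ d) = 0 \<longrightarrow>
      (\<forall>d\<le>D. cst.ev \<xi> (a d) = 0)"
    using exists_transcendental[OF finite_vars[of ps] finY, of \<xi>] by (elim exE conjE) (rule that)
  have "exact (mat_at p (\<xi>(y := t))) q"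
    by (rule exact_swap(1)[OF j ex q(2) qn mat_at_update_y]) (use t(1) in auto)
  moreover have "covers TYPE('k) p q (lm f)"
    if f: "f \<noteq> 0" "pvars f \<subseteq> vars p" "cst.ev (\<xi>(y := t)) f = 0" for f :: "'k pol"
  proof -
    define d where "d = lookup (lm f) y"
    note lead = lm_coeff_in[OF top_var_y[OF compat] f(2,1), folded d_def]
    have sub: "pvars (coeff_in y e f) \<subseteq> vars ps" for e using pvars_coeff_in[of y e f] f(2) vars_ps by auto
    have "(\<Sum>e\<le>d. cst.ev \<xi> (coeff_in y e f) * t ^ e) = 0"
      using cst.ev_coeff_in[of f y d \<xi> t] lead(1) f(3) by simp
    then have "cst.ev \<xi> (coeff_in y d f) = 0" using t(2)[rule_format, of "\<lambda>e. coeff_in y e f" d d] sub by simp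
    then have "covers TYPE('k) ps q (lm (coeff_in y d f))"
      using gp lead(2) sub unfolding generic_point_def by blast
    then show ?thesis using covers_lead_coeff lead(3) q(2) by blast
  qed
  ultimately show ?thesis unfolding generic_point_def by blast
qed

text \<open>At a generic point \<open>\<xi>\<close> for \<open>q'\<close> the coordinate \<open>y\<close> is a quotient \<open>- c / e\<close> of two minors with
  \<open>c\<close> nonzero and \<open>e\<close> zero at a generic point \<open>\<zeta>\<close> for \<open>q\<close>. Clearing denominators and specializing from
  \<open>\<xi>\<close> to \<open>\<zeta>\<close> isolates the leading coefficient of \<open>f\<close> with respect to \<open>y\<close>.\<close>

lemma lead_coeff_vanishes:
  fixes \<xi> \<zeta> :: "pos \<Rightarrow> 'k::field rat_fun"
  assumes q: "row_perm n q" "q (Suc j) < q j"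
    and gp: "generic_point ps (swap_at j q) \<xi>" and gp': "generic_point ps q \<zeta>"
    and ex: "exact (mat_at p (\<xi>(y := t))) q"
    and f: "pvars f \<subseteq> vars p" "cst.ev (\<xi>(y := t)) f = 0" and d: "\<And>m. m \<in> keys f \<Longrightarrow> lookup m y \<le> d"
  shows "cst.ev \<zeta> (coeff_in y d f) = 0"
proof -
  let ?q' = "swap_at j q"
  \<comment> \<open>In the lowest \<open>?a\<close> rows the rank prescribed by \<open>q\<close>
    grows at column \<open>j + 1\<close> but not at column \<open>j\<close>. Hence \<open>c\<close>,
    which uses column \<open>j + 1\<close>, can be chosen nonzero at \<open>\<zeta>\<close>, while
    \<open>e\<close>, which uses column \<open>j\<close>, vanishes there.\<close>
  let ?a = "q (Suc j)"
  have an: "?a \<le> n" using row_perm_in[OF q(1), of "Suc j"] j by simp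
  have ex': "exact (mat_at ps \<zeta>) q" using gp' unfolding generic_point_def by blast
  obtain i where i: "j = Suc i" using j by (cases j) auto
  \<comment> \<open>The conditions of \<open>q\<close> are the stronger ones, so the minors for
    \<open>?q'\<close> also vanish at \<open>\<zeta>\<close>; this permits the specialization from
    \<open>\<xi>\<close> to \<open>\<zeta>\<close>.\<close>
  have "rk q a k \<le> rk ?q' a k" for a k
  proof (cases "k = j")
    case True
    have "rk ?q' a i = rk q a i" using rk_swap_at[OF j(1), of i] i by simp
    then show ?thesis using True q(2) i by (simp add: rk_Suc swap_at_def)
  qed (simp add: rk_swap_at[OF j(1)])
  then have \<zeta>: "cst.ev \<zeta> g = 0" if "g \<in> gens ps ?q'" for g
    using exact_gens_vanish[OF ex' _ that] by blast
  have spec: "cst.ev \<zeta> h = 0" if "pvars h \<subseteq> vars ps" "cst.ev \<xi> h = 0" for h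
    using generic_point_specialize[OF gp \<zeta> that] by blast
  \<comment> \<open>The pivot columns before \<open>j\<close>. As \<open>q j > ?a\<close>, they
    account for the whole rank of the first \<open>j\<close> columns.\<close>
  define B where "B = {l \<in> {1..<j}. q l \<le> ?a}"
  define cs where "cs = rev (sorted_list_of_set B)"
  have cs: "set cs = B" "sorted_wrt (>) cs" "length cs = card B"
    by (simp_all add: cs_def B_def sorted_wrt_rev strict_sorted_list_of_set)
  have notin: "j \<notin> set cs" "Suc j \<notin> set cs" by (auto simp: cs(1) B_def)
  have "{l \<in> {1..j}. q l \<le> ?a} = B" using q(2) by (auto simp: B_def le_less)
  then have r: "rk q ?a j = length cs" by (simp add: rk_def cs(3))
  have B: "l < j \<and> 1 \<le> l \<and> q l \<le> ?a" if "l \<in> B" for l using that by (simp add: B_def)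
  have "\<exists>rs. set rs \<subseteq> {1..?a} \<and> length rs = length (Suc j # cs) \<and> lminor (mat_at ps \<zeta>) rs (Suc j # cs) \<noteq> 0"
  proof (rule exact_lminor_nonzero[OF ex' an])
    show "sorted_wrt (>) (Suc j # cs)" using cs(1,2) B by fastforce
    show "set (Suc j # cs) \<subseteq> {1..n}" using cs(1) B j by fastforce
    show "q l \<le> ?a" if "l \<in> set (Suc j # cs)" for l using that cs(1) B by auto
  qed
  then obtain rs where rs: "set rs \<subseteq> {1..?a}" "length rs = Suc (length cs)"
    "lminor (mat_at ps \<zeta>) rs (Suc j # cs) \<noteq> 0" by auto
  define c :: "'k pol" where "c = lminor (ent ps) rs (Suc j # cs)"
  define e :: "'k pol" where "e = lminor (ent ps) rs (j # cs)"
  have vars: "pvars c \<subseteq> vars ps" "pvars e \<subseteq> vars ps"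
    unfolding c_def e_def by (intro pvars_lminor_ent; simp add: rs(2))+
  have c\<zeta>: "cst.ev \<zeta> c \<noteq> 0" using rs(3) by (simp add: c_def ev_lminor)
  have jn: "j \<le> n" using j by simp
  have csj: "set (j # cs) \<subseteq> {1..j}" using cs(1) B j by fastforce
  have e\<zeta>: "cst.ev \<zeta> e = 0"
    unfolding e_def ev_lminor
    by (rule exact_lminor_zero[OF ex' an jn rs(1) csj]) (simp_all add: rs(2) r)
  have "cst.ev (\<xi>(y := t)) (lminor (ent p) rs (j # cs)) = 0"
    unfolding ev_lminor by (rule exact_lminor_zero[OF ex an jn rs(1) csj]) (simp_all add: rs(2) r)
  then have "cst.ev (\<xi>(y := t)) (c + indet y * e) = 0"
    using lminor_j[OF rs(2) notin(1), where 'k = 'k] map_s_id[OF notin] by (simp add: c_def e_def)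
  then have "cst.ev \<xi> c + t * cst.ev \<xi> e = 0"
    using ev_update_y[OF vars(1), of \<xi> t] ev_update_y[OF vars(2), of \<xi> t]
    by (simp add: cst.ev_add cst.ev_mult)
  then have ce: "- cst.ev \<xi> c = t * cst.ev \<xi> e" by (rule minus_unique)
  \<comment> \<open>This is \<open>e ^ d\<close> times the result of substituting
    \<open>- c / e\<close> for \<open>y\<close> in \<open>f\<close>, written without denominators;
    it is free of \<open>y\<close>.\<close>
  define F where "F = (\<Sum>k\<le>d. coeff_in y k f * ((- c) ^ k * e ^ (d - k)))"
  have sub: "pvars (coeff_in y k f) \<subseteq> vars ps" for k using pvars_coeff_in[of y k f] f(1) vars_ps by auto
  have evF: "cst.ev \<eta> F = (\<Sum>k\<le>d. cst.ev \<eta> (coeff_in y k f) * ((- cst.ev \<eta> c) ^ k * cst.ev \<eta> e ^ (d - k)))" for \<eta>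
    unfolding F_def by (simp add: cst.ev_sum cst.ev_mult cst.ev.hom_power cst.ev.hom_uminus)
  have "cst.ev \<xi> F = (\<Sum>k\<le>d. cst.ev \<xi> (coeff_in y k f) * t ^ k) * cst.ev \<xi> e ^ d"
    unfolding evF ce sum_distrib_right
    by (intro sum.cong refl) (simp add: power_mult_distrib power_add[symmetric] mult.assoc)
  also have "\<dots> = 0" using cst.ev_coeff_in[of f y d \<xi> t] d f(2) by simp
  finally have "cst.ev \<zeta> F = 0"
    by (intro spec) (unfold F_def, intro pvars_sum_subset pvars_mult_subset pvars_power_subset sub,
        use vars in simp_all)
  \<comment> \<open>Every summand with \<open>k < d\<close> contains a factor \<open>e\<close>,
    which vanishes at \<open>\<zeta>\<close>.\<close>
  moreover have "cst.ev \<zeta> F = cst.ev \<zeta> (coeff_in y d f) * (- cst.ev \<zeta> c) ^ d"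
    unfolding evF e\<zeta> by (subst sum.remove[of _ d]) (auto intro!: sum.neutral)
  ultimately show ?thesis using c\<zeta> by simp
qed

text \<open>The hypothesis \<open>IH\<close> is conditional because \<open>ps\<close> may violate
  the rank conditions of \<open>q\<close>, in contrast to those of
  \<open>swap_at j q\<close>.\<close>

lemma generic_point_descent:
  fixes \<xi> :: "pos \<Rightarrow> 'k::field rat_fun"
  assumes compat: "compat p" and q: "row_perm n q" "q (Suc j) < q j" and gp: "generic_point ps (swap_at j q) \<xi>"
    and IH: "(\<And>a k. a \<le> n \<Longrightarrow> k \<le> n \<Longrightarrow> rk ps a k \<le> rk q a k) \<Longrightarrow>
      \<exists>\<zeta> :: pos \<Rightarrow> 'k rat_fun. generic_point ps q \<zeta>"
  shows "\<exists>\<xi> :: pos \<Rightarrow> 'k rat_fun. generic_point p q \<xi>"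
proof -
  let ?q' = "swap_at j q"
  let ?M = "mat_at ps \<xi>"
  have ex: "exact ?M ?q'" using gp unfolding generic_point_def by blast
  have q': "?q' j < ?q' (Suc j)" "?q' (Suc j) \<le> n" using q(2) row_perm_in[OF q(1), of j] j by auto
  have "in_span ?M (?q' (Suc j) - 1) {1..<Suc j} (\<lambda>b. ?M b (Suc j))"
  proof -
    have "Suc j \<in> {1..n}" "?q' (Suc j) - 1 \<le> n" "?q' (Suc j) - 1 < ?q' (Suc j)" using q' j by auto
    then show ?thesis using ex unfolding exact_def by blast
  qed
  moreover have "{1..<Suc j} = insert j {1..<j}" using j by auto
  ultimately have span: "in_span ?M (?q' (Suc j) - 1) (insert j {1..<j}) (\<lambda>b. ?M b (Suc j))" by (simp only:)
  have notin: "j \<notin> {1..<j}" by simp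
  \<comment> \<open>In the rows below \<open>?q' (Suc j)\<close>, column \<open>j + 1\<close>
    depends on the earlier columns, and \<open>s\<close> is the coefficient of column
    \<open>j\<close>. Taking \<open>t = - s\<close> leaves a dependence on the columns before
    \<open>j\<close> alone.\<close>
  obtain s where s: "in_span ?M (?q' (Suc j) - 1) {1..<j} (\<lambda>b. ?M b (Suc j) - s * ?M b j)"
    using iffD1[OF in_span_insert_iff[OF finite_atLeastLessThan notin] span] by (elim exE)
  define t where "t = - s"
  have "exact (mat_at p (\<xi>(y := t))) (swap_at j ?q')"
  proof (rule exact_swap(2)[OF j ex q' mat_at_update_y])
    show "in_span ?M (?q' (Suc j) - 1) {1..<j} (\<lambda>b. ?M b (Suc j) + t * ?M b j)"
      using s by (simp only: t_def mult_minus_left diff_conv_add_uminus)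
  qed
  then have ex': "exact (mat_at p (\<xi>(y := t))) q" by simp
  moreover have "covers TYPE('k) p q (lm f)"
    if f: "f \<noteq> 0" "pvars f \<subseteq> vars p" "cst.ev (\<xi>(y := t)) f = 0" for f :: "'k pol"
  proof -
    define d where "d = lookup (lm f) y"
    note lead = lm_coeff_in[OF top_var_y[OF compat] f(2,1), folded d_def]
    have sub: "pvars (coeff_in y e f) \<subseteq> vars ps" for e using pvars_coeff_in[of y e f] f(2) vars_ps by auto
    show ?thesis
    proof (cases d)
      \<comment> \<open>Here \<open>y\<close> does not occur in \<open>f\<close>, so the point for
        \<open>?q'\<close> decides.\<close>
      case 0
      have "cst.ev \<xi> (coeff_in y d f) = 0"
        using cst.ev_coeff_in[of f y d \<xi> t] lead(1) f(3) 0 by simp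
      then have "covers TYPE('k) ps ?q' (lm (coeff_in y d f))"
        using gp lead(2) sub unfolding generic_point_def by blast
      then show ?thesis using covers_lead_coeff lead(3) q'(1) rk_swap_at[OF j(1)] by metis
    next
      case (Suc e)
      have "covers TYPE('k) ps q (lm (coeff_in y d f))"
      proof (cases "\<forall>a\<le>n. \<forall>k\<le>n. rk ps a k \<le> rk q a k")
        case True
        then obtain \<zeta> :: "pos \<Rightarrow> 'k rat_fun" where gp': "generic_point ps q \<zeta>" using IH by blast
        have "cst.ev \<zeta> (coeff_in y d f) = 0"
          using lead_coeff_vanishes[OF q gp gp' ex' f(2,3) lead(1)] by blast
        then show ?thesis using gp' lead(2) sub unfolding generic_point_def by blast
      next
        \<comment> \<open>The constant 1 is then one of the minors, and its leading monomial divides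
          every monomial.\<close>
        case False
        then obtain a k where "a \<le> n" "k \<le> n" "rk q a k < rk ps a k" by (auto simp: not_le)
        then have "(1 :: 'k pol) \<in> gens ps q" using one_in_gens[OF ps] by blast
        then show ?thesis unfolding covers_def by (intro bexI[of _ 1]) auto
      qed
      then show ?thesis using covers_y_lead_coeff[of q e f] lead(3) compat unfolding Suc by blast
    qed
  qed
  ultimately show ?thesis unfolding generic_point_def by blast
qed

text \<open>The measure of the induction. The larger value moves to the column of smaller weight,
  and the sum drops by \<open>p j - p (Suc j)\<close>.\<close>

lemma sum_weight_ps: "(\<Sum>k\<in>{1..n}. (n - k) * ps k) < (\<Sum>k\<in>{1..n}. (n - k) * p k)"
proof -
  define m where "m = n - Suc j"
  have m: "n - j = Suc m" "n - Suc j = m" using j by (auto simp: m_def)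
  have "{1..n} = insert j (insert (Suc j) ({1..n} - {j, Suc j}))" using j by auto
  then have split: "(\<Sum>k\<in>{1..n}. g k) = g j + (g (Suc j) + (\<Sum>k\<in>{1..n} - {j, Suc j}. g k))" for g :: "nat \<Rightarrow> nat"
    by (metis Diff_iff finite_Diff finite_atLeastAtMost finite_insert insert_iff n_not_Suc_n sum.insert)
  have "(\<Sum>k\<in>{1..n} - {j, Suc j}. (n - k) * ps k) = (\<Sum>k\<in>{1..n} - {j, Suc j}. (n - k) * p k)"
    by (intro sum.cong) auto
  then show ?thesis unfolding split m using desc by (simp add: algebra_simps)
qed

end

section \<open>Base case and existence of generic points\<close>

context labelling
begin

text \<open>The identity has an empty diagram, and the rank conditions at \<open>(k, k)\<close>
  force \<open>q\<close> to agree with it. The matrix is a unit matrix and only constant polynomials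
  remain, so every \<open>\<xi>\<close> qualifies.\<close>

lemma generic_point_identity:
  fixes \<xi> :: "pos \<Rightarrow> 'k::field rat_fun"
  assumes p: "\<And>k. k \<in> {1..n} \<Longrightarrow> p k = k" and q: "row_perm n q"
    and rk: "\<And>a k. a \<le> n \<Longrightarrow> k \<le> n \<Longrightarrow> rk p a k \<le> rk q a k"
  shows "generic_point p q \<xi>"
proof -
  have no_var: "\<not> is_var p b k" for b k
  proof
    assume v: "is_var p b k"
    then have "b \<in> {1..<k}" "p b = b" using p by (auto simp: is_var_def)
    then show False using v by (metis image_eqI is_var_def)
  qed
  then have "vars p = {}" by (simp add: vars_def)
  have qk: "q k = k" if "k \<in> {1..n}" for k
    using that
  proof (induction k rule: less_induct)
    case (less k)
    have "{l \<in> {1..k}. p l \<le> k} = {1..k}" using less.prems p by auto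
    then have "card {1..k} \<le> card {l \<in> {1..k}. q l \<le> k}"
      using rk[of k k] less.prems by (simp add: rk_def)
    then have eq: "{l \<in> {1..k}. q l \<le> k} = {1..k}" by (intro card_seteq) auto
    have "k \<in> {1..k}" using less.prems by simp
    then have "k \<in> {l \<in> {1..k}. q l \<le> k}" unfolding eq .
    then have le: "q k \<le> k" by simp
    have "q k \<noteq> l" if "l \<in> {1..<k}" for l
      using that less row_perm_inj[OF q, of k l] by auto
    moreover have "q k \<in> {1..n}" using row_perm_in[OF q less.prems] .
    ultimately show ?case using le by (metis atLeastAtMost_iff atLeastLessThan_iff le_neq_implies_less)
  qed
  have M: "mat_at p \<xi> b k = (if b = k then 1 else 0)" if "k \<in> {1..n}" for b k
    using p[OF that] no_var by (simp add: mat_at_def ent_def)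
  have "exact (mat_at p \<xi>) q"
    unfolding exact_def
  proof (intro ballI allI impI)
    fix k a assume k: "k \<in> {1..n}" and a: "a \<le> n"
    show "in_span (mat_at p \<xi>) a {1..<k} (\<lambda>b. mat_at p \<xi> b k) \<longleftrightarrow> a < q k"
    proof
      assume "in_span (mat_at p \<xi>) a {1..<k} (\<lambda>b. mat_at p \<xi> b k)"
      then obtain \<mu> where \<mu>: "\<And>b. b \<in> {1..a} \<Longrightarrow> mat_at p \<xi> b k = (\<Sum>l\<in>{1..<k}. \<mu> l * mat_at p \<xi> b l)"
        unfolding in_span_def by blast
      have "(\<Sum>l\<in>{1..<k}. \<mu> l * mat_at p \<xi> k l) = 0"
        by (rule sum.neutral) (use k M in auto)
      then have "k \<notin> {1..a}" using \<mu>[of k] M[OF k, of k] by auto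
      then show "a < q k" using qk[OF k] k by auto
    next
      assume "a < q k"
      then have "in_span (mat_at p \<xi>) a {1..<k} (\<lambda>b. mat_at p \<xi> b k) \<longleftrightarrow> in_span (mat_at p \<xi>) a {1..<k} (\<lambda>b. 0)"
        by (intro in_span_cong) (use M[OF k] qk[OF k] in auto)
      then show "in_span (mat_at p \<xi>) a {1..<k} (\<lambda>b. mat_at p \<xi> b k)" using in_span_zero by blast
    qed
  qed
  moreover have "cst.ev \<xi> f \<noteq> 0" if f: "f \<noteq> 0" "pvars f \<subseteq> vars p" for f :: "'k pol"
  proof -
    have zero: "m = 0" if "m \<in> keys f" for m
    proof -
      have "keys m = {}" using that f(2) \<open>vars p = {}\<close> by (auto simp: pvars_def)
      then show ?thesis by simp
    qed
    obtain m where m: "m \<in> keys f" using f(1) by (metis ex_in_conv keys_eq_empty)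
    then have "keys f = {0}" using zero by blast
    then have "cst.ev \<xi> f = cst (lookup f 0)" "lookup f 0 \<noteq> 0" by (auto simp: cst.ev_def in_keys_iff)
    then show ?thesis by (simp add: cst_def) (metis lookup_single_eq lookup_zero)
  qed
  ultimately show ?thesis unfolding generic_point_def by blast
qed

text \<open>The largest descent is chosen because the exchange of columns relies on \<open>p\<close>
  being increasing to the right of it. Without descents \<open>p\<close> is the identity on
  \<open>{1..n}\<close>.\<close>

theorem exists_generic_point:
  assumes "row_perm n p" "row_perm n q" "compat p" "\<And>a k. a \<le> n \<Longrightarrow> k \<le> n \<Longrightarrow> rk p a k \<le> rk q a k"
  shows "\<exists>\<xi> :: pos \<Rightarrow> 'k::field rat_fun. generic_point p q \<xi>"
  using assms
proof (induction "\<Sum>k\<in>{1..n}. (n - k) * p k" arbitrary: p q rule: less_induct)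
  case less
  define J where "J = {j. 1 \<le> j \<and> j < n \<and> p (Suc j) < p j}"
  have step: "p k < p l" if nd: "\<And>i. k \<le> i \<Longrightarrow> i < n \<Longrightarrow> i \<notin> J" and "1 \<le> k" "k < l" "l \<le> n" for k l
  proof -
    have inc: "p i < p (Suc i)" if "k \<le> i" "i < n" for i
      using nd[OF that] row_perm_inj[OF less.prems(1), of i "Suc i"] that \<open>1 \<le> k\<close> by (force simp: J_def)
    show ?thesis using that(3,4)
    proof (induction l)
      case (Suc l)
      then show ?case using inc[of l] by (cases "k = l") auto
    qed simp
  qed
  show ?case
  proof (cases "J = {}")
    case True
    then have mono: "p k < p l" if "1 \<le> k" "k < l" "l \<le> n" for k l using step that by blast
    have ge: "k \<le> p k" if "k \<in> {1..n}" for k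
      using that
    proof (induction k)
      case (Suc k)
      show ?case
      proof (cases "k = 0")
        case True
        then show ?thesis using row_perm_in[OF less.prems(1) Suc.prems] by simp
      next
        case False
        then show ?thesis using Suc mono[of k "Suc k"] by simp
      qed
    qed simp
    have le: "p k \<le> k" if "k \<in> {1..n}" for k
    proof -
      have "p (n - i) \<le> n - i" if "i < n" for i
        using that
      proof (induction i)
        case 0
        then show ?case using row_perm_in[OF less.prems(1), of n] by simp
      next
        case (Suc i)
        have "p (n - Suc i) < p (n - i)" by (rule mono) (use Suc.prems in auto)
        then show ?case using Suc by simp
      qed
      from this[of "n - k"] show ?thesis using that by auto
    qed
    have "p k = k" if "k \<in> {1..n}" for k using ge[OF that] le[OF that] by simp
    \<comment> \<open>There are no indeterminates, so any point will do.\<close>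
    then have "generic_point p q (undefined :: pos \<Rightarrow> 'k rat_fun)"
      using less.prems by (intro generic_point_identity) auto
    then show ?thesis by blast
  next
    case False
    define j where "j = Max J"
    have fin: "finite J" unfolding J_def by (rule finite_subset[of _ "{..n}"]) auto
    have "j \<in> J" unfolding j_def using fin False by (rule Max_in)
    then have j: "1 \<le> j" "j < n" "p (Suc j) < p j" by (auto simp: J_def)
    have "i \<notin> J" if "j < i" for i using Max_ge[OF fin, of i] that unfolding j_def by fastforce
    then have inc: "p k < p l" if "j < k" "k < l" "l \<le> n" for k l
      using step[of k l] that j by auto
    interpret last_descent n lab p j
    proof
      show "row_perm n p" by (rule less.prems(1))
      show "p k < p l" if "j < k" "k < l" "l \<le> n" for k l by (rule inc[OF that])
    qed (rule j)+
    have IH: "\<exists>\<xi> :: pos \<Rightarrow> 'k rat_fun. generic_point ps r \<xi>"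
      if "row_perm n r" "\<And>a k. a \<le> n \<Longrightarrow> k \<le> n \<Longrightarrow> rk ps a k \<le> rk r a k" for r
      using less.hyps[OF sum_weight_ps ps that(1) compat_ps[OF less.prems(3)] that(2)] .
    have "q j \<noteq> q (Suc j)" using row_perm_inj[OF less.prems(2), of j "Suc j"] j by auto
    then consider "q j < q (Suc j)" | "q (Suc j) < q j" by linarith
    then show ?thesis
    proof cases
      case 1
      have "\<exists>\<xi> :: pos \<Rightarrow> 'k rat_fun. generic_point ps q \<xi>"
        using IH[OF less.prems(2)] rk_ps_le[OF less.prems(4), of q] 1 by blast
      then show ?thesis using generic_point_no_descent[OF less.prems(3,2) 1] by blast
    next
      case 2
      have "\<exists>\<xi> :: pos \<Rightarrow> 'k rat_fun. generic_point ps (swap_at j q) \<xi>"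
        using IH[OF row_perm_swap_at[OF less.prems(2) j(1,2)]] rk_ps_le[OF less.prems(4), of "swap_at j q"] 2 by auto
      then show ?thesis using generic_point_descent[OF less.prems(3,2) 2] IH[OF less.prems(2)] by blast
    qed
  qed
qed

end

section \<open>Essential minors suffice\<close>

context labelling
begin

text \<open>The Rothe diagram again, in a form that shows where neither the last row nor the last
  column of the region contributes to the rank.\<close>

definition diag :: "(nat \<Rightarrow> nat) \<Rightarrow> nat \<Rightarrow> nat \<Rightarrow> bool" where
  "diag q a k \<longleftrightarrow> a \<in> {1..n} \<and> k \<in> {1..n} \<and> a < q k \<and> a \<notin> q ` {1..k}"

definition cover_at :: "'k::field itself \<Rightarrow> (nat \<Rightarrow> nat) \<Rightarrow> (nat \<Rightarrow> nat) \<Rightarrow> nat \<Rightarrow> nat \<Rightarrow> monom \<Rightarrow> bool" where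
  "cover_at _ p q a k m \<longleftrightarrow> (\<exists>rs cs. set rs \<subseteq> {1..a} \<and> set cs \<subseteq> {1..k} \<and> length rs = length cs \<and>
     length cs = Suc (rk q a k) \<and> lminor (ent p) rs cs \<noteq> (0 :: 'k pol) \<and>
     mdvd (lm (lminor (ent p) rs cs :: 'k pol)) m)"

lemma rk_Suc_row:
  assumes q: "row_perm n q" and k: "k \<le> n"
  shows "rk q (Suc a) k = rk q a k + (if Suc a \<in> q ` {1..k} then 1 else 0)"
proof (cases "Suc a \<in> q ` {1..k}")
  case True
  then obtain l where l: "l \<in> {1..k}" "q l = Suc a" by auto
  have "{i \<in> {1..k}. q i \<le> Suc a} = insert l {i \<in> {1..k}. q i \<le> a}"
  proof
    show "{i \<in> {1..k}. q i \<le> Suc a} \<subseteq> insert l {i \<in> {1..k}. q i \<le> a}"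
    proof
      fix i assume i: "i \<in> {i \<in> {1..k}. q i \<le> Suc a}"
      then have "q i = q l \<longleftrightarrow> i = l" using row_perm_inj[OF q, of i l] l k by auto
      then show "i \<in> insert l {i \<in> {1..k}. q i \<le> a}" using i l by (auto simp: le_Suc_eq)
    qed
  qed (use l in auto)
  then show ?thesis using True l by (simp add: rk_def)
next
  case False
  have "q i \<noteq> Suc a" if "i \<in> {1..k}" for i using False that by (metis imageI)
  then have "{i \<in> {1..k}. q i \<le> Suc a} = {i \<in> {1..k}. q i \<le> a}" by (auto simp: le_Suc_eq)
  then show ?thesis using False by (simp add: rk_def)
qed

text \<open>Outside the diagram the last column or the last row raises the rank by one. Deleting it
  by Laplace expansion yields a minor for the smaller region whose leading monomial divides the
  given one.\<close>

lemma cover_at_diag: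
  assumes p: "row_perm n p" and q: "row_perm n q" and "a \<le> n" "k \<le> n" "cover_at TYPE('k::field) p q a k m"
  shows "\<exists>a k. diag q a k \<and> cover_at TYPE('k) p q a k m"
  using assms(3-)
proof (induction "a + k" arbitrary: a k rule: less_induct)
  case less
  obtain rs cs where rc: "set rs \<subseteq> {1..a}" "set cs \<subseteq> {1..k}" "length rs = length cs"
    "length cs = Suc (rk q a k)" "lminor (ent p) rs cs \<noteq> (0 :: 'k pol)"
    "mdvd (lm (lminor (ent p) rs cs :: 'k pol)) m"
    using less.prems(3) unfolding cover_at_def by blast
  \<comment> \<open>The minor has positive size, so neither bound is 0 and the descent has to stop
    inside the diagram.\<close>
  obtain a' where a: "a = Suc a'" using rc by (cases a; cases rs) auto
  obtain k' where k: "k = Suc k'" using rc by (cases k; cases cs) auto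
  consider "q k \<le> a" | "a \<in> q ` {1..k}" | "diag q a k"
    using less.prems a k unfolding diag_def by force
  then show ?case
  proof cases
    case 1
    then have "length cs = Suc (Suc (rk q a k'))" using rc(4) by (simp add: k rk_Suc)
    from shrink_cols[OF p rc(3,5) rc(2)[unfolded k] less.prems(2)[unfolded k] this]
    have "cover_at TYPE('k) p q a k' m"
      using rc(1,6) mdvd_trans unfolding cover_at_def by (meson order_trans)
    then show ?thesis using less.hyps[of a k'] less.prems k by simp
  next
    case 2
    then have "length cs = Suc (Suc (rk q a' k))" using rc(4) rk_Suc_row[OF q less.prems(2), of a'] a by simp
    moreover have "set cs \<subseteq> {1..n}" using rc(2) less.prems(2) by auto
    ultimately have "cover_at TYPE('k) p q a' k m"
      using shrink_rows[OF p rc(3,5) _ rc(1)[unfolded a]] rc(2,6) mdvd_trans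
      unfolding cover_at_def by (meson order_trans)
    then show ?thesis using less.hyps[of a' k] less.prems a by simp
  next
    case 3
    then show ?thesis using less.prems by blast
  qed
qed

text \<open>A step upwards or to the right within the diagram preserves the rank, so the same minor
  belongs to the larger region. Such steps end at an essential box.\<close>

lemma cover_at_essential:
  assumes q: "row_perm n q" and "diag q a k" "cover_at TYPE('k::field) p q a k m"
  shows "\<exists>a k. diag q a k \<and> \<not> diag q (Suc a) k \<and> \<not> diag q a (Suc k) \<and> cover_at TYPE('k) p q a k m"
  using assms(2-)
proof (induction "2 * n - (a + k)" arbitrary: a k rule: less_induct)
  case less
  have mono: "cover_at TYPE('k) p q a' k' m" if "rk q a' k' = rk q a k" "a \<le> a'" "k \<le> k'" for a' k'
  proof -
    have "{1..a} \<subseteq> {1..a'}" "{1..k} \<subseteq> {1..k'}" using that by auto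
    then show ?thesis using less.prems(2) that(1) unfolding cover_at_def by (metis order_trans)
  qed
  consider "diag q (Suc a) k" | "diag q a (Suc k)" | "\<not> diag q (Suc a) k" "\<not> diag q a (Suc k)" by blast
  then show ?case
  proof cases
    case 1
    then have "rk q (Suc a) k = rk q a k" using rk_Suc_row[OF q, of k a] by (auto simp: diag_def)
    moreover have "2 * n - (Suc a + k) < 2 * n - (a + k)" using 1 by (auto simp: diag_def)
    ultimately show ?thesis using less.hyps[of "Suc a" k] 1 mono[of "Suc a" k] by simp
  next
    case 2
    then have "rk q a (Suc k) = rk q a k" by (auto simp: diag_def rk_Suc)
    moreover have "2 * n - (a + Suc k) < 2 * n - (a + k)" using 2 by (auto simp: diag_def)
    ultimately show ?thesis using less.hyps[of a "Suc k"] 2 mono[of a "Suc k"] by simp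
  qed (use less.prems in blast)
qed

lemma covers_essential:
  assumes "row_perm n p" "row_perm n q" "covers TYPE('k::field) p q m"
  shows "\<exists>a k. diag q a k \<and> \<not> diag q (Suc a) k \<and> \<not> diag q a (Suc k) \<and> cover_at TYPE('k) p q a k m"
proof -
  obtain a k where "a \<le> n" "k \<le> n" "cover_at TYPE('k) p q a k m"
    using assms(3) unfolding covers_def gens_def cover_at_def by blast
  then show ?thesis using cover_at_diag[OF assms(1,2)] cover_at_essential[OF assms(2)] by blast
qed

end


section \<open>Kazhdan--Lusztig ideals\<close>

lemma bij_betw_pick:
  assumes "finite I"
  shows "bij_betw (pick I) {..<card I} I"
proof -
  have inj: "inj_on (pick I) {..<card I}"
    by (rule linorder_inj_onI') (metis lessThan_iff less_irrefl pick_mono_le)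
  have "pick I ` {..<card I} \<subseteq> I" using pick_in_set_le by auto
  then have "pick I ` {..<card I} = I" using assms inj by (intro card_subset_eq) (simp_all add: card_image)
  then show ?thesis using inj by (simp add: bij_betw_def)
qed

lemma pick_atLeastLessThan:
  assumes "r < b - a"
  shows "pick {a..<b} r = a + r"
proof -
  have "{x \<in> {a..<b}. x < a + r} = {a..<a + r}" using assms by auto
  then show ?thesis using pick_card_in_set[of "a + r" "{a..<b}"] assms by simp
qed

lemma pick_lessThan: "r < b \<Longrightarrow> pick {..<b} r = r"
  using pick_atLeastLessThan[of r b 0] by (simp add: atLeast0LessThan)

section \<open>Translation to the matrices and permutations of the statement\<close>

locale KL =
  fixes n :: nat and v w :: "nat \<Rightarrow> nat"
  assumes v: "v permutes {1..n}" and w: "w permutes {1..n}"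
begin

text \<open>The value \<open>k\<close> outside \<open>{1..n}\<close> makes this a permutation of all
  naturals, whose inverse is used for the labels.\<close>

definition rows_of :: "(nat \<Rightarrow> nat) \<Rightarrow> nat \<Rightarrow> nat" where
  "rows_of u k = (if k \<in> {1..n} then n - u k + 1 else k)"

lemma rows_of_eq: "k \<in> {1..n} \<Longrightarrow> rows_of u k = n - u k + 1"
  by (simp add: rows_of_def)

lemma permutes_range: "u permutes {1..n} \<Longrightarrow> k \<in> {1..n} \<Longrightarrow> u k \<in> {1..n}"
  using permutes_in_image by metis

lemma rows_of_permutes:
  assumes "u permutes {1..n}"
  shows "rows_of u permutes {1..n}"
proof (rule bij_imp_permutes)
  have inj: "inj_on (rows_of u) {1..n}"
  proof (rule inj_onI)
    fix k l assume kl: "k \<in> {1..n}" "l \<in> {1..n}" "rows_of u k = rows_of u l"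
    then have "n - u k + 1 = n - u l + 1" by (simp add: rows_of_eq)
    then have "u k = u l"
      using permutes_range[OF assms kl(1)] permutes_range[OF assms kl(2)]
      unfolding atLeastAtMost_iff by arith
    then show "k = l" using permutes_inj[OF assms] by (simp add: inj_eq)
  qed
  have "rows_of u ` {1..n} \<subseteq> {1..n}"
    using permutes_range[OF assms] by (fastforce simp: rows_of_eq)
  then have "rows_of u ` {1..n} = {1..n}" using inj by (intro card_subset_eq) (simp_all add: card_image)
  then show "bij_betw (rows_of u) {1..n} {1..n}" using inj by (simp add: bij_betw_def)
qed (auto simp: rows_of_def)

lemma row_perm_rows_of: "u permutes {1..n} \<Longrightarrow> row_perm n (rows_of u)"
  unfolding row_perm_def by (rule permutes_imp_bij[OF rows_of_permutes])

abbreviation "p \<equiv> rows_of v"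
abbreviation "q \<equiv> rows_of w"

lemmas p = row_perm_rows_of[OF v]
lemmas q = row_perm_rows_of[OF w]

text \<open>The column is recovered from the row of its 1, so the label of an indeterminate of
  \<open>p\<close> is its position.\<close>

definition pos_lab :: "nat \<Rightarrow> nat \<Rightarrow> pos" where
  "pos_lab b c = (b, inv_into UNIV p c)"

sublocale labelling n pos_lab
proof
  have "bij (inv_into UNIV p)" using permutes_bij[OF rows_of_permutes[OF v]] by (rule bij_imp_bij_inv)
  then show "pos_lab b c = pos_lab b' c' \<longleftrightarrow> b = b' \<and> c = c'" for b c b' c'
    by (auto simp: pos_lab_def dest: bij_is_inj injD)
qed

lemma pos_lab [simp]: "pos_lab b (p k) = (b, k)"
  using permutes_inverses(2)[OF rows_of_permutes[OF v]] by (simp add: pos_lab_def)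

lemma compat_p: "compat p"
  by (auto simp: compat_def indet_less_def)

lemma KL_one_pos_iff: "k \<in> {1..n} \<Longrightarrow> (b, k) \<in> KL_one_pos n v \<longleftrightarrow> b = p k"
  by (auto simp: KL_one_pos_def rows_of_eq)

lemma KL_zero_pos_iff:
  assumes "b \<in> {1..n}" "k \<in> {1..n}"
  shows "(b, k) \<in> KL_zero_pos n v \<longleftrightarrow> b \<in> p ` {1..<k} \<or> p k < b"
proof -
  have "(b, k) \<in> KL_zero_pos n v \<longleftrightarrow> (\<exists>l\<in>{1..n}. b = n - v l + 1 \<and> l < k) \<or> n - v k + 1 < b"
    using assms unfolding KL_zero_pos_def by blast
  also have "(\<exists>l\<in>{1..n}. b = n - v l + 1 \<and> l < k) \<longleftrightarrow> b \<in> p ` {1..<k}"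
    using assms by (force simp: rows_of_def)
  finally show ?thesis using assms by (simp add: rows_of_eq)
qed

lemma KL_entry_eq_ent:
  assumes "b \<in> {1..n}" "k \<in> {1..n}"
  shows "KL_entry n v (b, k) = ent p b k"
  unfolding KL_entry_def KL_one_pos_iff[OF assms(2)] KL_zero_pos_iff[OF assms] ent_def is_var_def
  using assms by auto

lemma KL_indet_pos_eq: "KL_indet_pos n v = vars p"
proof -
  have "(b, k) \<in> KL_indet_pos n v \<longleftrightarrow> is_var p b k" for b k
  proof (cases "b \<in> {1..n} \<and> k \<in> {1..n}")
    case True
    have "b \<noteq> p k" if "b \<in> p ` {1..<k}"
      using that row_perm_inj[OF p, of k] True by fastforce
    then show ?thesis
      using True KL_one_pos_iff[of k b] KL_zero_pos_iff[of b k] unfolding KL_indet_pos_def is_var_def by auto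
  qed (auto simp: KL_indet_pos_def is_var_def)
  then show ?thesis by (force simp: vars_def)
qed

lemma perm_rank_eq:
  assumes "a \<le> n" "k \<le> n"
  shows "perm_rank n w a k = rk q a k"
proof -
  have "w l \<ge> n - a + 1 \<longleftrightarrow> q l \<le> a" if "l \<in> {1..n}" for l
    using permutes_range[OF w that] that assms(1) by (auto simp: rows_of_eq)
  then have "{l \<in> {1..n}. l \<le> k \<and> w l \<ge> n - a + 1} = {l \<in> {1..k}. q l \<le> a}"
    using assms(2) by auto
  then show ?thesis by (simp add: perm_rank_def rk_def)
qed

lemma rothe_diagram_iff: "(a, k) \<in> rothe_diagram n w \<longleftrightarrow> diag q a k"
proof (cases "a \<in> {1..n} \<and> k \<in> {1..n}")
  case True
  define l where "l = inv_into UNIV w (n - a + 1)"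
  have wl: "w l = n - a + 1" using permutes_inverses(1)[OF w] by (simp add: l_def)
  have l: "l \<in> {1..n}" using permutes_in_image[OF w, of l] wl True by auto
  have "q l = a" using wl True l by (auto simp: rows_of_eq)
  then have "a \<in> q ` {1..k} \<longleftrightarrow> l \<le> k"
    using l True row_perm_inj[OF q, of _ l] by fastforce
  then show ?thesis using True by (auto simp: rothe_diagram_def diag_def rows_of_eq l_def)
qed (auto simp: rothe_diagram_def diag_def)

lemma dim_KL_southwest:
  assumes "i \<le> n" "j \<le> n"
  shows "dim_row (KL_southwest n v i j) = i" "dim_col (KL_southwest n v i j) = j"
proof -
  have "{r. r < n \<and> r \<in> {n - i..<n}} = {n - i..<n}" "{r. r < n \<and> r \<in> {..<j}} = {..<j}" using assms by auto
  then show "dim_row (KL_southwest n v i j) = i" "dim_col (KL_southwest n v i j) = j"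
    using assms by (simp_all add: KL_southwest_def dim_submatrix KL_matrix_def del: mem_Collect_eq)
qed

text \<open>Row \<open>r\<close> of the submatrix, counted from the top starting at 0, is row
  \<open>i - r\<close> from the bottom; the column index shifts by one.\<close>

lemma KL_southwest_index:
  assumes "i \<le> n" "j \<le> n" "r < i" "c < j"
  shows "KL_southwest n v i j $$ (r, c) = ent p (i - r) (Suc c)"
proof -
  have "KL_southwest n v i j $$ (r, c) = KL_matrix n v $$ (pick {n - i..<n} r, pick {..<j} c)"
    unfolding KL_southwest_def
    by (rule submatrix_index; simp only: assms(3,4) dim_KL_southwest[OF assms(1,2), unfolded KL_southwest_def dim_submatrix])
  also have "pick {n - i..<n} r = n - i + r" by (rule pick_atLeastLessThan) (use assms in simp)
  also have "pick {..<j} c = c" by (rule pick_lessThan[OF assms(4)])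
  also have "KL_matrix n v $$ (n - i + r, c) = KL_entry n v (i - r, Suc c)"
    using assms by (simp add: KL_matrix_def)
  also have "\<dots> = ent p (i - r) (Suc c)" by (rule KL_entry_eq_ent) (use assms in auto)
  finally show ?thesis .
qed

lemma det_submatrix_eq:
  assumes "i \<le> n" "j \<le> n" and I: "I \<subseteq> {..<i}" "card I = m" and J: "J \<subseteq> {..<j}" "card J = m"
  shows "det (submatrix (KL_southwest n v i j) I J) =
    lminor (ent p) (map (\<lambda>a. i - pick I a) [0..<m]) (map (\<lambda>b. Suc (pick J b)) [0..<m])"
proof -
  have eq: "{r. r < i \<and> r \<in> I} = I" "{c. c < j \<and> c \<in> J} = J" using I J by auto
  have in_I: "pick I a < i" if "a < m" for a using pick_in_set_le[of a I] that I by auto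
  have in_J: "pick J a < j" if "a < m" for a using pick_in_set_le[of a J] that J by auto
  show ?thesis
    unfolding lminor_def submatrix_def dim_KL_southwest[OF assms(1,2)] eq I(2) J(2)
    by (intro arg_cong[where f = det] cong_mat) (simp_all add: KL_southwest_index[OF assms(1,2)] in_I in_J)
qed

lemma minors_lminor:
  assumes "i \<le> n" "j \<le> n" "f \<in> minors m (KL_southwest n v i j)"
  shows "\<exists>rs cs. set rs \<subseteq> {1..i} \<and> set cs \<subseteq> {1..j} \<and> length rs = length cs \<and> length cs = m \<and>
    f = lminor (ent p) rs cs"
proof -
  obtain I J where IJ: "I \<subseteq> {..<i}" "J \<subseteq> {..<j}" "card I = m" "card J = m"
    "f = det (submatrix (KL_southwest n v i j) I J)"
    using assms(3) unfolding minors_def dim_KL_southwest[OF assms(1,2)] by blast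
  have "set (map (\<lambda>a. i - pick I a) [0..<m]) \<subseteq> {1..i}"
    using IJ(1,3) pick_in_set_le[of _ I] by fastforce
  moreover have "set (map (\<lambda>b. Suc (pick J b)) [0..<m]) \<subseteq> {1..j}"
    using IJ(2,4) pick_in_set_le[of _ J] by fastforce
  ultimately show ?thesis
    using det_submatrix_eq[OF assms(1,2) IJ(1,3,2,4)] IJ(5) by (intro exI conjI) auto
qed

text \<open>Nonvanishing excludes repeated indices, so the lists enumerate sets. A submatrix takes
  these sets in a fixed order, which can only affect the sign.\<close>

lemma lminor_minors:
  assumes ij: "i \<le> n" "j \<le> n" and rc: "set rs \<subseteq> {1..i}" "set cs \<subseteq> {1..j}" "length rs = length cs"
    "length cs = m" and nz: "lminor (ent p) rs cs \<noteq> (0 :: 'k::field pol)"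
  shows "\<exists>g\<in>minors m (KL_southwest n v i j). pm_eq g (lminor (ent p) rs cs :: 'k pol)"
proof -
  have dist: "distinct rs" "distinct cs" using lminor_nonzero_distinct[OF nz rc(3)] .
  define I where "I = (\<lambda>b. i - b) ` set rs"
  define J where "J = (\<lambda>k. k - 1) ` set cs"
  have "inj_on (\<lambda>b. i - b) (set rs)" using rc(1) by (intro inj_onI) (metis atLeastAtMost_iff diff_diff_cancel subsetD)
  then have cI: "card I = m" using dist rc by (simp add: I_def card_image distinct_card)
  have "inj_on (\<lambda>k. k - 1) (set cs)" using rc(2) by (intro inj_onI) (metis atLeastAtMost_iff le_add_diff_inverse subsetD)
  then have cJ: "card J = m" using dist rc by (simp add: J_def card_image distinct_card)
  have sub: "I \<subseteq> {..<i}" "J \<subseteq> {..<j}" using rc by (force simp: I_def J_def)+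
  let ?rs = "map (\<lambda>a. i - pick I a) [0..<m]" and ?cs = "map (\<lambda>b. Suc (pick J b)) [0..<m]"
  have bij: "bij_betw (pick I) {..<m} I" "bij_betw (pick J) {..<m} J"
    using bij_betw_pick[of I] bij_betw_pick[of J] cI cJ by (auto simp: I_def J_def)
  have "set ?rs = (\<lambda>x. i - x) ` I"
    using bij_betw_imp_surj_on[OF bij(1)] by (simp add: image_image[symmetric] atLeast0LessThan)
  also have "\<dots> = set rs"
    unfolding I_def image_image using rc(1) by (intro trans[OF image_cong image_ident]) auto
  finally have srs: "set ?rs = set rs" .
  have "set ?cs = Suc ` J"
    using bij_betw_imp_surj_on[OF bij(2)] by (simp add: image_image[symmetric] atLeast0LessThan)
  also have "\<dots> = set cs"
    unfolding J_def image_image using rc(2) by (intro trans[OF image_cong image_ident]) auto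
  finally have scs: "set ?cs = set cs" .
  have "mset ?rs = mset rs"
    using srs dist(1) rc(3,4) by (metis card_distinct length_map length_upt distinct_card minus_nat.diff_0 set_eq_iff_mset_eq_distinct)
  moreover have "mset ?cs = mset cs"
    using scs dist(2) rc(4) by (metis card_distinct length_map length_upt distinct_card minus_nat.diff_0 set_eq_iff_mset_eq_distinct)
  ultimately have "pm_eq (lminor (ent p) ?rs ?cs) (lminor (ent p) rs cs :: 'k pol)"
    using pm_eq_trans[OF lminor_permute_rows[of ?rs rs ?cs] lminor_permute_cols[of ?cs cs rs]] rc(3,4) by simp
  moreover have "det (submatrix (KL_southwest n v i j) I J) \<in> minors m (KL_southwest n v i j :: 'k pol mat)"
    unfolding minors_def dim_KL_southwest[OF ij] using sub cI cJ by blast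
  ultimately show ?thesis
    unfolding det_submatrix_eq[OF ij sub(1) cI sub(2) cJ] by blast
qed

lemma minors_subset_gens:
  assumes "i \<in> {1..n}" "j \<in> {1..n}"
  shows "minors (1 + perm_rank n w i j) (KL_southwest n v i j) \<subseteq> gens p q"
proof
  fix f :: "'a pol" assume f: "f \<in> minors (1 + perm_rank n w i j) (KL_southwest n v i j)"
  have ij: "i \<le> n" "j \<le> n" using assms by auto
  obtain rs cs where "set rs \<subseteq> {1..i}" "set cs \<subseteq> {1..j}" "length rs = length cs"
    "length cs = 1 + perm_rank n w i j" "f = lminor (ent p) rs cs"
    using minors_lminor[OF ij f] by blast
  then show "f \<in> gens p q"
    using ij unfolding gens_def perm_rank_eq[OF ij] plus_1_eq_Suc by blast
qed

section \<open>The Kazhdan--Lusztig ideal and its leading terms\<close>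

abbreviation R :: "'k::field pol ring" where "R \<equiv> pol_ring (vars p)"

lemma KL_ring_eq: "KL_ring n v = R"
  by (simp add: KL_ring_def KL_indet_pos_eq)

lemma carrier_R: "carrier R = {f. pvars f \<subseteq> vars p}"
  by (auto simp: pvars_def)

lemma ring_R: "ring (R :: 'k::field pol ring)"
  using cring_pol_ring cring.axioms(1) by blast

definition KL_gens :: "'k::field pol set" where
  "KL_gens = (\<Union>i\<in>{1..n}. \<Union>j\<in>{1..n}. minors (1 + perm_rank n w i j) (KL_southwest n v i j))"

lemma KL_ideal_eq: "KL_ideal n v w = Idl\<^bsub>R\<^esub> KL_gens"
  by (simp add: KL_ideal_def KL_gens_def KL_ring_eq)

lemma KL_gens_subset: "KL_gens \<subseteq> gens p q"
  unfolding KL_gens_def using minors_subset_gens by blast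

lemma KL_gens_carrier: "KL_gens \<subseteq> carrier (R :: 'k::field pol ring)"
  unfolding carrier_R using KL_gens_subset pvars_gens by blast

lemma essential_set_subset: "essential_set n w \<subseteq> {1..n} \<times> {1..n}"
  by (auto simp: essential_set_def rothe_diagram_def)

lemma essential_minors_subset: "essential_minors n v w \<subseteq> KL_gens"
  unfolding essential_minors_def KL_gens_def using essential_set_subset by blast

lemma finite_essential_minors: "finite (essential_minors n v w :: 'k::field pol set)"
proof -
  have "finite (minors m A)" for m and A :: "'k pol mat"
  proof -
    have "minors m A \<subseteq> (\<lambda>(I, J). det (submatrix A I J)) ` (Pow {..<dim_row A} \<times> Pow {..<dim_col A})"
      unfolding minors_def by auto
    then show ?thesis by (rule finite_subset) simp
  qed
  moreover have "finite (essential_set n w)" using essential_set_subset by (rule finite_subset) simp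
  ultimately show ?thesis by (auto simp: essential_minors_def)
qed

text \<open>This is the kernel of the evaluation at \<open>\<xi>\<close>, so it contains the whole
  ideal as soon as it contains the generators.\<close>

lemma vanishing_ideal:
  fixes \<xi> :: "pos \<Rightarrow> 'k::field rat_fun"
  shows "ideal {f. pvars f \<subseteq> vars p \<and> cst.ev \<xi> f = 0} R"
proof (rule idealI[OF ring_R])
  interpret ring "R :: 'k pol ring" by (rule ring_R)
  let ?I = "{f. pvars f \<subseteq> vars p \<and> cst.ev \<xi> f = 0}"
  show "subgroup ?I (add_monoid R)"
  proof
    show "inv\<^bsub>add_monoid R\<^esub> f \<in> ?I" if f: "f \<in> ?I" for f
    proof -
      have "\<ominus>\<^bsub>R\<^esub> f = - f" by (rule minus_equality) (use f carrier_R in auto)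
      then show ?thesis using f by (simp add: a_inv_def cst.ev.hom_uminus)
    qed
  qed (auto simp: carrier_R cst.ev_add pvars_add_subset simp del: pol_ring_simps(1))
qed (auto simp: carrier_R cst.ev_mult pvars_mult_subset simp del: pol_ring_simps(1))

text \<open>Under the rank conditions the ideal vanishes at a generic point, which controls its
  leading monomials; otherwise 1 belongs to \<open>gens p q\<close>.\<close>

lemma KL_ideal_covers:
  assumes f: "f \<in> KL_ideal n v w" "f \<noteq> (0 :: 'k::field pol)"
  shows "covers TYPE('k) p q (lm f)"
proof (cases "\<forall>a\<le>n. \<forall>k\<le>n. rk p a k \<le> rk q a k")
  case True
  then obtain \<xi> :: "pos \<Rightarrow> 'k rat_fun" where gp: "generic_point p q \<xi>"
    using exists_generic_point[OF p q compat_p] by blast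
  then have "cst.ev \<xi> g = 0" if "g \<in> gens p q" for g
    using exact_gens_vanish[of p \<xi> q q g] that unfolding generic_point_def by blast
  then have "KL_gens \<subseteq> {f. pvars f \<subseteq> vars p \<and> cst.ev \<xi> f = 0}"
    using KL_gens_subset pvars_gens by blast
  then have "KL_ideal n v w \<subseteq> {f. pvars f \<subseteq> vars p \<and> cst.ev \<xi> f = 0}"
    unfolding KL_ideal_eq by (rule ring.genideal_minimal[OF ring_R vanishing_ideal])
  then show ?thesis using f gp unfolding generic_point_def by blast
next
  case False
  then obtain a k where "a \<le> n" "k \<le> n" "rk q a k < rk p a k" by (auto simp: not_le)
  then have "(1 :: 'k pol) \<in> gens p q" using one_in_gens[OF p] by blast
  then show ?thesis unfolding covers_def by (intro bexI[of _ 1]) auto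
qed

lemma covers_essential_minor:
  assumes "covers TYPE('k::field) p q m"
  shows "\<exists>g\<in>essential_minors n v w :: 'k pol set. g \<noteq> 0 \<and> mdvd (lm g) m"
proof -
  obtain a k where ak: "diag q a k" "\<not> diag q (Suc a) k" "\<not> diag q a (Suc k)"
    and cov: "cover_at TYPE('k) p q a k m"
    using covers_essential[OF p q assms] by blast
  have le: "a \<le> n" "k \<le> n" using ak(1) by (auto simp: diag_def)
  have ess: "(a, k) \<in> essential_set n w"
    using ak by (simp add: essential_set_def rothe_diagram_iff)
  obtain rs cs where rc: "set rs \<subseteq> {1..a}" "set cs \<subseteq> {1..k}" "length rs = length cs"
    "length cs = 1 + perm_rank n w a k" "lminor (ent p) rs cs \<noteq> (0 :: 'k pol)"
    "mdvd (lm (lminor (ent p) rs cs :: 'k pol)) m"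
    using cov unfolding cover_at_def perm_rank_eq[OF le] by auto
  obtain g :: "'k pol" where g: "g \<in> minors (1 + perm_rank n w a k) (KL_southwest n v a k)"
    and pm: "pm_eq g (lminor (ent p) rs cs)"
    using lminor_minors[OF le rc(1-5)] by blast
  have "g \<in> essential_minors n v w" unfolding essential_minors_def using g ess by blast
  then show ?thesis using rc(5,6) pm_eq_zero[OF pm] pm_eq_lm[OF pm] by (intro bexI[of _ g]) simp_all
qed

text \<open>Over a field, divisibility of leading monomials makes one leading term a multiple of the
  other. The quotient involves only indeterminates of \<open>f\<close>, so it lies in the
  ring.\<close>

lemma lead_term_in_Idl:
  fixes f g :: "'k::field pol"
  assumes f: "pvars f \<subseteq> vars p" "f \<noteq> 0" and g: "g \<in> S" "g \<noteq> 0" "mdvd (lm g) (lm f)"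
    and S: "lead_term lex_less ` (S - {0}) \<subseteq> carrier R"
  shows "lead_term lex_less f \<in> Idl\<^bsub>R\<^esub> (lead_term lex_less ` (S - {0}))"
proof -
  interpret ring "R :: 'k pol ring" by (rule ring_R)
  obtain c where c: "lm f = lm g + c" using g(3) unfolding mdvd_def by blast
  have lg: "lookup g (lm g) \<noteq> 0" using lm_in_keys[OF g(2)] by (simp add: in_keys_iff)
  let ?s = "single c (lookup f (lm f) / lookup g (lm g)) :: 'k pol"
  have eq: "lead_term lex_less f = ?s * lead_term lex_less g"
    using lg by (simp add: lead_term_def mult_single c add.commute)
  have "keys c \<subseteq> keys (lm f)" unfolding c by (auto simp: in_keys_iff lookup_add)
  then have "keys c \<subseteq> vars p" using f lm_in_keys[OF f(2)] by (auto simp: pvars_def)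
  then have "?s \<in> carrier R" using carrier_R pvars_single[of c "lookup f (lm f) / lookup g (lm g)"] by auto
  moreover have "lead_term lex_less g \<in> Idl\<^bsub>R\<^esub> (lead_term lex_less ` (S - {0}))"
    using genideal_self[OF S] g by blast
  ultimately have "?s \<otimes>\<^bsub>R\<^esub> lead_term lex_less g \<in> Idl\<^bsub>R\<^esub> (lead_term lex_less ` (S - {0}))"
    using ideal.I_l_closed[OF genideal_ideal[OF S]] by blast
  then show ?thesis by (simp only: eq pol_ring_simps)
qed

lemma lead_term_carrier: "pvars f \<subseteq> vars p \<Longrightarrow> f \<noteq> 0 \<Longrightarrow> lead_term lex_less f \<in> carrier R"
  using lm_in_keys[of f] by (auto simp: lead_term_def pvars_def)

lemma KL_groebner_basis:
  "groebner_basis (KL_indet_pos n v) lex_less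
     (KL_ideal n v w :: 'k::field pol set) (essential_minors n v w)"
proof -
  interpret ring "R :: 'k pol ring" by (rule ring_R)
  let ?I = "KL_ideal n v w :: 'k pol set" and ?G = "essential_minors n v w :: 'k pol set"
  let ?lt = "\<lambda>S. lead_term lex_less ` (S - {0}) :: 'k pol set"
  have id: "ideal ?I R" unfolding KL_ideal_eq by (rule genideal_ideal[OF KL_gens_carrier])
  have GI: "?G \<subseteq> ?I"
    unfolding KL_ideal_eq using essential_minors_subset genideal_self[OF KL_gens_carrier] by blast
  have I: "pvars f \<subseteq> vars p" if "f \<in> ?I" for f
    using ideal.Icarr[OF id that] unfolding carrier_R by simp
  have ltI: "?lt ?I \<subseteq> carrier R" using I lead_term_carrier by blast
  have ltG: "?lt ?G \<subseteq> carrier R" using ltI GI by blast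
  have "?lt ?G \<subseteq> Idl\<^bsub>R\<^esub> (?lt ?I)" using GI genideal_self[OF ltI] by blast
  then have "Idl\<^bsub>R\<^esub> (?lt ?G) \<subseteq> Idl\<^bsub>R\<^esub> (?lt ?I)" by (rule genideal_minimal[OF genideal_ideal[OF ltI]])
  \<comment> \<open>This inclusion carries the content: every leading term of the ideal is a
    multiple of the leading term of an essential minor.\<close>
  moreover have "?lt ?I \<subseteq> Idl\<^bsub>R\<^esub> (?lt ?G)"
  proof
    fix h assume "h \<in> ?lt ?I"
    then obtain f where f: "f \<in> ?I" "f \<noteq> 0" "h = lead_term lex_less f" by blast
    obtain g where "g \<in> ?G" "g \<noteq> 0" "mdvd (lm g) (lm f)"
      using covers_essential_minor[OF KL_ideal_covers[OF f(1,2)]] by blast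
    then show "h \<in> Idl\<^bsub>R\<^esub> (?lt ?G)"
      unfolding f(3) using lead_term_in_Idl[OF I[OF f(1)] f(2) _ _ _ ltG] by blast
  qed
  then have "Idl\<^bsub>R\<^esub> (?lt ?I) \<subseteq> Idl\<^bsub>R\<^esub> (?lt ?G)" by (rule genideal_minimal[OF genideal_ideal[OF ltG]])
  ultimately show ?thesis
    unfolding groebner_basis_def KL_indet_pos_eq using finite_essential_minors GI by blast
qed

end

theorem mainTheorem1:
  fixes n :: nat and v w :: "nat \<Rightarrow> nat"
  assumes "v permutes {1..n}" and "w permutes {1..n}"
  shows "groebner_basis (KL_indet_pos n v) lex_less
           (KL_ideal n v w :: 'k::field pol set) (essential_minors n v w)"
  using KL.KL_groebner_basis[OF KL.intro[OF assms]] .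

end
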